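(* Let $\Omega\subset\mathbb{R}^N$ be a smooth bounded domain, $p>1$, let $\rho:\Omega\to\mathbb{R}$ be a bounded nonnegative function not identically zero, and let $f$ satisfy condition $(\mathcal C)$ and be such that $f^{-1/(p-1)}\in L^1(0,a)$ for every $0<a<a_f$. Let $u\in W^{1,p}_0(\Omega)\cap C^1(\Omega)$ be a positive supersolution of $-\Delta_p u=\rho(x)f(u)$ in $\Omega$, $u=0$ on $\partial\Omega$, with $0<u(x)<a_f$ for all $x\in\Omega$. Then: (i) $F(u(x))\ge\psi_\rho(x)$ for all $x\in\Omega$; (ii) for every $x\in\Omega$ and every $y$ with $|y-x|<d_\Omega(x)$, $$F(u(y))\ \ge\ \frac{p-1}{p}\,\rho_x\big(d_\Omega(x)\big)^{\frac1{p-1}}\,\frac{d_\Omega(x)^{\frac p{p-1}}-|x-y|^{\frac p{p-1}}}{N^{\frac1{p-1}}};$$ (iii) in particular, for all $x\in\Omega$, $$F(u(x))\ \ge\ \frac{p-1}{p}\Big(\frac{\rho_x(d_\Omega(x))\,d_\Omega(x)^p}{N}\Big)^{\frac1{p-1}}.$$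
   Context: $\Delta_p u=\operatorname{div}(|\nabla u|^{p-2}\nabla u)$. Condition $(\mathcal C)$: $f:[0,a_f)\to[0,\infty)$ with $0<a_f\le\infty$ is a nondecreasing $C^1$ function with $f(u)>0$ for $u>0$. A supersolution of $-\Delta_p u=\rho f(u)$ is $u\in W^{1,p}_0(\Omega)$ with $\rho f(u)\in L^1(\Omega)$ and $\int_\Omega|\nabla u|^{p-2}\nabla u\cdot\nabla\varphi\ge\int_\Omega\rho f(u)\varphi$ for all nonnegative $\varphi\in C_c^\infty(\Omega)$. $F(t)=\int_0^t f(s)^{-1/(p-1)}\,ds$ for $0\le t<a_f$. $\psi_\rho$ is the unique weak solution of $-\Delta_p\psi_\rho=\rho$ in $\Omega$, $\psi_\rho=0$ on $\partial\Omega$. $d_\Omega(x)=\operatorname{dist}(x,\partial\Omega)$, and $\rho_x(r)=\inf\{\rho(y):|y-x|<r\}$ for $0<r\le d_\Omega(x)$. *)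

theory Defs
  imports "HOL-Analysis.Analysis"
begin

definition pderiv_dir :: "('a::euclidean_space \<Rightarrow> real) \<Rightarrow> 'a \<Rightarrow> 'a \<Rightarrow> real" where
  "pderiv_dir g v x = frechet_derivative g (at x) v"

definition grad :: "('a::euclidean_space \<Rightarrow> real) \<Rightarrow> 'a \<Rightarrow> 'a" where
  "grad g x = (\<Sum>b\<in>Basis. pderiv_dir g b x *\<^sub>R b)"

fun Ck_on :: "nat \<Rightarrow> 'a::euclidean_space set \<Rightarrow> ('a \<Rightarrow> real) \<Rightarrow> bool" where
  "Ck_on 0 U g = continuous_on U g"
| "Ck_on (Suc k) U g = (continuous_on U g \<and> (\<forall>x\<in>U. g differentiable (at x)) \<and>
      (\<forall>b\<in>Basis. Ck_on k U (pderiv_dir g b)))"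

definition smooth_on :: "'a::euclidean_space set \<Rightarrow> ('a \<Rightarrow> real) \<Rightarrow> bool" where
  "smooth_on U g \<longleftrightarrow> (\<forall>k. Ck_on k U g)"

definition C1_on :: "'a::euclidean_space set \<Rightarrow> ('a \<Rightarrow> real) \<Rightarrow> bool" where
  "C1_on U g \<longleftrightarrow> (\<forall>x\<in>U. g differentiable (at x)) \<and> continuous_on U (grad g)"

definition smooth_bounded_domain :: "'a::euclidean_space set \<Rightarrow> bool" where
  "smooth_bounded_domain \<Omega> \<longleftrightarrow> open \<Omega> \<and> connected \<Omega> \<and> \<Omega> \<noteq> {} \<and> bounded \<Omega> \<and>
     (\<forall>z\<in>frontier \<Omega>. \<exists>U g. open U \<and> z \<in> U \<and> smooth_on U g \<and>
        (\<forall>x\<in>U. grad g x \<noteq> 0) \<and> \<Omega> \<inter> U = {x\<in>U. g x < 0})"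

definition test_fun :: "'a::euclidean_space set \<Rightarrow> ('a \<Rightarrow> real) \<Rightarrow> bool" where
  "test_fun \<Omega> \<phi> \<longleftrightarrow> smooth_on UNIV \<phi> \<and> compact (closure {x. \<phi> x \<noteq> 0}) \<and>
     closure {x. \<phi> x \<noteq> 0} \<subseteq> \<Omega>"

definition Lp_on :: "real \<Rightarrow> 'a::euclidean_space set \<Rightarrow> ('a \<Rightarrow> 'b::real_normed_vector) \<Rightarrow> bool" where
  "Lp_on p \<Omega> h \<longleftrightarrow> h \<in> borel_measurable (lebesgue_on \<Omega>) \<and>
     set_integrable lebesgue \<Omega> (\<lambda>x. norm (h x) powr p)"

definition weak_grad :: "'a::euclidean_space set \<Rightarrow> ('a \<Rightarrow> real) \<Rightarrow> ('a \<Rightarrow> 'a) \<Rightarrow> bool" where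
  "weak_grad \<Omega> u g \<longleftrightarrow>
     (\<forall>\<phi>. test_fun \<Omega> \<phi> \<longrightarrow> (\<forall>b\<in>Basis.
        (LINT x:\<Omega>|lebesgue. u x * pderiv_dir \<phi> b x) = - (LINT x:\<Omega>|lebesgue. (g x \<bullet> b) * \<phi> x)))"

definition sobolev0 :: "real \<Rightarrow> 'a::euclidean_space set \<Rightarrow> ('a \<Rightarrow> real) \<Rightarrow> ('a \<Rightarrow> 'a) \<Rightarrow> bool" where
  "sobolev0 p \<Omega> u g \<longleftrightarrow> Lp_on p \<Omega> u \<and> Lp_on p \<Omega> g \<and> weak_grad \<Omega> u g \<and>
     (\<exists>\<phi>s. (\<forall>k. test_fun \<Omega> (\<phi>s k)) \<and>
        (\<lambda>k. LINT x:\<Omega>|lebesgue. \<bar>\<phi>s k x - u x\<bar> powr p) \<longlonglongrightarrow> 0 \<and>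
        (\<lambda>k. LINT x:\<Omega>|lebesgue. norm (grad (\<phi>s k) x - g x) powr p) \<longlonglongrightarrow> 0)"

definition supersolution :: "real \<Rightarrow> 'a::euclidean_space set \<Rightarrow> ('a \<Rightarrow> real) \<Rightarrow> (real \<Rightarrow> real) \<Rightarrow> ('a \<Rightarrow> real) \<Rightarrow> bool" where
  "supersolution p \<Omega> \<rho> f u \<longleftrightarrow> (\<exists>g. sobolev0 p \<Omega> u g \<and>
     set_integrable lebesgue \<Omega> (\<lambda>x. \<rho> x * f (u x)) \<and>
     (\<forall>\<phi>. test_fun \<Omega> \<phi> \<and> (\<forall>x. 0 \<le> \<phi> x) \<longrightarrow>
        (LINT x:\<Omega>|lebesgue. (norm (g x) powr (p - 2) *\<^sub>R g x) \<bullet> grad \<phi> x)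
          \<ge> (LINT x:\<Omega>|lebesgue. \<rho> x * f (u x) * \<phi> x)))"

definition weak_solution_rhs :: "real \<Rightarrow> 'a::euclidean_space set \<Rightarrow> ('a \<Rightarrow> real) \<Rightarrow> ('a \<Rightarrow> real) \<Rightarrow> bool" where
  "weak_solution_rhs p \<Omega> \<rho> \<psi> \<longleftrightarrow> (\<exists>g. sobolev0 p \<Omega> \<psi> g \<and>
     (\<forall>\<phi>. test_fun \<Omega> \<phi> \<longrightarrow>
        (LINT x:\<Omega>|lebesgue. (norm (g x) powr (p - 2) *\<^sub>R g x) \<bullet> grad \<phi> x)
          = (LINT x:\<Omega>|lebesgue. \<rho> x * \<phi> x)))"

definition condC :: "(real \<Rightarrow> real) \<Rightarrow> ereal \<Rightarrow> bool" where
  "condC f af \<longleftrightarrow> 0 < af \<and>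
     (let S = {t. 0 \<le> t \<and> ereal t < af} in
        mono_on S f \<and>
        (\<exists>f'. (\<forall>t\<in>S. (f has_real_derivative f' t) (at t within S)) \<and> continuous_on S f') \<and>
        (\<forall>t\<in>S. 0 \<le> f t) \<and> (\<forall>t\<in>S. 0 < t \<longrightarrow> 0 < f t))"

definition Fint :: "real \<Rightarrow> (real \<Rightarrow> real) \<Rightarrow> real \<Rightarrow> real" where
  "Fint p f t = (LINT s:{0..t}|lborel. f s powr (- 1 / (p - 1)))"

definition dOmega :: "'a::euclidean_space set \<Rightarrow> 'a \<Rightarrow> real" where
  "dOmega \<Omega> x = infdist x (frontier \<Omega>)"

definition rho_inf :: "('a::euclidean_space \<Rightarrow> real) \<Rightarrow> 'a \<Rightarrow> real \<Rightarrow> real" where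
  "rho_inf \<rho> x r = (INF y\<in>ball x r. \<rho> y)"

end

theory Submission
  imports Defs
begin

text \<open>Write \<open>A(\<xi>) = |\<xi>|\<^bsup>p-2\<^esup> \<xi>\<close> and \<open>w = F(u)\<close>. Testing the inequality for \<open>u\<close> with \<open>\<theta> / f(u)\<close>
  shows that \<open>-\<Delta>\<^sub>p w \<ge> \<rho>\<close> weakly, tested with nonnegative compactly supported \<open>C\<^sup>1\<close> functions.
  For (ii), \<open>w\<close> is compared in the ball with the explicit radial solution of \<open>-\<Delta>\<^sub>p v = c\<close>, where
  \<open>c\<close> is the infimum of \<open>\<rho>\<close> there; (iii) is the value at the centre. For (i), \<open>w\<close> is compared with
  test functions that converge to \<open>\<psi>\<close>. In both cases the test function is a \<open>C\<^sup>1\<close> positive part of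
  the difference, and strict monotonicity of \<open>A\<close> together with a Poincare inequality shows that it
  vanishes (in (i), in the limit).\<close>

section \<open>Compactly supported functions of class \<open>C\<^sup>1\<close>\<close>

text \<open>The definitions test with smooth functions, whereas \<theta> / f(u) and positive parts
  of differences are only of class C^1. Hence the mollification: approximants close to a C^1
  function uniformly in value and gradient carry a weak inequality over as soon as flux and density
  are integrable. The obstacle is the boundary. Since f(u) may tend to 0 there, w need not inherit a
  global gradient bound from u; what remains of the boundary condition is w \<ge> 0, and it is
  exactly what gives the test functions compact support. In (i) there is a second difficulty: \<psi>
  has only a weak gradient and w only a local one, so neither can enter a test function of the
  other's equation directly, and the comparison runs through a limit with error terms. The exponent
  p/(p-1) in (ii) is the one for which A maps the gradient of a radial power to a linear field,
  whose divergence is constant; the dimension N under the root is the divergence of the identity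
  field. A Poincare inequality in L^1 suffices because only the vanishing of a nonnegative function,
  or of a limit of such functions, is drawn from it.\<close>

lemma has_derivative_grad:
  assumes "g differentiable (at x)"
  shows "(g has_derivative (\<lambda>h. grad g x \<bullet> h)) (at x)"
proof -
  have D: "(g has_derivative frechet_derivative g (at x)) (at x)"
    using assms frechet_derivative_works by blast
  have lin: "linear (frechet_derivative g (at x))"
    using D has_derivative_linear by blast
  have "frechet_derivative g (at x) h = grad g x \<bullet> h" for h
  proof -
    have "frechet_derivative g (at x) h = frechet_derivative g (at x) (\<Sum>b\<in>Basis. (h \<bullet> b) *\<^sub>R b)"
      by (simp add: euclidean_representation)
    also have "\<dots> = (\<Sum>b\<in>Basis. (h \<bullet> b) * frechet_derivative g (at x) b)"
      using lin by (simp add: linear_sum linear_scale)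
    also have "\<dots> = grad g x \<bullet> h"
      unfolding grad_def pderiv_dir_def inner_sum_left
      by (intro sum.cong) (auto simp: inner_commute mult.commute)
    finally show ?thesis .
  qed
  then have "frechet_derivative g (at x) = (\<lambda>h. grad g x \<bullet> h)" by auto
  with D show ?thesis by simp
qed

lemma grad_eqI:
  assumes "(g has_derivative (\<lambda>h. d \<bullet> h)) (at x)"
  shows "grad g x = d"
proof -
  have "frechet_derivative g (at x) = (\<lambda>h. d \<bullet> h)"
    using frechet_derivative_at[OF assms] by simp
  then show ?thesis
    unfolding grad_def pderiv_dir_def by (simp add: euclidean_representation)
qed

lemma pderiv_dir_eqI:
  assumes "(g has_derivative g') (at x)"
  shows "pderiv_dir g v x = g' v"
  unfolding pderiv_dir_def using frechet_derivative_at[OF assms] by simp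

lemma grad_inner_Basis:
  assumes "b \<in> Basis"
  shows "grad g x \<bullet> b = pderiv_dir g b x"
  using assms unfolding grad_def
  by (simp add: inner_sum_left inner_Basis if_distrib[of "\<lambda>x. _ * x"] sum.delta cong: if_cong)

text \<open>The gradient is an explicit argument, so that product and chain rules can supply it as a
  formula. Both functions are total and vanish off a compact part of \<open>U\<close>; integrals
  over \<open>U\<close> are then integrals over the whole space, where translation invariance is at
  hand.\<close>

definition C1c :: "'a::euclidean_space set \<Rightarrow> ('a \<Rightarrow> real) \<Rightarrow> ('a \<Rightarrow> 'a) \<Rightarrow> bool" where
  "C1c U v dv \<longleftrightarrow> (\<forall>x. (v has_derivative (\<lambda>h. dv x \<bullet> h)) (at x)) \<and> continuous_on UNIV dv \<and>
     (\<exists>K. compact K \<and> K \<subseteq> U \<and> (\<forall>x. x \<notin> K \<longrightarrow> v x = 0 \<and> dv x = 0))"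

lemma C1c_mono: "C1c U v dv \<Longrightarrow> U \<subseteq> V \<Longrightarrow> C1c V v dv"
  unfolding C1c_def by blast

lemma C1c_continuous: "C1c U v dv \<Longrightarrow> continuous_on UNIV v"
  unfolding C1c_def
  by (intro continuous_at_imp_continuous_on ballI) (meson has_derivative_continuous)

section \<open>Integrals of compactly supported functions and their derivatives\<close>

lemma compact_support_bounded:
  fixes f :: "'a::euclidean_space \<Rightarrow> 'b::real_normed_vector"
  assumes "compact K" "continuous_on K f" "\<And>x. x \<notin> K \<Longrightarrow> f x = 0"
  obtains B where "B > 0" "\<And>x. norm (f x) \<le> B"
proof -
  have "bounded (f ` K)" using assms compact_continuous_image compact_imp_bounded by blast
  then obtain B where B: "B > 0" "\<And>x. x \<in> K \<Longrightarrow> norm (f x) \<le> B"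
    unfolding bounded_pos by auto
  show ?thesis
  proof (rule that[of B])
    show "norm (f x) \<le> B" for x using B assms(3) by (cases "x \<in> K") auto
  qed (use B in auto)
qed

lemma compact_support_integrable:
  fixes f :: "'a::euclidean_space \<Rightarrow> 'b::euclidean_space"
  assumes "compact K" "continuous_on UNIV f" "\<And>x. x \<notin> K \<Longrightarrow> f x = 0"
  shows "integrable lborel f"
proof -
  have "set_integrable lborel K f"
    unfolding set_integrable_def using assms(1) continuous_on_subset[OF assms(2)]
    by (intro borel_integrable_compact) auto
  moreover have "indicator K x *\<^sub>R f x = f x" for x using assms(3) by (auto simp: indicator_def)
  ultimately show ?thesis unfolding set_integrable_def by simp
qed

lemma C1c_integrable:
  assumes "C1c U v dv"
  shows "integrable lborel v" "integrable lborel dv" "integrable lborel (\<lambda>x. norm (dv x))"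
proof -
  obtain K where K: "compact K" "\<And>x. x \<notin> K \<Longrightarrow> v x = 0" "\<And>x. x \<notin> K \<Longrightarrow> dv x = 0"
    using assms unfolding C1c_def by metis
  show "integrable lborel v" "integrable lborel dv"
    using K assms C1c_continuous compact_support_integrable unfolding C1c_def by blast+
  then show "integrable lborel (\<lambda>x. norm (dv x))" by simp
qed

text \<open>The integral of a difference quotient vanishes by translation invariance of Lebesgue measure;
  dominated convergence passes this on to the derivative without any use of Fubini.\<close>

lemma integral_C1c_derivative_0:
  fixes b :: "'a::euclidean_space"
  assumes C: "C1c U v dv"
  shows "(LINT x|lborel. dv x \<bullet> b) = 0"
proof -
  obtain K where K: "compact K" "\<And>x. x \<notin> K \<Longrightarrow> v x = 0" "\<And>x. x \<notin> K \<Longrightarrow> dv x = 0"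
    using C unfolding C1c_def by metis
  have cv: "continuous_on UNIV v" using C1c_continuous[OF C] .
  have cdv: "continuous_on UNIV dv" and dv: "\<And>x. (v has_derivative (\<lambda>h. dv x \<bullet> h)) (at x)"
    using C unfolding C1c_def by auto
  obtain B where B: "B > 0" "\<And>x. norm (dv x) \<le> B"
    using compact_support_bounded[OF K(1) continuous_on_subset[OF cdv subset_UNIV]] K(3) by blast
  obtain R where R: "\<And>x. x \<in> K \<Longrightarrow> norm x \<le> R"
    using K(1) compact_imp_bounded bounded_iff by metis
  define r where "r n = inverse (real (Suc n))" for n
  have r: "r n > 0" "r n \<le> 1" for n unfolding r_def by (auto simp: inverse_le_1_iff)
  have r0: "r \<longlonglongrightarrow> 0" unfolding r_def by (rule LIMSEQ_inverse_real_of_nat)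
  define q where "q n x = (v (x + r n *\<^sub>R b) - v x) / r n" for n x
  have mv: "v \<in> borel_measurable borel" using cv by (rule borel_measurable_continuous_onI)
  have iv: "integrable lborel v" using C1c_integrable[OF C] by simp
  have tr: "has_bochner_integral lborel (\<lambda>x. v (x + r n *\<^sub>R b)) (LINT x|lborel. v x)" for n
  proof -
    have *: "lborel = distr lborel borel ((+) (r n *\<^sub>R b))" by (simp add: lborel_distr_plus)
    have "integrable (distr lborel borel ((+) (r n *\<^sub>R b))) v" using iv * by simp
    then have 1: "integrable lborel (\<lambda>x. v (r n *\<^sub>R b + x))"
      using integrable_distr[of "(+) (r n *\<^sub>R b)" lborel borel v] by simp
    have "(LINT x|distr lborel borel ((+) (r n *\<^sub>R b)). v x) = (LINT x|lborel. v (r n *\<^sub>R b + x))"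
      using mv by (intro integral_distr) auto
    then have "(LINT x|lborel. v x) = (LINT x|lborel. v (r n *\<^sub>R b + x))" using * by simp
    with 1 show ?thesis by (simp add: has_bochner_integral_iff add.commute)
  qed
  have "has_bochner_integral lborel (q n) 0" for n
  proof -
    have "has_bochner_integral lborel (\<lambda>x. v (x + r n *\<^sub>R b) - v x) ((LINT x|lborel. v x) - (LINT x|lborel. v x))"
      using tr iv by (intro has_bochner_integral_diff) (auto simp: has_bochner_integral_iff)
    then have "has_bochner_integral lborel (\<lambda>x. (v (x + r n *\<^sub>R b) - v x) / r n) (((LINT x|lborel. v x) - (LINT x|lborel. v x)) / r n)"
      by (intro has_bochner_integral_divide_zero) auto
    then show ?thesis unfolding q_def by simp
  qed
  then have q0: "(LINT x|lborel. q n x) = 0" and qi: "integrable lborel (q n)" for n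
    by (auto simp: has_bochner_integral_iff)
  have "(\<lambda>n. LINT x|lborel. q n x) \<longlonglongrightarrow> (LINT x|lborel. dv x \<bullet> b)"
  proof (rule integral_dominated_convergence)
    show "(\<lambda>x. dv x \<bullet> b) \<in> borel_measurable lborel"
      using cdv by (auto intro!: borel_measurable_continuous_onI continuous_intros)
    show "q n \<in> borel_measurable lborel" for n using qi by auto
    \<comment> \<open>The steps \<open>r n\<close> are at most 1, so all translated supports stay in
      this ball; the mean value inequality bounds the quotient by \<open>B * norm b\<close>.\<close>
    show "integrable lborel (\<lambda>x. indicator (cball 0 (R + norm b)) x * (B * norm b))"
      using emeasure_bounded_finite[OF bounded_cball, of 0 "R + norm b"]
      by (intro integrable_mult_left integrable_real_indicator) auto
    show "AE x in lborel. (\<lambda>n. q n x) \<longlonglongrightarrow> dv x \<bullet> b"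
    proof (rule AE_I2)
      fix x
      have "((\<lambda>t. v (x + t *\<^sub>R b)) has_derivative (\<lambda>t. dv x \<bullet> (t *\<^sub>R b))) (at 0)"
      proof (rule has_derivative_compose[of "\<lambda>t. x + t *\<^sub>R b" "\<lambda>t. t *\<^sub>R b" 0 UNIV v "\<lambda>h. dv x \<bullet> h"])
        show "((\<lambda>t. x + t *\<^sub>R b) has_derivative (\<lambda>t. t *\<^sub>R b)) (at 0)"
          by (auto intro!: derivative_eq_intros)
      qed (use dv in auto)
      then have "((\<lambda>t. v (x + t *\<^sub>R b)) has_real_derivative (dv x \<bullet> b)) (at 0)"
        unfolding has_field_derivative_def by (rule has_derivative_eq_rhs) (auto simp: mult.commute)
      then have L: "((\<lambda>t. (v (x + t *\<^sub>R b) - v x) / t) \<longlongrightarrow> dv x \<bullet> b) (at 0)"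
        by (simp add: has_field_derivative_iff)
      have "filterlim r (at 0) sequentially"
        using r0 r(1) by (auto simp: filterlim_at intro!: always_eventually) (metis less_irrefl)
      from filterlim_compose[OF L this] show "(\<lambda>n. q n x) \<longlonglongrightarrow> dv x \<bullet> b"
        unfolding q_def by simp
    qed
    show "AE x in lborel. norm (q n x) \<le> indicator (cball 0 (R + norm b)) x * (B * norm b)" for n
    proof (rule AE_I2)
      fix x
      have lip: "\<bar>v (x + r n *\<^sub>R b) - v x\<bar> \<le> B * norm (r n *\<^sub>R b)"
      proof -
        have "norm (v (x + r n *\<^sub>R b) - v x) \<le> B * norm (x + r n *\<^sub>R b - x)"
        proof (rule differentiable_bound[of UNIV v "\<lambda>x h. dv x \<bullet> h"])
          show "onorm ((\<bullet>) (dv x)) \<le> B" for x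
          proof (rule onorm_bound)
            show "norm (dv x \<bullet> h) \<le> B * norm h" for h
              using Cauchy_Schwarz_ineq2[of "dv x" h] mult_right_mono[OF B(2)[of x] norm_ge_zero[of h]]
              by simp
          qed (use B in simp)
        qed (use dv in auto)
        then show ?thesis by simp
      qed
      show "norm (q n x) \<le> indicator (cball 0 (R + norm b)) x * (B * norm b)"
      proof (cases "x \<in> cball 0 (R + norm b)")
        case True
        have "norm (q n x) = \<bar>v (x + r n *\<^sub>R b) - v x\<bar> / r n" unfolding q_def using r[of n] by simp
        also have "\<dots> \<le> B * norm (r n *\<^sub>R b) / r n" using lip r[of n] by (intro divide_right_mono) auto
        also have "\<dots> = B * norm b" using r[of n] by simp
        finally show ?thesis using True by simp
      next
        case False
        then have nx: "norm x > R + norm b" by simp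
        have "norm (r n *\<^sub>R b) \<le> norm b" using r[of n] by (simp add: mult_left_le_one_le)
        then have "norm (x + r n *\<^sub>R b) > R"
          using nx norm_triangle_ineq2[of x "- (r n *\<^sub>R b)"] by simp
        then have "x + r n *\<^sub>R b \<notin> K" using R by force
        moreover have "x \<notin> K" using R nx norm_ge_zero[of b] by (metis add_increasing2 not_le)
        ultimately show ?thesis using K(2) False by (simp add: q_def)
      qed
    qed
  qed
  then show ?thesis using q0 LIMSEQ_unique by (simp add: LIMSEQ_const_iff)
qed

lemma C1c_mult:
  assumes C: "C1c U v dv" and g: "\<And>x. (g has_derivative (\<lambda>h. dg x \<bullet> h)) (at x)" "continuous_on UNIV dg"
  shows "C1c U (\<lambda>x. g x * v x) (\<lambda>x. v x *\<^sub>R dg x + g x *\<^sub>R dv x)"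
proof -
  have cg: "continuous_on UNIV g"
    by (intro continuous_at_imp_continuous_on ballI) (rule has_derivative_continuous[OF g(1)])
  have "((\<lambda>x. g x * v x) has_derivative (\<lambda>h. (v x *\<^sub>R dg x + g x *\<^sub>R dv x) \<bullet> h)) (at x)" for x
    using C unfolding C1c_def
    by (auto intro!: derivative_eq_intros g(1) simp: inner_add_left algebra_simps)
  moreover have "continuous_on UNIV (\<lambda>x. v x *\<^sub>R dg x + g x *\<^sub>R dv x)"
    using C C1c_continuous[OF C] cg g(2) unfolding C1c_def by (auto intro!: continuous_intros)
  moreover obtain K where "compact K" "K \<subseteq> U" "\<And>x. x \<notin> K \<Longrightarrow> v x = 0 \<and> dv x = 0"
    using C unfolding C1c_def by metis
  ultimately show ?thesis unfolding C1c_def by (intro conjI exI[of _ K]) auto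
qed

text \<open>The product of \<open>v\<close> with an affine coordinate is again compactly supported,
  so its derivative in direction \<open>b\<close> has integral 0. This serves twice: with one
  coordinate for the Poincare inequality, and with all of them for the linear flux of the
  barrier.\<close>

lemma integral_C1c_by_parts:
  assumes C: "C1c U v dv" and b: "b \<in> Basis"
  shows "(LINT x|lborel. ((x - a) \<bullet> b) * (dv x \<bullet> b)) = - (LINT x|lborel. v x)"
    and "integrable lborel (\<lambda>x. ((x - a) \<bullet> b) * (dv x \<bullet> b))"
proof -
  have C2: "C1c U (\<lambda>x. ((x - a) \<bullet> b) * v x) (\<lambda>x. v x *\<^sub>R b + ((x - a) \<bullet> b) *\<^sub>R dv x)"
    by (rule C1c_mult[OF C]) (auto intro!: derivative_eq_intros simp: inner_commute)
  have "(LINT x|lborel. (v x *\<^sub>R b + ((x - a) \<bullet> b) *\<^sub>R dv x) \<bullet> b) = 0"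
    by (rule integral_C1c_derivative_0[OF C2])
  moreover have e: "(v x *\<^sub>R b + ((x - a) \<bullet> b) *\<^sub>R dv x) \<bullet> b = v x + ((x - a) \<bullet> b) * (dv x \<bullet> b)" for x
    using b by (simp add: inner_add_left)
  ultimately have 0: "(LINT x|lborel. v x + ((x - a) \<bullet> b) * (dv x \<bullet> b)) = 0" by simp
  have "integrable lborel (\<lambda>x. (v x *\<^sub>R b + ((x - a) \<bullet> b) *\<^sub>R dv x) \<bullet> b)"
    using C1c_integrable(2)[OF C2] by (intro integrable_inner_left) auto
  then have i: "integrable lborel (\<lambda>x. v x + ((x - a) \<bullet> b) * (dv x \<bullet> b))" unfolding e .
  have iv: "integrable lborel v" using C1c_integrable[OF C] by simp
  from Bochner_Integration.integrable_diff[OF i iv]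
  show i2: "integrable lborel (\<lambda>x. ((x - a) \<bullet> b) * (dv x \<bullet> b))" by simp
  show "(LINT x|lborel. ((x - a) \<bullet> b) * (dv x \<bullet> b)) = - (LINT x|lborel. v x)"
    using 0 Bochner_Integration.integral_add[OF iv i2] by simp
qed

text \<open>One coordinate suffices: integrating \<open>v\<close> by parts against
  \<open>x \<bullet> b\<close> leaves a factor of size at most \<open>R\<close> on
  \<open>U\<close>.\<close>

lemma Poincare_C1c:
  assumes C: "C1c U v dv" and R: "\<And>x. x \<in> U \<Longrightarrow> norm x \<le> R"
  shows "(LINT x|lborel. v x) \<le> R * (LINT x|lborel. norm (dv x))"
proof -
  obtain b :: 'a where b: "b \<in> Basis" using nonempty_Basis by blast
  have "(LINT x|lborel. v x) = (LINT x|lborel. - (((x - 0) \<bullet> b) * (dv x \<bullet> b)))"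
    using integral_C1c_by_parts[OF C b, of 0] by simp
  also have "\<dots> \<le> (LINT x|lborel. R * norm (dv x))"
  proof (rule integral_mono)
    show "integrable lborel (\<lambda>x. - (((x - 0) \<bullet> b) * (dv x \<bullet> b)))"
      using integral_C1c_by_parts(2)[OF C b, of 0] by simp
    show "integrable lborel (\<lambda>x. R * norm (dv x))" using C1c_integrable[OF C] by simp
    fix x
    show "- (((x - 0) \<bullet> b) * (dv x \<bullet> b)) \<le> R * norm (dv x)"
    proof (cases "x \<in> U")
      case True
      have "\<bar>x \<bullet> b\<bar> * \<bar>dv x \<bullet> b\<bar> \<le> R * norm (dv x)"
        using R[OF True] b Basis_le_norm[OF b, of x] Basis_le_norm[OF b, of "dv x"]
        by (intro mult_mono) auto
      then show ?thesis by (simp add: abs_mult[symmetric])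
    next
      case False
      then have "dv x = 0" using C unfolding C1c_def by blast
      then show ?thesis by simp
    qed
  qed
  finally show ?thesis by simp
qed

text \<open>\<open>U\<close> and the complement of \<open>K\<close> are open and cover the space,
  and off \<open>K\<close> the extension is identically 0; differentiability and continuity are
  local.\<close>

lemma C1c_extend:
  assumes "open U" "compact K" "K \<subseteq> U"
    and d: "\<And>x. x \<in> U \<Longrightarrow> (v has_derivative (\<lambda>h. dv x \<bullet> h)) (at x)"
    and c: "continuous_on U dv"
    and z: "\<And>x. x \<in> U - K \<Longrightarrow> v x = 0 \<and> dv x = 0"
  shows "C1c U (\<lambda>x. if x \<in> U then v x else 0) (\<lambda>x. if x \<in> U then dv x else 0)"
proof -
  let ?v = "\<lambda>x. if x \<in> U then v x else 0" and ?d = "\<lambda>x. if x \<in> U then dv x else 0"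
  have oK: "open (- K)" using assms(2) compact_imp_closed by auto
  have "(?v has_derivative (\<lambda>h. ?d x \<bullet> h)) (at x)" for x
  proof (cases "x \<in> U")
    case True
    have "(?v has_derivative (\<lambda>h. dv x \<bullet> h)) (at x)"
      by (rule has_derivative_transform_within_open[OF d[OF True] assms(1) True]) auto
    then show ?thesis using True by simp
  next
    case False
    then have x: "x \<in> - K" using assms by auto
    have "(?v has_derivative (\<lambda>h. 0)) (at x)"
      by (rule has_derivative_transform_within_open[OF has_derivative_const[of 0] oK x]) (use z in auto)
    then show ?thesis using False by simp
  qed
  moreover have "continuous_on (U \<union> - K) ?d"
  proof (rule continuous_on_open_Un[OF assms(1) oK])
    show "continuous_on U ?d" using c by (auto cong: continuous_on_cong)
    have "continuous_on (- K) (\<lambda>x. 0::'a)" by auto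
    then show "continuous_on (- K) ?d" by (rule continuous_on_eq) (use z in auto)
  qed
  moreover have "U \<union> - K = UNIV" using assms by auto
  ultimately show ?thesis unfolding C1c_def using assms(2,3) z by (intro conjI exI[of _ K]) auto
qed

section \<open>Mollification\<close>

text \<open>For \<open>m = 0\<close> this is the classical function that is smooth and flat at 0.
  Powers of \<open>inverse t\<close> are what differentiation produces, so the derivative of each
  member is a combination of later members.\<close>

definition flat_exp :: "nat \<Rightarrow> real \<Rightarrow> real" where
  "flat_exp m t = (if t > 0 then exp (- inverse t) * inverse t ^ m else 0)"

lemma flat_exp_tendsto_0: "(flat_exp m \<longlongrightarrow> 0) (at 0)"
proof -
  have "((\<lambda>t. inverse t ^ m / exp (inverse t)) \<longlongrightarrow> (0::real)) (at_right 0)"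
    by (rule filterlim_compose[OF tendsto_power_div_exp_0 filterlim_inverse_at_top_right])
  moreover have "eventually (\<lambda>t. inverse t ^ m / exp (inverse t) = flat_exp m t) (at_right (0::real))"
    using eventually_at_right_less[of "0::real"]
    by eventually_elim (simp add: flat_exp_def exp_minus field_simps)
  ultimately have "(flat_exp m \<longlongrightarrow> 0) (at_right 0)"
    using Lim_transform_eventually by blast
  moreover have "eventually (\<lambda>t. 0 = flat_exp m t) (at_left (0::real))"
    unfolding eventually_at_left_field by (auto simp: flat_exp_def intro!: exI[of _ "-1"])
  then have "(flat_exp m \<longlongrightarrow> 0) (at_left 0)"
    using Lim_transform_eventually[OF tendsto_const] by blast
  ultimately show ?thesis by (simp add: filterlim_at_split)
qed

lemma DERIV_flat_exp:
  "(flat_exp m has_real_derivative (flat_exp (m + 2) t - real m * flat_exp (m + 1) t)) (at t)"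
proof (cases t "0::real" rule: linorder_cases)
  case less
  have "((\<lambda>x. 0) has_real_derivative 0) (at t)" by simp
  then have "(flat_exp m has_real_derivative 0) (at t)"
    by (rule has_field_derivative_transform_within_open[of _ _ _ "{..<0}"])
       (use less in \<open>auto simp: flat_exp_def\<close>)
  then show ?thesis using less by (simp add: flat_exp_def)
next
  case equal
  have "((\<lambda>h. flat_exp (m + 1) h) \<longlongrightarrow> 0) (at 0)" by (rule flat_exp_tendsto_0)
  \<comment> \<open>Dividing by \<open>h\<close> is one more factor \<open>inverse h\<close>: the
    difference quotient at 0 is the next member of the family, already known to tend to 0.\<close>
  moreover have "flat_exp (m + 1) h = (flat_exp m (0 + h) - flat_exp m 0) / h" for h
    by (simp add: flat_exp_def field_simps)
  ultimately have "(flat_exp m has_real_derivative 0) (at 0)"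
    unfolding DERIV_def by simp
  then show ?thesis using equal by (simp add: flat_exp_def)
next
  case greater
  have "((\<lambda>x. exp (- inverse x) * inverse x ^ m) has_real_derivative
      (flat_exp (m + 2) t - real m * flat_exp (m + 1) t)) (at t)"
  proof (cases m)
    case 0
    then show ?thesis using greater
      by (auto intro!: derivative_eq_intros simp: flat_exp_def field_simps power2_eq_square)
  next
    case (Suc k)
    then show ?thesis using greater
      by (auto intro!: derivative_eq_intros simp: flat_exp_def field_simps power2_eq_square)
         (cases k; simp)
  qed
  then show ?thesis
    by (rule has_field_derivative_transform_within_open[of _ _ _ "{0<..}"])
       (use greater in \<open>auto simp: flat_exp_def\<close>)
qed

text \<open>An algebra of functions that contains a bump supported in the ball of radius \<open>e\<close> and is
  closed under partial derivatives; all its members are therefore smooth.\<close>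

inductive_set bump_algebra :: "real \<Rightarrow> ('a::euclidean_space \<Rightarrow> real) set" for e where
  const: "(\<lambda>x. c) \<in> bump_algebra e"
| coord: "(\<lambda>x. x \<bullet> b) \<in> bump_algebra e"
| bump: "(\<lambda>x. flat_exp m (e\<^sup>2 - x \<bullet> x)) \<in> bump_algebra e"
| add: "f \<in> bump_algebra e \<Longrightarrow> g \<in> bump_algebra e \<Longrightarrow> (\<lambda>x. f x + g x) \<in> bump_algebra e"
| mult: "f \<in> bump_algebra e \<Longrightarrow> g \<in> bump_algebra e \<Longrightarrow> (\<lambda>x. f x * g x) \<in> bump_algebra e"

lemma bump_algebra_derivative:
  assumes "f \<in> bump_algebra e"
  shows "\<exists>f'. (\<forall>x. (f has_derivative f' x) (at x)) \<and> (\<forall>v. (\<lambda>x. f' x v) \<in> bump_algebra e)"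
  using assms
proof induction
  case (const c)
  show ?case by (intro exI[of _ "\<lambda>x v. 0"]) (auto intro: bump_algebra.const)
next
  case (coord b)
  show ?case
    by (intro exI[of _ "\<lambda>x v. v \<bullet> b"]) (auto intro: bump_algebra.const intro!: derivative_eq_intros)
next
  case (bump m)
  let ?d = "\<lambda>x. flat_exp (m + 2) (e\<^sup>2 - x \<bullet> x) - real m * flat_exp (m + 1) (e\<^sup>2 - x \<bullet> x)"
  let ?D = "\<lambda>x v. (flat_exp (m + 2) (e\<^sup>2 - x \<bullet> x) + (- real m) * flat_exp (m + 1) (e\<^sup>2 - x \<bullet> x)) * ((- 2) * (x \<bullet> v))"
  have "((\<lambda>x. flat_exp m (e\<^sup>2 - x \<bullet> x)) has_derivative ?D x) (at x)" for x :: 'a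
  proof -
    have "((\<lambda>x. e\<^sup>2 - x \<bullet> x) has_derivative (\<lambda>v. (- 2) * (x \<bullet> v))) (at x)"
      by (auto intro!: derivative_eq_intros simp: inner_commute)
    from has_derivative_compose[OF this DERIV_flat_exp[of m "e\<^sup>2 - x \<bullet> x", unfolded has_field_derivative_def]]
    show ?thesis by simp
  qed
  moreover have "(\<lambda>x. ?D x v) \<in> bump_algebra e" for v
    by (intro bump_algebra.mult bump_algebra.add bump_algebra.const bump_algebra.bump bump_algebra.coord)
  ultimately show ?case by (intro exI[of _ ?D]) blast
next
  case (add f g)
  then obtain f' g' where
    "\<And>x. (f has_derivative f' x) (at x)" "\<And>v. (\<lambda>x. f' x v) \<in> bump_algebra e"
    "\<And>x. (g has_derivative g' x) (at x)" "\<And>v. (\<lambda>x. g' x v) \<in> bump_algebra e" by blast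
  then show ?case
    by (intro exI[of _ "\<lambda>x v. f' x v + g' x v"]) (auto intro!: bump_algebra.intros has_derivative_add)
next
  case (mult f g)
  then obtain f' g' where *:
    "\<And>x. (f has_derivative f' x) (at x)" "\<And>v. (\<lambda>x. f' x v) \<in> bump_algebra e"
    "\<And>x. (g has_derivative g' x) (at x)" "\<And>v. (\<lambda>x. g' x v) \<in> bump_algebra e" by blast
  have "(\<lambda>x. f x * g' x v + f' x v * g x) \<in> bump_algebra e" for v
    by (intro bump_algebra.add bump_algebra.mult mult.hyps *)
  then show ?case
    using has_derivative_mult[OF *(1) *(3)]
    by (intro exI[of _ "\<lambda>x v. f x * g' x v + f' x v * g x"]) blast
qed

lemma bump_algebra_differentiable: "f \<in> bump_algebra e \<Longrightarrow> f differentiable (at x)"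
  using bump_algebra_derivative differentiable_def by blast

lemma bump_algebra_continuous: "f \<in> bump_algebra e \<Longrightarrow> continuous_on UNIV f"
  using bump_algebra_differentiable differentiable_imp_continuous_within
  by (intro continuous_at_imp_continuous_on) blast

lemma bump_algebra_pderiv:
  assumes "f \<in> bump_algebra e"
  shows "pderiv_dir f v \<in> bump_algebra e"
proof -
  obtain f' where f': "\<And>x. (f has_derivative f' x) (at x)" "\<And>v. (\<lambda>x. f' x v) \<in> bump_algebra e"
    using bump_algebra_derivative[OF assms] by blast
  have "pderiv_dir f v = (\<lambda>x. f' x v)" using pderiv_dir_eqI[OF f'(1)] by auto
  then show ?thesis using f' by simp
qed

lemma bump_algebra_continuous_grad:
  assumes "f \<in> bump_algebra e"
  shows "continuous_on UNIV (grad f)"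
  unfolding grad_def
  using bump_algebra_continuous[OF bump_algebra_pderiv[OF assms]] by (auto intro!: continuous_intros)

text \<open>The Leibniz rule for an integral over a box, with everything continuous. The rule takes
  derivatives with values in the bounded linear functions, hence \<open>blinfun_inner_right\<close>;
  the second half evaluates the resulting integral at a vector.\<close>

lemma convolution_bump_algebra_derivative:
  fixes \<theta> :: "'a::euclidean_space \<Rightarrow> real"
  assumes \<theta>: "continuous_on UNIV \<theta>" and \<eta>: "\<eta> \<in> bump_algebra e"
  shows "((\<lambda>x. integral (cbox a b) (\<lambda>y. \<theta> y * \<eta> (x - y))) has_derivative
    (\<lambda>v. integral (cbox a b) (\<lambda>y. \<theta> y * (grad \<eta> (x - y) \<bullet> v)))) (at x)"
proof -
  have d\<eta>: "(\<eta> has_derivative (\<lambda>h. grad \<eta> z \<bullet> h)) (at z)" for z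
    using has_derivative_grad bump_algebra_differentiable[OF \<eta>] by blast
  note c\<eta> = bump_algebra_continuous[OF \<eta>] and cg = bump_algebra_continuous_grad[OF \<eta>]
  let ?fx = "\<lambda>x y. \<theta> y *\<^sub>R blinfun_inner_right (grad \<eta> (x - y))"
  have "((\<lambda>x. integral (cbox a b) ((\<lambda>x y. \<theta> y * \<eta> (x - y)) x)) has_derivative
      integral (cbox a b) (?fx x)) (at x within UNIV)"
  proof (rule leibniz_rule)
    fix x y
    have "((\<lambda>x. \<eta> (x - y)) has_derivative (\<lambda>h. grad \<eta> (x - y) \<bullet> h)) (at x)"
      by (rule has_derivative_compose[of "\<lambda>x. x - y" "\<lambda>h. h", OF _ d\<eta>]) (auto intro!: derivative_eq_intros)
    then show "((\<lambda>x. \<theta> y * \<eta> (x - y)) has_derivative blinfun_apply (?fx x y)) (at x within UNIV)"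
      by (auto intro!: derivative_eq_intros simp: blinfun.scaleR_left)
  next
    show "(\<lambda>y. \<theta> y * \<eta> (x - y)) integrable_on cbox a b" for x
      by (intro integrable_continuous continuous_intros continuous_on_subset[OF \<theta>]
          continuous_on_compose2[OF c\<eta>]) auto
    show "continuous_on (UNIV \<times> cbox a b) (\<lambda>(x, y). ?fx x y)"
      unfolding case_prod_beta
      by (intro continuous_on_scaleR continuous_on_compose2[OF \<theta>] continuous_on_compose2[OF cg]
          bounded_linear.continuous_on[OF bounded_linear_blinfun_inner_right] continuous_intros) auto
  qed auto
  moreover have "blinfun_apply (integral (cbox a b) (?fx x)) v
      = integral (cbox a b) (\<lambda>y. \<theta> y * (grad \<eta> (x - y) \<bullet> v))" for v
  proof -
    have "?fx x integrable_on cbox a b"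
      by (intro integrable_continuous continuous_on_scaleR continuous_on_compose2[OF \<theta>] continuous_on_compose2[OF cg]
          bounded_linear.continuous_on[OF bounded_linear_blinfun_inner_right] continuous_intros) auto
    then show ?thesis by (simp add: blinfun_apply_integral blinfun.scaleR_left)
  qed
  ultimately show ?thesis by (elim has_derivative_eq_rhs) auto
qed

lemma convolution_bump_algebra_pderiv:
  assumes "continuous_on UNIV \<theta>" "\<eta> \<in> bump_algebra e" "v \<in> Basis"
  shows "pderiv_dir (\<lambda>x. integral (cbox a b) (\<lambda>y. \<theta> y * \<eta> (x - y))) v
    = (\<lambda>x. integral (cbox a b) (\<lambda>y. \<theta> y * pderiv_dir \<eta> v (x - y)))"
proof
  fix x
  show "pderiv_dir (\<lambda>x. integral (cbox a b) (\<lambda>y. \<theta> y * \<eta> (x - y))) v x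
    = integral (cbox a b) (\<lambda>y. \<theta> y * pderiv_dir \<eta> v (x - y))"
    using pderiv_dir_eqI[OF convolution_bump_algebra_derivative[OF assms(1,2)]]
    by (simp add: grad_inner_Basis[OF assms(3)])
qed

text \<open>Each derivative falls on the kernel and gives another member of
  \<open>bump_algebra\<close>, so the induction on the order of differentiability runs over all
  kernels at once.\<close>

lemma smooth_convolution:
  assumes "continuous_on UNIV \<theta>" "\<eta> \<in> bump_algebra e"
  shows "smooth_on UNIV (\<lambda>x. integral (cbox a b) (\<lambda>y. \<theta> y * \<eta> (x - y)))"
proof -
  have d: "(\<lambda>x. integral (cbox a b) (\<lambda>y. \<theta> y * \<eta> (x - y))) differentiable (at x)"
    if "\<eta> \<in> bump_algebra e" for x \<eta>
    using convolution_bump_algebra_derivative[OF assms(1) that] differentiable_def by blast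
  have c: "continuous_on UNIV (\<lambda>x. integral (cbox a b) (\<lambda>y. \<theta> y * \<eta> (x - y)))"
    if "\<eta> \<in> bump_algebra e" for \<eta>
    using d[OF that] differentiable_imp_continuous_within
    by (intro continuous_at_imp_continuous_on) blast
  have "Ck_on k UNIV (\<lambda>x. integral (cbox a b) (\<lambda>y. \<theta> y * \<eta> (x - y)))"
    if "\<eta> \<in> bump_algebra e" for k \<eta>
    using that
  proof (induction k arbitrary: \<eta>)
    case 0
    then show ?case using c by simp
  next
    case (Suc k)
    then show ?case
      using c d Suc.IH[OF bump_algebra_pderiv[OF Suc.prems]]
      by (simp add: convolution_bump_algebra_pderiv[OF assms(1) Suc.prems])
  qed
  then show ?thesis using assms(2) unfolding smooth_on_def by blast
qed

text \<open>Evenness replaces the reflection y -> x - y by the translation y -> y - x, under which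
  Lebesgue measure is invariant.\<close>

lemma integral_even_kernel:
  fixes \<eta> :: "'a::euclidean_space \<Rightarrow> real"
  assumes "\<eta> \<in> borel_measurable borel" "integrable lborel \<eta>" "\<And>z. \<eta> (- z) = \<eta> z"
  shows "integrable lborel (\<lambda>y. \<eta> (x - y))" "(LINT y|lborel. \<eta> (x - y)) = (LINT y|lborel. \<eta> y)"
proof -
  have *: "lborel = distr lborel borel ((+) (- x))" by (simp add: lborel_distr_plus)
  have e: "\<eta> (x - y) = \<eta> (- x + y)" for y using assms(3)[of "x - y"] by simp
  have "integrable (distr lborel borel ((+) (- x))) \<eta>" using assms(2) * by simp
  then show "integrable lborel (\<lambda>y. \<eta> (x - y))"
    unfolding e using integrable_distr[of "(+) (- x)" lborel borel \<eta>] by simp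
  have "(LINT y|distr lborel borel ((+) (- x)). \<eta> y) = (LINT y|lborel. \<eta> (- x + y))"
    using assms(1) by (intro integral_distr) auto
  then show "(LINT y|lborel. \<eta> (x - y)) = (LINT y|lborel. \<eta> y)" unfolding e using * by simp
qed

text \<open>The kernel charges only points closer than \<open>d\<close> to \<open>x\<close>. It is
  not normalised, so its mass appears on both sides and is divided out later.\<close>

lemma kernel_average_close:
  fixes \<theta> :: "'a::euclidean_space \<Rightarrow> real"
  assumes m: "\<eta> \<in> borel_measurable borel" and i: "integrable lborel \<eta>" and ev: "\<And>z. \<eta> (- z) = \<eta> z"
    and nn: "\<And>z. 0 \<le> \<eta> z" and supp: "\<And>z. d \<le> norm z \<Longrightarrow> \<eta> z = 0"
    and iq: "integrable lborel (\<lambda>y. \<theta> y * \<eta> (x - y))"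
    and close: "\<And>y. dist y x < d \<Longrightarrow> \<bar>\<theta> y - \<theta> x\<bar> \<le> e"
  shows "\<bar>(LINT y|lborel. \<theta> y * \<eta> (x - y)) - \<theta> x * (LINT y|lborel. \<eta> y)\<bar> \<le> e * (LINT y|lborel. \<eta> y)"
proof -
  note k = integral_even_kernel[OF m i ev, of x]
  have "(LINT y|lborel. \<theta> y * \<eta> (x - y)) - \<theta> x * (LINT y|lborel. \<eta> y)
      = (LINT y|lborel. \<theta> y * \<eta> (x - y) - \<theta> x * \<eta> (x - y))"
    using k iq by (subst Bochner_Integration.integral_diff) auto
  moreover have "\<bar>(LINT y|lborel. \<theta> y * \<eta> (x - y) - \<theta> x * \<eta> (x - y))\<bar> \<le> (LINT y|lborel. e * \<eta> (x - y))"
  proof (rule integral_abs_bound_integral)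
    fix y
    show "\<bar>\<theta> y * \<eta> (x - y) - \<theta> x * \<eta> (x - y)\<bar> \<le> e * \<eta> (x - y)"
    proof (cases "dist y x < d")
      case True
      have "\<theta> y * \<eta> (x - y) - \<theta> x * \<eta> (x - y) = (\<theta> y - \<theta> x) * \<eta> (x - y)" by (simp add: algebra_simps)
      then show ?thesis
        using mult_right_mono[OF close[OF True] nn[of "x - y"]] nn[of "x - y"] by (simp add: abs_mult)
    next
      case False
      then have "\<eta> (x - y) = 0" by (intro supp) (simp add: dist_norm norm_minus_commute)
      then show ?thesis by simp
    qed
  qed (use k iq in auto)
  ultimately show ?thesis using k by simp
qed

text \<open>The compact set containing the supports does not depend on the accuracy.\<close>

lemma smooth_approximation:
  fixes \<theta> :: "'a::euclidean_space \<Rightarrow> real"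
  assumes U: "open U" and K: "compact K" "K \<subseteq> U"
    and \<theta>: "continuous_on UNIV \<theta>" "\<And>x. x \<notin> K \<Longrightarrow> \<theta> x = 0"
  obtains L where "compact L" "L \<subseteq> U"
    "\<forall>e>0. \<exists>\<phi>. smooth_on UNIV \<phi> \<and> (\<forall>x. x \<notin> L \<longrightarrow> \<phi> x = 0) \<and>
       (\<forall>x. \<bar>\<phi> x - \<theta> x\<bar> \<le> e) \<and> ((\<forall>x. 0 \<le> \<theta> x) \<longrightarrow> (\<forall>x. 0 \<le> \<phi> x)) \<and>
       (\<forall>d\<theta>. C1c U \<theta> d\<theta> \<longrightarrow> (\<forall>x. norm (grad \<phi> x - d\<theta> x) \<le> e))"
proof -
  obtain r where r: "r > 0" "(\<Union>x\<in>K. ball x r) \<subseteq> U"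
    using compact_subset_open_imp_ball_epsilon_subset[OF K(1) U K(2)] .
  \<comment> \<open>The kernels will have support radius at most \<open>r / 2\<close>, so this fixed
    neighbourhood of \<open>K\<close> contains the supports of all approximants.\<close>
  define L where "L = {x + y | x y. x \<in> K \<and> y \<in> cball 0 (r / 2)}"
  have L: "compact L" unfolding L_def by (rule compact_sums[OF K(1) compact_cball])
  have LU: "L \<subseteq> U"
  proof
    fix z assume "z \<in> L"
    then obtain x y where "z = x + y" "x \<in> K" "norm y \<le> r / 2" unfolding L_def by auto
    then have "z \<in> ball x r" using r by (simp add: dist_norm)
    with \<open>x \<in> K\<close> show "z \<in> U" using r(2) by blast
  qed
  \<comment> \<open>Uniform continuity on a unit neighbourhood of the support extends to the whole
    space: of two points closer than 1, either both lie in \<open>Q\<close> or both values are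
    0.\<close>
  have unif: "\<exists>d>0. \<forall>x y. dist y x < d \<longrightarrow> dist (h y) (h x) \<le> e"
    if e: "0 < e" and h: "continuous_on UNIV h" "\<And>x. x \<notin> K' \<Longrightarrow> h x = 0" and K': "compact K'"
    for e and h :: "'a \<Rightarrow> 'b::real_normed_vector" and K'
  proof -
    define Q where "Q = {x + y | x y. x \<in> K' \<and> y \<in> cball 0 (1::real)}"
    have "compact Q" unfolding Q_def by (rule compact_sums[OF K' compact_cball])
    then have "uniformly_continuous_on Q h"
      using h(1) continuous_on_subset compact_uniformly_continuous by blast
    then obtain d where d: "d > 0" "\<And>x y. x \<in> Q \<Longrightarrow> y \<in> Q \<Longrightarrow> dist y x < d \<Longrightarrow> dist (h y) (h x) < e"
      unfolding uniformly_continuous_on_def using e by metis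
    have inQ: "y \<in> Q" if "x \<in> K'" "dist y x \<le> 1" for x y
    proof -
      have "y = x + (y - x)" "y - x \<in> cball 0 1" using that by (auto simp: dist_norm norm_minus_commute)
      then show ?thesis unfolding Q_def using that by blast
    qed
    have "dist (h y) (h x) \<le> e" if "dist y x < min d 1" for x y
    proof (cases "x \<in> K' \<or> y \<in> K'")
      case True
      then have "x \<in> Q" "y \<in> Q" using inQ that by (force simp: dist_commute)+
      then show ?thesis using d(2) that by fastforce
    next
      case False
      then show ?thesis using e h(2) by simp
    qed
    then show ?thesis using d(1) by (intro exI[of _ "min d 1"]) auto
  qed
  obtain R0 where R0: "K \<subseteq> cbox (- R0) R0"
    using bounded_subset_cbox_symmetric[OF compact_imp_bounded[OF K(1)]] by blast
  have "\<exists>\<phi>. smooth_on UNIV \<phi> \<and> (\<forall>x. x \<notin> L \<longrightarrow> \<phi> x = 0) \<and>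
       (\<forall>x. \<bar>\<phi> x - \<theta> x\<bar> \<le> e) \<and> ((\<forall>x. 0 \<le> \<theta> x) \<longrightarrow> (\<forall>x. 0 \<le> \<phi> x)) \<and>
       (\<forall>d\<theta>. C1c U \<theta> d\<theta> \<longrightarrow> (\<forall>x. norm (grad \<phi> x - d\<theta> x) \<le> e))" if e: "0 < e" for e
  proof -
    obtain d1 where d1: "d1 > 0" "\<And>x y. dist y x < d1 \<Longrightarrow> \<bar>\<theta> y - \<theta> x\<bar> \<le> e"
      using unif[OF e \<theta>(1) \<theta>(2) K(1)] by (auto simp: dist_real_def)
    \<comment> \<open>\<open>\<theta>\<close> has at most one gradient, so one \<open>d2\<close>
      serves every admissible \<open>d\<theta>\<close>, and any value serves if there is none.
      Dividing by \<open>DIM('a)\<close> anticipates a componentwise estimate summed over the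
      basis.\<close>
    have "\<exists>d2>0. \<forall>d\<theta>. C1c U \<theta> d\<theta> \<longrightarrow> (\<forall>x y. dist y x < d2 \<longrightarrow> norm (d\<theta> y - d\<theta> x) \<le> e / DIM('a))"
    proof (cases "\<exists>d\<theta>. C1c U \<theta> d\<theta>")
      case True
      then obtain d\<theta> where C: "C1c U \<theta> d\<theta>" by blast
      then obtain K' where K': "compact K'" "\<And>x. x \<notin> K' \<Longrightarrow> d\<theta> x = 0" unfolding C1c_def by metis
      have "continuous_on UNIV d\<theta>" using C unfolding C1c_def by blast
      from unif[OF _ this K'(2,1), of "e / DIM('a)"] e
      obtain d2 where d2: "d2 > 0" "\<And>x y. dist y x < d2 \<Longrightarrow> norm (d\<theta> y - d\<theta> x) \<le> e / DIM('a)"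
        by (auto simp: dist_norm)
      have "d\<theta>' = d\<theta>" if "C1c U \<theta> d\<theta>'" for d\<theta>'
        using that C grad_eqI unfolding C1c_def by (metis ext)
      with d2 show ?thesis by blast
    next
      case False
      then show ?thesis by (intro exI[of _ 1]) auto
    qed
    then obtain d2 where d2: "d2 > 0"
      "\<And>d\<theta> x y. C1c U \<theta> d\<theta> \<Longrightarrow> dist y x < d2 \<Longrightarrow> norm (d\<theta> y - d\<theta> x) \<le> e / DIM('a)" by blast
    define d where "d = min (min d1 d2) (r / 2)"
    have d: "d > 0" "d \<le> d1" "d \<le> d2" "d \<le> r / 2" unfolding d_def using d1 d2 r by auto
    define \<eta> where "\<eta> x = flat_exp 0 (d\<^sup>2 - x \<bullet> x)" for x :: 'a
    have \<eta>: "\<eta> \<in> bump_algebra d" unfolding \<eta>_def by (rule bump_algebra.bump)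
    have c\<eta>: "continuous_on UNIV \<eta>" using bump_algebra_continuous[OF \<eta>] .
    have m\<eta>: "\<eta> \<in> borel_measurable borel" using c\<eta> by (rule borel_measurable_continuous_onI)
    have nn: "0 \<le> \<eta> z" for z unfolding \<eta>_def flat_exp_def by simp
    have ev: "\<eta> (- z) = \<eta> z" for z unfolding \<eta>_def by simp
    have supp: "\<eta> z = 0" if "d \<le> norm z" for z
      using power_mono[OF that, of 2] d unfolding \<eta>_def flat_exp_def by (simp add: power2_norm_eq_inner)
    have pos: "\<eta> z > 0" if "norm z < d" for z
      using power_strict_mono[OF that, of 2] unfolding \<eta>_def flat_exp_def by (simp add: power2_norm_eq_inner)
    have i\<eta>: "integrable lborel \<eta>"
      by (rule compact_support_integrable[OF compact_cball[of 0 d] c\<eta>]) (auto intro: supp)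
    define c where "c = (LINT y|lborel. \<eta> y)"
    have c: "c > 0"
    proof -
      have "c \<noteq> 0"
      proof
        assume "c = 0"
        then have "AE z in lborel. \<eta> z = 0"
          using integral_nonneg_eq_0_iff_AE[OF i\<eta>] nn unfolding c_def by auto
        then have "AE z in lborel. z \<notin> ball (0::'a) d" by eventually_elim (use pos in force)
        then have "emeasure lborel (ball (0::'a) d) = 0"
          by (subst (asm) AE_iff_measurable[of "ball (0::'a) d"]) auto
        then show False using content_ball_pos[OF d(1), of "0::'a"] by (simp add: measure_def)
      qed
      moreover have "c \<ge> 0" unfolding c_def using nn by simp
      ultimately show ?thesis by simp
    qed
    \<comment> \<open>The mass of the kernel is divided out of \<open>\<theta>\<close>, so that
      \<open>\<eta>\<close> stays the plain bump.\<close>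
    define \<Theta> where "\<Theta> y = \<theta> y / c" for y
    have c\<Theta>: "continuous_on UNIV \<Theta>" unfolding \<Theta>_def using \<theta>(1) c by (auto intro!: continuous_intros)
    define \<phi> where "\<phi> x = integral (cbox (- R0) R0) (\<lambda>y. \<Theta> y * \<eta> (x - y))" for x
    have zcb: "\<theta> y = 0" if "y \<notin> cbox (- R0) R0" for y using that R0 \<theta>(2) by auto
    have conv_int: "integrable lborel (\<lambda>y. \<theta> y * k (x - y))" if "continuous_on UNIV k" for k x
      using that \<theta> by (intro compact_support_integrable[OF K(1)] continuous_intros continuous_on_compose2[OF that]) auto
    have conv: "integral (cbox (- R0) R0) (\<lambda>y. \<Theta> y * k (x - y)) = (LINT y|lborel. \<theta> y * k (x - y)) / c"
      if k: "continuous_on UNIV k" for k x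
    proof -
      have "integral (cbox (- R0) R0) (\<lambda>y. \<Theta> y * k (x - y))
        = integral UNIV (\<lambda>y. if y \<in> cbox (- R0) R0 then \<Theta> y * k (x - y) else 0)"
        by (simp add: Henstock_Kurzweil_Integration.integral_restrict_UNIV)
      also have "\<dots> = integral UNIV (\<lambda>y. \<theta> y * k (x - y) / c)"
        by (rule arg_cong[of _ _ "integral UNIV"]) (auto simp: \<Theta>_def zcb)
      also have "\<dots> = (LINT y|lborel. \<theta> y * k (x - y) / c)"
        using conv_int[OF k, of x] by (intro integral_lborel) auto
      finally show ?thesis by simp
    qed
    have \<phi>eq: "\<phi> x = (LINT y|lborel. \<theta> y * \<eta> (x - y)) / c" for x unfolding \<phi>_def by (rule conv[OF c\<eta>])
    have s: "smooth_on UNIV \<phi>" unfolding \<phi>_def by (rule smooth_convolution[OF c\<Theta> \<eta>])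
    have z: "\<phi> x = 0" if "x \<notin> L" for x
    proof -
      have "\<theta> y * \<eta> (x - y) = 0" for y
      proof (cases "y \<in> K")
        case True
        have "x = y + (x - y)" by simp
        then have "x - y \<notin> cball 0 (r / 2)" using that True unfolding L_def by blast
        then show ?thesis using supp[of "x - y"] d by simp
      qed (use \<theta>(2) in simp)
      then have *: "(\<lambda>y. \<theta> y * \<eta> (x - y)) = (\<lambda>y. 0)" by (rule ext)
      show ?thesis unfolding \<phi>eq * by simp
    qed
    have scale: "\<bar>I / c - t\<bar> \<le> e'" if "\<bar>I - t * c\<bar> \<le> e' * c" for I t e'
    proof -
      have "I / c - t = (I - t * c) / c" using c by (simp add: field_simps)
      then show ?thesis using that c by (simp add: abs_div pos_divide_le_eq)
    qed
    have a: "\<bar>\<phi> x - \<theta> x\<bar> \<le> e" for x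
    proof -
      have "\<bar>(LINT y|lborel. \<theta> y * \<eta> (x - y)) - \<theta> x * c\<bar> \<le> e * c"
        unfolding c_def
        by (rule kernel_average_close[OF m\<eta> i\<eta> ev nn supp conv_int[OF c\<eta>]]) (use d1 d in auto)
      then show ?thesis unfolding \<phi>eq by (rule scale)
    qed
    have n: "0 \<le> \<phi> x" if "\<forall>x. 0 \<le> \<theta> x" for x
      unfolding \<phi>eq using that nn c by (intro divide_nonneg_pos integral_nonneg_AE) auto
    have g: "norm (grad \<phi> x - d\<theta> x) \<le> e" if C: "C1c U \<theta> d\<theta>" for d\<theta> x
    proof -
      have comp: "\<bar>(grad \<phi> x - d\<theta> x) \<bullet> b\<bar> \<le> e / DIM('a)" if b: "b \<in> Basis" for b
      proof -
        have cd: "continuous_on UNIV d\<theta>" and zd: "\<exists>K. compact K \<and> (\<forall>x. x \<notin> K \<longrightarrow> d\<theta> x = 0)"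
          using C unfolding C1c_def by blast+
        note cp = bump_algebra_continuous[OF bump_algebra_pderiv[OF \<eta>], of b]
        note gb = grad_inner_Basis[OF b]
        have "grad \<phi> x \<bullet> b = pderiv_dir \<phi> b x" by (rule gb)
        also have "\<dots> = integral (cbox (- R0) R0) (\<lambda>y. \<Theta> y * pderiv_dir \<eta> b (x - y))"
          unfolding \<phi>_def convolution_bump_algebra_pderiv[OF c\<Theta> \<eta> b] ..
        also have "\<dots> = (LINT y|lborel. \<theta> y * pderiv_dir \<eta> b (x - y)) / c" by (rule conv[OF cp])
        \<comment> \<open>The gradient of \<open>\<eta> (x - y)\<close> in \<open>y\<close> is minus
          \<open>grad \<eta> (x - y)\<close>, so integrating the derivative of
          \<open>\<eta> (x - y) * \<theta> y\<close> moves it from the kernel to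
          \<open>\<theta>\<close>.\<close>
        also have "(LINT y|lborel. \<theta> y * pderiv_dir \<eta> b (x - y)) = (LINT y|lborel. (d\<theta> y \<bullet> b) * \<eta> (x - y))"
        proof -
          have "C1c U (\<lambda>y. \<eta> (x - y) * \<theta> y) (\<lambda>y. \<theta> y *\<^sub>R (- grad \<eta> (x - y)) + \<eta> (x - y) *\<^sub>R d\<theta> y)"
          proof (rule C1c_mult[OF C])
            fix y
            have d1: "(\<eta> has_derivative (\<lambda>h. grad \<eta> (x - y) \<bullet> h)) (at (x - y))"
              using has_derivative_grad bump_algebra_differentiable[OF \<eta>] by blast
            have d2: "((\<lambda>y. x - y) has_derivative (\<lambda>h. - h)) (at y)"
              by (auto intro!: derivative_eq_intros)
            show "((\<lambda>y. \<eta> (x - y)) has_derivative (\<lambda>h. (- grad \<eta> (x - y)) \<bullet> h)) (at y)"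
              using has_derivative_compose[OF d2 d1] by simp
            show "continuous_on UNIV (\<lambda>y. - grad \<eta> (x - y))"
              by (intro continuous_intros continuous_on_compose2[OF bump_algebra_continuous_grad[OF \<eta>]]) auto
          qed
          from integral_C1c_derivative_0[OF this, of b]
          have 0: "(LINT y|lborel. (d\<theta> y \<bullet> b) * \<eta> (x - y) - \<theta> y * pderiv_dir \<eta> b (x - y)) = 0"
            by (simp add: inner_add_left gb algebra_simps)
          obtain K' where K': "compact K'" "\<And>x. x \<notin> K' \<Longrightarrow> d\<theta> x = 0" using zd by blast
          have "integrable lborel (\<lambda>y. (d\<theta> y \<bullet> b) * \<eta> (x - y))"
            using K' by (intro compact_support_integrable[OF K'(1)] continuous_intros cd continuous_on_compose2[OF c\<eta>]) auto
          from Bochner_Integration.integral_diff[OF this conv_int[OF cp, of x]] 0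
          show ?thesis by simp
        qed
        finally have gr: "grad \<phi> x \<bullet> b = (LINT y|lborel. (d\<theta> y \<bullet> b) * \<eta> (x - y)) / c" .
        have "\<bar>(LINT y|lborel. (d\<theta> y \<bullet> b) * \<eta> (x - y)) - (d\<theta> x \<bullet> b) * c\<bar> \<le> (e / DIM('a)) * c"
          unfolding c_def
        proof (rule kernel_average_close[OF m\<eta> i\<eta> ev nn supp])
          obtain K' where K': "compact K'" "\<And>x. x \<notin> K' \<Longrightarrow> d\<theta> x = 0" using zd by blast
          show "integrable lborel (\<lambda>y. (d\<theta> y \<bullet> b) * \<eta> (x - y))"
            using K' by (intro compact_support_integrable[OF K'(1)] continuous_intros cd continuous_on_compose2[OF c\<eta>]) auto
          show "\<bar>d\<theta> y \<bullet> b - d\<theta> x \<bullet> b\<bar> \<le> e / DIM('a)" if "dist y x < d" for y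
          proof -
            have "\<bar>(d\<theta> y - d\<theta> x) \<bullet> b\<bar> \<le> norm (d\<theta> y - d\<theta> x)" by (rule Basis_le_norm[OF b])
            also have "\<dots> \<le> e / DIM('a)" using d2(2)[OF C] that d by simp
            finally show ?thesis by (simp add: inner_diff_left)
          qed
        qed auto
        from scale[OF this] show ?thesis by (simp add: inner_diff_left gr)
      qed
      have "norm (grad \<phi> x - d\<theta> x) \<le> (\<Sum>b\<in>Basis. \<bar>(grad \<phi> x - d\<theta> x) \<bullet> b\<bar>)" by (rule norm_le_l1)
      also have "\<dots> \<le> (\<Sum>b\<in>(Basis::'a set). e / DIM('a))" by (rule sum_mono[OF comp])
      also have "\<dots> = e" by simp
      finally show ?thesis .
    qed
    show ?thesis using s z a n g by (intro exI[of _ \<phi>]) blast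
  qed
  then show ?thesis by (intro that[OF L LU]) simp
qed

section \<open>Test functions and weak gradients\<close>

lemma LINT_lebesgue_on:
  fixes f :: "'a::euclidean_space \<Rightarrow> 'b::euclidean_space"
  assumes "\<Omega> \<in> sets lebesgue"
  shows "(LINT x:\<Omega>|lebesgue. f x) = (LINT x|lebesgue_on \<Omega>. f x)"
  using assms by (simp add: set_lebesgue_integral_def integral_restrict_space)

lemma set_integrable_lebesgue_on:
  fixes f :: "'a::euclidean_space \<Rightarrow> 'b::euclidean_space"
  assumes "\<Omega> \<in> sets lebesgue"
  shows "set_integrable lebesgue \<Omega> f \<longleftrightarrow> integrable (lebesgue_on \<Omega>) f"
  using assms by (simp add: set_integrable_def integrable_restrict_space)

lemma borel_measurable_lebesgue_on_continuous:
  assumes "continuous_on UNIV f"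
  shows "f \<in> borel_measurable (lebesgue_on \<Omega>)"
  using assms by (intro measurable_restrict_space1 measurable_completion) (auto intro: borel_measurable_continuous_onI)

lemma integral_lebesgue_on_eq_lborel:
  fixes f :: "'a::euclidean_space \<Rightarrow> 'b::euclidean_space"
  assumes S: "\<Omega> \<in> sets lebesgue" and c: "continuous_on UNIV f" and z: "\<And>x. x \<notin> \<Omega> \<Longrightarrow> f x = 0"
  shows "(LINT x|lebesgue_on \<Omega>. f x) = (LINT x|lborel. f x)"
proof -
  have "indicator \<Omega> x *\<^sub>R f x = f x" for x using z by (auto simp: indicator_def)
  then have "(LINT x|lebesgue_on \<Omega>. f x) = (LINT x|lebesgue. f x)"
    using S by (simp add: integral_restrict_space)
  also have "\<dots> = (LINT x|lborel. f x)"
    using c by (intro integral_completion) (simp add: borel_measurable_continuous_onI)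
  finally show ?thesis .
qed

lemma C1c_bounded:
  assumes "C1c U v dv"
  obtains B where "B > 0" "\<And>x. \<bar>v x\<bar> \<le> B" "\<And>x. norm (dv x) \<le> B"
proof -
  obtain K where K: "compact K" "\<And>x. x \<notin> K \<Longrightarrow> v x = 0" "\<And>x. x \<notin> K \<Longrightarrow> dv x = 0"
    using assms unfolding C1c_def by metis
  have c: "continuous_on UNIV v" "continuous_on UNIV dv"
    using assms C1c_continuous unfolding C1c_def by blast+
  obtain B1 where "B1 > 0" "\<And>x. norm (v x) \<le> B1"
    using compact_support_bounded[OF K(1) continuous_on_subset[OF c(1) subset_UNIV] K(2)] by blast
  moreover obtain B2 where "B2 > 0" "\<And>x. norm (dv x) \<le> B2"
    using compact_support_bounded[OF K(1) continuous_on_subset[OF c(2) subset_UNIV] K(3)] by blast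
  ultimately show ?thesis
    using that[of "max B1 B2"] by (metis less_max_iff_disj max.coboundedI1 max.coboundedI2 real_norm_def)
qed

lemma C1c_measurable:
  assumes "C1c U v dv"
  shows "v \<in> borel_measurable (lebesgue_on \<Omega>)" "dv \<in> borel_measurable (lebesgue_on \<Omega>)"
  using assms C1c_continuous unfolding C1c_def
  by (blast intro: borel_measurable_lebesgue_on_continuous)+

lemma smooth_compact_support_C1c:
  assumes s: "smooth_on UNIV \<phi>" and K: "compact K" "K \<subseteq> U" "\<And>x. x \<notin> K \<Longrightarrow> \<phi> x = 0"
  shows "C1c U \<phi> (grad \<phi>)"
proof -
  have C: "Ck_on (Suc 0) UNIV \<phi>" using s unfolding smooth_on_def by blast
  have d: "(\<phi> has_derivative (\<lambda>h. grad \<phi> x \<bullet> h)) (at x)" for x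
    using C by (intro has_derivative_grad) simp
  have "continuous_on UNIV (grad \<phi>)"
    using C unfolding grad_def by (auto intro!: continuous_intros)
  moreover have "grad \<phi> x = 0" if "x \<notin> K" for x
  proof (rule grad_eqI)
    have "open (- K)" using K(1) compact_imp_closed by auto
    then have "(\<phi> has_derivative (\<lambda>h. 0)) (at x)"
      by (rule has_derivative_transform_within_open[OF has_derivative_const[of 0]]) (use that K(3) in auto)
    then show "(\<phi> has_derivative (\<lambda>h. 0 \<bullet> h)) (at x)" by simp
  qed
  ultimately show ?thesis unfolding C1c_def using d K by blast
qed

lemma test_fun_C1c: "test_fun \<Omega> \<phi> \<Longrightarrow> C1c \<Omega> \<phi> (grad \<phi>)"
  unfolding test_fun_def using closure_subset[of "{x. \<phi> x \<noteq> 0}"]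
  by (intro smooth_compact_support_C1c[of _ "closure {x. \<phi> x \<noteq> 0}"]) auto

lemma smooth_compact_support_test_fun:
  assumes "smooth_on UNIV \<phi>" and K: "compact K" "K \<subseteq> \<Omega>" "\<And>x. x \<notin> K \<Longrightarrow> \<phi> x = 0"
  shows "test_fun \<Omega> \<phi>"
proof -
  have "closure {x. \<phi> x \<noteq> 0} \<subseteq> K"
    using K by (intro closure_minimal) (auto intro: compact_imp_closed)
  moreover from this have "compact (closure {x. \<phi> x \<noteq> 0})"
    using K(1) compact_closure bounded_subset compact_imp_bounded closed_closure
    by (meson compact_eq_bounded_closed)
  ultimately show ?thesis unfolding test_fun_def using assms by blast
qed

lemma integrable_mult_bounded:
  fixes r g :: "'a \<Rightarrow> real"
  assumes "integrable M r" "g \<in> borel_measurable M" "\<And>x. \<bar>g x\<bar> \<le> B"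
  shows "integrable M (\<lambda>x. r x * g x)"
proof (rule Bochner_Integration.integrable_bound)
  show "integrable M (\<lambda>x. B * r x)" using assms by simp
  show "AE x in M. norm (r x * g x) \<le> norm (B * r x)"
    using order.trans[OF assms(3) abs_ge_self]
    by (intro AE_I2) (auto simp: abs_mult mult.commute[of "\<bar>r _\<bar>"] intro!: mult_right_mono)
qed (use assms in measurable)

lemma integrable_inner_bounded:
  fixes V g :: "'a \<Rightarrow> 'b::euclidean_space"
  assumes "integrable M V" "g \<in> borel_measurable M" "\<And>x. norm (g x) \<le> B"
  shows "integrable M (\<lambda>x. V x \<bullet> g x)"
proof (rule Bochner_Integration.integrable_bound)
  show "integrable M (\<lambda>x. B * norm (V x))" using assms by simp
  show "AE x in M. norm (V x \<bullet> g x) \<le> norm (B * norm (V x))"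
  proof (rule AE_I2)
    fix x
    have "\<bar>V x \<bullet> g x\<bar> \<le> norm (V x) * norm (g x)" by (rule Cauchy_Schwarz_ineq2)
    also have "\<dots> \<le> norm (V x) * B" using assms(3) by (intro mult_left_mono) auto
    finally show "norm (V x \<bullet> g x) \<le> norm (B * norm (V x))" by (simp add: mult.commute)
  qed
qed (use assms in measurable)

text \<open>Smooth nonnegative approximants that are uniformly \<open>e\<close>-close in value and
  gradient change the two sides by at most \<open>e\<close> times the L^1 norms of \<open>r\<close>
  and \<open>V\<close>; \<open>T\<close> is the sum of these norms.\<close>

lemma test_inequality_C1c:
  fixes \<Omega> :: "'a::euclidean_space set"
  assumes \<Omega>: "open \<Omega>" and V: "integrable (lebesgue_on \<Omega>) V" and r: "integrable (lebesgue_on \<Omega>) r"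
    and test: "\<And>\<phi>. test_fun \<Omega> \<phi> \<Longrightarrow> (\<And>x. 0 \<le> \<phi> x) \<Longrightarrow>
      (LINT x|lebesgue_on \<Omega>. r x * \<phi> x) \<le> (LINT x|lebesgue_on \<Omega>. V x \<bullet> grad \<phi> x)"
    and C: "C1c \<Omega> \<theta> d\<theta>" and nn: "\<And>x. 0 \<le> \<theta> x"
  shows "(LINT x|lebesgue_on \<Omega>. r x * \<theta> x) \<le> (LINT x|lebesgue_on \<Omega>. V x \<bullet> d\<theta> x)"
proof -
  let ?M = "lebesgue_on \<Omega>"
  obtain K where K: "compact K" "K \<subseteq> \<Omega>" "\<And>x. x \<notin> K \<Longrightarrow> \<theta> x = 0"
    using C unfolding C1c_def by metis
  obtain L where L: "compact L" "L \<subseteq> \<Omega>" and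
    app: "\<forall>e>0. \<exists>\<phi>. smooth_on UNIV \<phi> \<and> (\<forall>x. x \<notin> L \<longrightarrow> \<phi> x = 0) \<and>
       (\<forall>x. \<bar>\<phi> x - \<theta> x\<bar> \<le> e) \<and> ((\<forall>x. 0 \<le> \<theta> x) \<longrightarrow> (\<forall>x. 0 \<le> \<phi> x)) \<and>
       (\<forall>d\<theta>. C1c \<Omega> \<theta> d\<theta> \<longrightarrow> (\<forall>x. norm (grad \<phi> x - d\<theta> x) \<le> e))"
    using smooth_approximation[OF \<Omega> K(1,2) C1c_continuous[OF C] K(3)] .
  define T where "T = (LINT x|?M. \<bar>r x\<bar>) + (LINT x|?M. norm (V x))"
  have int: "integrable ?M (\<lambda>x. r x * v x)" "integrable ?M (\<lambda>x. V x \<bullet> dv x)" if v: "C1c \<Omega> v dv" for v dv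
  proof -
    obtain B where "0 < B" "\<And>x. \<bar>v x\<bar> \<le> B" "\<And>x. norm (dv x) \<le> B" using C1c_bounded[OF v] by metis
    then show "integrable ?M (\<lambda>x. r x * v x)" "integrable ?M (\<lambda>x. V x \<bullet> dv x)"
      using C1c_measurable[OF v, of \<Omega>]
      by (auto intro: integrable_mult_bounded[OF r] integrable_inner_bounded[OF V])
  qed
  have T: "T \<ge> 0" unfolding T_def by simp
  have "(LINT x|?M. r x * \<theta> x) \<le> (LINT x|?M. V x \<bullet> d\<theta> x) + e * T" if e: "0 < e" for e
  proof -
    obtain \<phi> where \<phi>: "smooth_on UNIV \<phi>" "\<And>x. x \<notin> L \<Longrightarrow> \<phi> x = 0"
      "\<And>x. \<bar>\<phi> x - \<theta> x\<bar> \<le> e" "\<And>x. 0 \<le> \<phi> x" "\<And>x. norm (grad \<phi> x - d\<theta> x) \<le> e"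
      using app e nn C by metis
    have t: "test_fun \<Omega> \<phi>" using smooth_compact_support_test_fun[OF \<phi>(1) L \<phi>(2)] .
    have C\<phi>: "C1c \<Omega> \<phi> (grad \<phi>)" using test_fun_C1c[OF t] .
    have "(LINT x|?M. r x * \<theta> x) \<le> (LINT x|?M. r x * \<phi> x + e * \<bar>r x\<bar>)"
    proof (rule integral_mono[OF int(1)[OF C]])
      show "integrable ?M (\<lambda>x. r x * \<phi> x + e * \<bar>r x\<bar>)" using int(1)[OF C\<phi>] r by auto
      fix x
      have "r x * (\<theta> x - \<phi> x) \<le> \<bar>r x\<bar> * \<bar>\<phi> x - \<theta> x\<bar>"
        using abs_ge_self[of "r x * (\<theta> x - \<phi> x)"] by (simp add: abs_mult abs_minus_commute)
      also have "\<dots> \<le> \<bar>r x\<bar> * e" using \<phi>(3) by (intro mult_left_mono) auto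
      finally show "r x * \<theta> x \<le> r x * \<phi> x + e * \<bar>r x\<bar>" by (simp add: algebra_simps)
    qed
    also have "\<dots> = (LINT x|?M. r x * \<phi> x) + e * (LINT x|?M. \<bar>r x\<bar>)"
      using int(1)[OF C\<phi>] r by simp
    also have "(LINT x|?M. r x * \<phi> x) \<le> (LINT x|?M. V x \<bullet> grad \<phi> x)" using test[OF t \<phi>(4)] .
    also have "(LINT x|?M. V x \<bullet> grad \<phi> x) \<le> (LINT x|?M. V x \<bullet> d\<theta> x + e * norm (V x))"
    proof (rule integral_mono[OF int(2)[OF C\<phi>]])
      show "integrable ?M (\<lambda>x. V x \<bullet> d\<theta> x + e * norm (V x))" using int(2)[OF C] V by auto
      fix x
      have "V x \<bullet> (grad \<phi> x - d\<theta> x) \<le> norm (V x) * norm (grad \<phi> x - d\<theta> x)" by (rule norm_cauchy_schwarz)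
      also have "\<dots> \<le> norm (V x) * e" using \<phi>(5) by (intro mult_left_mono) auto
      finally show "V x \<bullet> grad \<phi> x \<le> V x \<bullet> d\<theta> x + e * norm (V x)" by (simp add: inner_diff_right algebra_simps)
    qed
    also have "\<dots> = (LINT x|?M. V x \<bullet> d\<theta> x) + e * (LINT x|?M. norm (V x))"
      using int(2)[OF C] V by simp
    finally show ?thesis unfolding T_def by (simp add: algebra_simps)
  qed
  note main = this
  show ?thesis
  proof (rule field_le_epsilon)
    fix e :: real assume "0 < e"
    then have p: "0 < e / (T + 1)" using T by simp
    have "e / (T + 1) * T \<le> e" using T \<open>0 < e\<close> by (simp add: field_simps)
    then show "(LINT x|?M. r x * \<theta> x) \<le> (LINT x|?M. V x \<bullet> d\<theta> x) + e" using main[OF p] by linarith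
  qed
qed

text \<open>The fundamental lemma of the calculus of variations for a locally integrable
  \<open>h\<close>. The hypothesis extends to continuous functions with compact support; bounded
  ones converging to a cutoff of the sign of \<open>h\<close> then turn it into a statement about
  the integral of \<open>\<bar>h x\<bar>\<close> near any compact set.\<close>

lemma test_fun_integral_0_imp_AE_0:
  fixes h :: "'a::euclidean_space \<Rightarrow> real"
  assumes \<Omega>: "open \<Omega>" and m: "h \<in> borel_measurable (lebesgue_on \<Omega>)"
    and loc: "\<And>K. compact K \<Longrightarrow> K \<subseteq> \<Omega> \<Longrightarrow> integrable (lebesgue_on \<Omega>) (\<lambda>x. indicator K x * h x)"
    and test: "\<And>\<phi>. test_fun \<Omega> \<phi> \<Longrightarrow> (LINT x|lebesgue_on \<Omega>. h x * \<phi> x) = 0"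
  shows "AE x in lebesgue_on \<Omega>. h x = 0"
proof -
  let ?M = "lebesgue_on \<Omega>"
  have S: "\<Omega> \<in> sets lebesgue" using \<Omega> by auto
  have cont0: "(LINT x|?M. h x * \<theta> x) = 0"
    if K: "compact K" "K \<subseteq> \<Omega>" and \<theta>: "continuous_on UNIV \<theta>" "\<And>x. x \<notin> K \<Longrightarrow> \<theta> x = 0" for K \<theta>
  proof -
    obtain L where L: "compact L" "L \<subseteq> \<Omega>" and
      app: "\<forall>e>0. \<exists>\<phi>. smooth_on UNIV \<phi> \<and> (\<forall>x. x \<notin> L \<longrightarrow> \<phi> x = 0) \<and> (\<forall>x. \<bar>\<phi> x - \<theta> x\<bar> \<le> e)"
      using smooth_approximation[OF \<Omega> K \<theta>] by metis
    have LK: "compact (L \<union> K)" "L \<union> K \<subseteq> \<Omega>" using L K by auto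
    have int: "integrable ?M (\<lambda>x. h x * v x)"
      if v: "continuous_on UNIV v" "\<And>x. x \<notin> L \<union> K \<Longrightarrow> v x = 0" for v
    proof -
      obtain B where "\<And>x. norm (v x) \<le> B"
        using compact_support_bounded[OF LK(1) continuous_on_subset[OF v(1) subset_UNIV] v(2)] by blast
      then have "integrable ?M (\<lambda>x. (indicator (L \<union> K) x * h x) * v x)"
        using borel_measurable_lebesgue_on_continuous[OF v(1)]
        by (intro integrable_mult_bounded[OF loc[OF LK]]) auto
      moreover have "(\<lambda>x. (indicator (L \<union> K) x * h x) * v x) = (\<lambda>x. h x * v x)"
      proof
        fix x show "indicator (L \<union> K) x * h x * v x = h x * v x"
          by (cases "x \<in> L \<union> K")
             (simp_all only: v(2) indicator_simps mult_1_left mult_zero_left mult_zero_right not_False_eq_True)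
      qed
      ultimately show ?thesis by (rule back_subst)
    qed
    define T where "T = (LINT x|?M. \<bar>indicator (L \<union> K) x * h x\<bar>)"
    have T: "T \<ge> 0" unfolding T_def by simp
    have "\<bar>LINT x|?M. h x * \<theta> x\<bar> \<le> e * T" if e: "0 < e" for e
    proof -
      obtain \<phi> where \<phi>: "smooth_on UNIV \<phi>" "\<And>x. x \<notin> L \<Longrightarrow> \<phi> x = 0" "\<And>x. \<bar>\<phi> x - \<theta> x\<bar> \<le> e"
        using app e by metis
      have t: "test_fun \<Omega> \<phi>" using smooth_compact_support_test_fun[OF \<phi>(1) L \<phi>(2)] .
      have c\<phi>: "continuous_on UNIV \<phi>" using C1c_continuous[OF test_fun_C1c[OF t]] .
      have "(LINT x|?M. h x * \<theta> x) = (LINT x|?M. h x * \<theta> x) - (LINT x|?M. h x * \<phi> x)"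
        using test[OF t] by simp
      also have "\<dots> = (LINT x|?M. h x * \<theta> x - h x * \<phi> x)"
        using \<theta> c\<phi> \<phi>(2) by (intro Bochner_Integration.integral_diff[symmetric] int) auto
      also have "\<bar>\<dots>\<bar> \<le> (LINT x|?M. e * \<bar>indicator (L \<union> K) x * h x\<bar>)"
      proof (rule integral_abs_bound_integral)
        show "integrable ?M (\<lambda>x. h x * \<theta> x - h x * \<phi> x)"
          using \<theta> c\<phi> \<phi>(2) by (intro Bochner_Integration.integrable_diff int) auto
        show "integrable ?M (\<lambda>x. e * \<bar>indicator (L \<union> K) x * h x\<bar>)" using loc[OF LK] by auto
        fix x
        show "\<bar>h x * \<theta> x - h x * \<phi> x\<bar> \<le> e * \<bar>indicator (L \<union> K) x * h x\<bar>"
        proof (cases "x \<in> L \<union> K")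
          case True
          have "\<bar>h x * \<theta> x - h x * \<phi> x\<bar> = \<bar>\<phi> x - \<theta> x\<bar> * \<bar>h x\<bar>"
            by (simp add: abs_mult[symmetric] algebra_simps abs_minus_commute)
          also have "\<dots> \<le> e * \<bar>h x\<bar>" using \<phi>(3) by (intro mult_right_mono) auto
          finally show ?thesis using True by simp
        next
          case False
          then show ?thesis using \<theta>(2) \<phi>(2) by simp
        qed
      qed
      finally show ?thesis unfolding T_def by simp
    qed
    note main = this
    have "\<bar>LINT x|?M. h x * \<theta> x\<bar> \<le> 0"
    proof (rule field_le_epsilon)
      fix e :: real assume "0 < e"
      then have p: "0 < e / (T + 1)" using T by simp
      have "e / (T + 1) * T \<le> e" using T \<open>0 < e\<close> by (simp add: field_simps)
      then show "\<bar>LINT x|?M. h x * \<theta> x\<bar> \<le> 0 + e" using main[OF p] by linarith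
    qed
    then show ?thesis by simp
  qed
  have "(\<lambda>x. sgn (h x)) \<in> borel_measurable ?M" using m by measurable
  then have "(\<lambda>x. sgn (h x)) measurable_on \<Omega>"
    using S measurable_on_iff_borel_measurable by blast
  \<comment> \<open>Unfolding \<open>measurable_on\<close> delivers continuous functions that
    converge to the sign of \<open>h\<close> off a negligible set.\<close>
  then obtain N g where N: "negligible N" and g: "\<And>n. continuous_on UNIV (g n)"
    "\<And>x. x \<notin> N \<Longrightarrow> (\<lambda>n. g n x) \<longlonglongrightarrow> (if x \<in> \<Omega> then sgn (h x) else 0)"
    unfolding measurable_on_def by blast
  have AEN: "AE x in ?M. x \<notin> N"
  proof -
    have "AE x in lebesgue. x \<notin> N" using N by (intro AE_not_in) (simp add: negligible_iff_null_sets)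
    then have "AE x in lebesgue. x \<in> \<Omega> \<longrightarrow> x \<notin> N" by eventually_elim simp
    then show ?thesis using S by (simp add: AE_restrict_space_iff)
  qed
  have onK: "AE x in ?M. x \<in> K \<longrightarrow> h x = 0" if K: "compact K" "K \<subseteq> \<Omega>" for K
  proof (cases "K = {}")
    case False
    obtain r where r: "r > 0" "(\<Union>x\<in>K. ball x r) \<subseteq> \<Omega>"
      using compact_subset_open_imp_ball_epsilon_subset[OF K(1) \<Omega> K(2)] .
    define L where "L = {x + y | x y. x \<in> K \<and> y \<in> cball 0 (r / 2)}"
    have L: "compact L" unfolding L_def by (rule compact_sums[OF K(1) compact_cball])
    have LU: "L \<subseteq> \<Omega>"
    proof
      fix z assume "z \<in> L"
      then obtain x y where "z = x + y" "x \<in> K" "norm y \<le> r / 2" unfolding L_def by auto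
      then have "z \<in> ball x r" using r by (simp add: dist_norm)
      with \<open>x \<in> K\<close> show "z \<in> \<Omega>" using r(2) by blast
    qed
    define \<kappa> where "\<kappa> x = max 0 (1 - infdist x K / (r / 2))" for x
    have c\<kappa>: "continuous_on UNIV \<kappa>" unfolding \<kappa>_def using r by (auto intro!: continuous_intros)
    have \<kappa>01: "0 \<le> \<kappa> x" "\<kappa> x \<le> 1" for x unfolding \<kappa>_def using r infdist_nonneg[of x K] by auto
    have \<kappa>K: "\<kappa> x = 1" if "x \<in> K" for x unfolding \<kappa>_def using that by simp
    have \<kappa>z: "\<kappa> x = 0" if "x \<notin> L" for x
    proof (rule ccontr)
      assume "\<kappa> x \<noteq> 0"
      then have "infdist x K < r / 2" unfolding \<kappa>_def using r by (auto simp: max_def field_simps split: if_splits)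
      moreover obtain y where "y \<in> K" "infdist x K = dist x y"
        using infdist_attains_inf[OF compact_imp_closed[OF K(1)] False] by metis
      ultimately have "x = y + (x - y)" "x - y \<in> cball 0 (r / 2)" "y \<in> K"
        by (auto simp: dist_norm norm_minus_commute)
      then show False using that unfolding L_def by blast
    qed
    \<comment> \<open>Clamping to the interval from -1 to 1 provides the majorant for dominated
      convergence and leaves the limit, a value of \<open>sgn\<close>, unchanged.\<close>
    define \<theta> where "\<theta> n x = \<kappa> x * max (-1) (min 1 (g n x))" for n x
    have c\<theta>: "continuous_on UNIV (\<theta> n)" for n
      unfolding \<theta>_def using c\<kappa> g(1) by (auto intro!: continuous_intros)
    have m1: "\<bar>\<theta> n x\<bar> \<le> \<kappa> x" for n x
    proof -
      have "\<bar>max (-1) (min 1 (g n x))\<bar> \<le> 1" by auto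
      then show ?thesis unfolding \<theta>_def using \<kappa>01[of x] by (simp add: abs_mult mult_left_le)
    qed
    have z\<theta>: "(LINT x|?M. h x * \<theta> n x) = 0" for n
      by (rule cont0[OF L LU c\<theta>]) (simp add: \<theta>_def \<kappa>z)
    have iL: "integrable ?M (\<lambda>x. \<bar>indicator L x * h x\<bar>)" using loc[OF L LU] by simp
    have "(\<lambda>n. LINT x|?M. h x * \<theta> n x) \<longlonglongrightarrow> (LINT x|?M. \<bar>h x\<bar> * \<kappa> x)"
    proof (rule integral_dominated_convergence[OF _ _ iL])
      show "(\<lambda>x. \<bar>h x\<bar> * \<kappa> x) \<in> borel_measurable ?M"
        using m borel_measurable_lebesgue_on_continuous[OF c\<kappa>] by measurable
      show "(\<lambda>x. h x * \<theta> n x) \<in> borel_measurable ?M" for n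
        using m borel_measurable_lebesgue_on_continuous[OF c\<theta>] by measurable
      show "AE x in ?M. norm (h x * \<theta> n x) \<le> \<bar>indicator L x * h x\<bar>" for n
      proof (rule AE_I2)
        fix x
        show "norm (h x * \<theta> n x) \<le> \<bar>indicator L x * h x\<bar>"
          using m1[of n x] \<kappa>01[of x] \<kappa>z[of x]
          by (cases "x \<in> L") (auto simp: abs_mult intro!: mult_left_le)
      qed
      show "AE x in ?M. (\<lambda>n. h x * \<theta> n x) \<longlonglongrightarrow> \<bar>h x\<bar> * \<kappa> x"
        using AEN AE_space
      proof eventually_elim
        fix x assume x: "x \<notin> N" "x \<in> space ?M"
        then have gl: "(\<lambda>n. g n x) \<longlonglongrightarrow> sgn (h x)" using g(2)[OF x(1)] by simp
        have "(\<lambda>n. h x * \<theta> n x) \<longlonglongrightarrow> h x * (\<kappa> x * max (-1) (min 1 (sgn (h x))))"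
          unfolding \<theta>_def by (intro tendsto_intros gl)
        moreover have "max (-1) (min 1 (sgn (h x))) = sgn (h x)" by (auto simp: sgn_if)
        ultimately show "(\<lambda>n. h x * \<theta> n x) \<longlonglongrightarrow> \<bar>h x\<bar> * \<kappa> x"
          by (simp add: abs_sgn mult_ac)
      qed
    qed
    then have 0: "(LINT x|?M. \<bar>h x\<bar> * \<kappa> x) = 0" using z\<theta> by (simp add: LIMSEQ_const_iff)
    have "integrable ?M (\<lambda>x. \<bar>h x\<bar> * \<kappa> x)"
    proof (rule Bochner_Integration.integrable_bound[OF iL])
      show "(\<lambda>x. \<bar>h x\<bar> * \<kappa> x) \<in> borel_measurable ?M"
        using m borel_measurable_lebesgue_on_continuous[OF c\<kappa>] by measurable
      show "AE x in ?M. norm (\<bar>h x\<bar> * \<kappa> x) \<le> norm \<bar>indicator L x * h x\<bar>"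
      proof (rule AE_I2)
        fix x
        show "norm (\<bar>h x\<bar> * \<kappa> x) \<le> norm \<bar>indicator L x * h x\<bar>"
          using \<kappa>01[of x] \<kappa>z[of x] by (cases "x \<in> L") (auto simp: abs_mult intro!: mult_left_le)
      qed
    qed
    then have "AE x in ?M. \<bar>h x\<bar> * \<kappa> x = 0"
      using 0 \<kappa>01(1) integral_nonneg_eq_0_iff_AE[of ?M "\<lambda>x. \<bar>h x\<bar> * \<kappa> x"] by simp
    then show ?thesis by eventually_elim (use \<kappa>K in force)
  qed simp
  obtain C :: "nat \<Rightarrow> 'a set" where C: "\<And>n. compact (C n)" "\<And>n. C n \<subseteq> \<Omega>" "\<Union> (range C) = \<Omega>"
  proof (rule open_Union_compact_subsets[OF \<Omega>])
    fix C :: "nat \<Rightarrow> 'a set"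
    assume "\<And>n. compact (C n)" "\<And>n. C n \<subseteq> \<Omega>" "\<Union> (range C) = \<Omega>"
    then show thesis by (rule that)
  qed
  have "AE x in ?M. \<forall>n::nat. x \<in> C n \<longrightarrow> h x = 0"
    unfolding AE_all_countable using onK[OF C(1,2)] by blast
  then show ?thesis using AE_space
    by eventually_elim (use C(3) in auto)
qed

section \<open>Weak and classical gradients of a C^1 function\<close>

lemma integrable_norm_Lp:
  fixes h :: "'a::euclidean_space \<Rightarrow> 'b::euclidean_space"
  assumes \<Omega>: "open \<Omega>" "bounded \<Omega>" and h: "Lp_on p \<Omega> h" and q: "0 \<le> q" "q \<le> p"
  shows "integrable (lebesgue_on \<Omega>) (\<lambda>x. norm (h x) powr q)"
proof (rule Bochner_Integration.integrable_bound)
  let ?M = "lebesgue_on \<Omega>"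
  have S: "\<Omega> \<in> sets lebesgue" using \<Omega> by auto
  have m[measurable]: "h \<in> borel_measurable ?M" and i: "integrable ?M (\<lambda>x. norm (h x) powr p)"
    using h S unfolding Lp_on_def by (auto simp: set_integrable_lebesgue_on)
  have "finite_measure ?M"
    using \<Omega> by (intro finite_measure_lebesgue_on lmeasurable_open)
  then show "integrable ?M (\<lambda>x. 1 + norm (h x) powr p)"
    using i by (intro Bochner_Integration.integrable_add) (auto intro: finite_measure.integrable_const)
  show "AE x in ?M. norm (norm (h x) powr q) \<le> norm (1 + norm (h x) powr p)"
  proof (rule AE_I2)
    fix x
    have "norm (h x) powr q \<le> 1 + norm (h x) powr p"
    proof (cases "norm (h x) \<le> 1")
      case True
      then have "norm (h x) powr q \<le> 1" using q by (simp add: powr_le1)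
      then show ?thesis using powr_ge_zero[of "norm (h x)" p] by linarith
    next
      case False
      then have "norm (h x) powr q \<le> norm (h x) powr p" using q by (intro powr_mono) auto
      then show ?thesis by simp
    qed
    then show "norm (norm (h x) powr q) \<le> norm (1 + norm (h x) powr p)" by simp
  qed
  show "(\<lambda>x. norm (h x) powr q) \<in> borel_measurable ?M" by measurable
qed

text \<open>For a test function \<open>\<phi>\<close> the product \<open>u x * \<phi> x\<close> is
  compactly supported and of class C^1, so \<open>grad u\<close> obeys the same integration by parts
  as \<open>g\<close>, and the fundamental lemma applies to each component of the difference.
  Nothing controls \<open>grad u\<close> near the boundary, which is why that lemma asks only for
  local integrability.\<close>

lemma weak_grad_C1_eq_grad:
  fixes u :: "'a::euclidean_space \<Rightarrow> real"
  assumes \<Omega>: "open \<Omega>" "bounded \<Omega>" and u: "C1_on \<Omega> u" and w: "weak_grad \<Omega> u g"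
    and g: "Lp_on p \<Omega> g" "1 \<le> p"
  shows "AE x in lebesgue_on \<Omega>. g x = grad u x"
proof -
  let ?M = "lebesgue_on \<Omega>"
  have S: "\<Omega> \<in> sets lebesgue" using \<Omega> by auto
  have du: "\<And>x. x \<in> \<Omega> \<Longrightarrow> (u has_derivative (\<lambda>h. grad u x \<bullet> h)) (at x)" and cu': "continuous_on \<Omega> (grad u)"
    using u has_derivative_grad unfolding C1_on_def by blast+
  have cu: "continuous_on \<Omega> u"
    using du has_derivative_continuous by (intro continuous_at_imp_continuous_on) blast
  have mg: "g \<in> borel_measurable ?M" using g unfolding Lp_on_def by simp
  have ig: "integrable ?M g"
    using integrable_norm_Lp[OF \<Omega> g(1), of 1] g(2) mg by (simp add: integrable_norm_iff)
  have mgu: "grad u \<in> borel_measurable ?M" using continuous_imp_measurable_on_sets_lebesgue[OF cu' S] .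
  have comp: "AE x in ?M. g x \<bullet> b - grad u x \<bullet> b = 0" if b: "b \<in> Basis" for b
  proof (rule test_fun_integral_0_imp_AE_0[OF \<Omega>(1)])
    show "(\<lambda>x. g x \<bullet> b - grad u x \<bullet> b) \<in> borel_measurable ?M" using mg mgu by measurable
    have igb: "integrable ?M (\<lambda>x. g x \<bullet> b)" using ig by auto
    have igu: "integrable ?M (\<lambda>x. indicator K x * (grad u x \<bullet> b))" if "compact K" "K \<subseteq> \<Omega>" for K
    proof -
      have "continuous_on K (\<lambda>x. grad u x \<bullet> b)"
        using cu' that(2) by (auto intro!: continuous_intros intro: continuous_on_subset)
      then have "integrable lborel (\<lambda>x. indicator K x *\<^sub>R (grad u x \<bullet> b))"
        using that(1) by (intro borel_integrable_compact)
      then have "integrable lebesgue (\<lambda>x. indicator K x *\<^sub>R (grad u x \<bullet> b))"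
        using integrable_completion borel_measurable_integrable by blast
      moreover have "(\<lambda>x. indicator K x *\<^sub>R (grad u x \<bullet> b)) = (\<lambda>x. indicator \<Omega> x *\<^sub>R (indicator K x *\<^sub>R (grad u x \<bullet> b)))"
        using that(2) by (intro ext) (auto simp: indicator_def)
      ultimately have "integrable lebesgue (\<lambda>x. indicator \<Omega> x *\<^sub>R (indicator K x *\<^sub>R (grad u x \<bullet> b)))"
        by (rule back_subst)
      then show ?thesis using S by (simp add: integrable_restrict_space)
    qed
    show "integrable ?M (\<lambda>x. indicator K x * (g x \<bullet> b - grad u x \<bullet> b))" if "compact K" "K \<subseteq> \<Omega>" for K
    proof -
      have "K \<in> sets lebesgue" using compact_imp_closed[OF that(1)] by auto
      then have "(\<lambda>x. indicator K x :: real) \<in> borel_measurable ?M"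
        by (intro measurable_restrict_space1) auto
      from integrable_mult_bounded[OF igb this, of 1]
      have "integrable ?M (\<lambda>x. (g x \<bullet> b) * indicator K x)" by (auto simp: indicator_def)
      from Bochner_Integration.integrable_diff[OF this igu[OF that]]
      show ?thesis by (simp add: algebra_simps)
    qed
    show "(LINT x|?M. (g x \<bullet> b - grad u x \<bullet> b) * \<phi> x) = 0" if t: "test_fun \<Omega> \<phi>" for \<phi>
    proof -
      note C = test_fun_C1c[OF t]
      obtain K where K: "compact K" "K \<subseteq> \<Omega>" "\<And>x. x \<notin> K \<Longrightarrow> \<phi> x = 0 \<and> grad \<phi> x = 0"
        using C unfolding C1c_def by metis
      obtain B where B: "\<And>x. \<bar>\<phi> x\<bar> \<le> B" using C1c_bounded[OF C] by blast
      have d\<phi>: "(\<phi> has_derivative (\<lambda>h. grad \<phi> x \<bullet> h)) (at x)" for x using C unfolding C1c_def by blast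
      have c\<phi>: "continuous_on UNIV \<phi>" "continuous_on UNIV (grad \<phi>)"
        using C C1c_continuous unfolding C1c_def by blast+
      let ?d = "\<lambda>x. u x *\<^sub>R grad \<phi> x + \<phi> x *\<^sub>R grad u x"
      have Cu: "C1c \<Omega> (\<lambda>x. if x \<in> \<Omega> then u x * \<phi> x else 0) (\<lambda>x. if x \<in> \<Omega> then ?d x else 0)"
      proof (rule C1c_extend[OF \<Omega>(1) K(1,2)])
        show "((\<lambda>x. u x * \<phi> x) has_derivative (\<lambda>h. ?d x \<bullet> h)) (at x)" if "x \<in> \<Omega>" for x
          by (rule has_derivative_eq_rhs[OF has_derivative_mult[OF du[OF that] d\<phi>]])
             (auto simp: inner_add_left algebra_simps)
        show "continuous_on \<Omega> ?d"
          using cu cu' c\<phi> by (auto intro!: continuous_intros intro: continuous_on_subset)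
      qed (use K in auto)
      have "(LINT x|?M. ?d x \<bullet> b) = (LINT x|?M. (if x \<in> \<Omega> then ?d x else 0) \<bullet> b)"
        by (intro Bochner_Integration.integral_cong) auto
      also have "\<dots> = (LINT x|lborel. (if x \<in> \<Omega> then ?d x else 0) \<bullet> b)"
        using Cu S unfolding C1c_def
        by (intro integral_lebesgue_on_eq_lborel) (auto intro!: continuous_intros)
      also have "\<dots> = 0" by (rule integral_C1c_derivative_0[OF Cu])
      finally have 0: "(LINT x|?M. ?d x \<bullet> b) = 0" .
      note gb = grad_inner_Basis[OF b]
      have mphi: "\<phi> \<in> borel_measurable ?M" using C1c_measurable[OF C] by blast
      have i1: "integrable ?M (\<lambda>x. (grad u x \<bullet> b) * \<phi> x)"
      proof -
        have "integrable ?M (\<lambda>x. (indicator K x * (grad u x \<bullet> b)) * \<phi> x)"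
          by (rule integrable_mult_bounded[OF igu[OF K(1,2)] mphi B])
        moreover have "(\<lambda>x. (indicator K x * (grad u x \<bullet> b)) * \<phi> x) = (\<lambda>x. (grad u x \<bullet> b) * \<phi> x)"
          using K(3) by (intro ext) (auto simp: indicator_def)
        ultimately show ?thesis by (rule back_subst)
      qed
      have i2: "integrable ?M (\<lambda>x. (g x \<bullet> b) * \<phi> x)" by (rule integrable_mult_bounded[OF igb mphi B])
      have i3: "integrable ?M (\<lambda>x. ?d x \<bullet> b)"
      proof -
        have "integrable lborel (\<lambda>x. (if x \<in> \<Omega> then ?d x else 0) \<bullet> b)"
          using C1c_integrable(2)[OF Cu] by (intro integrable_inner_left) auto
        then have "integrable lebesgue (\<lambda>x. (if x \<in> \<Omega> then ?d x else 0) \<bullet> b)"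
          using integrable_completion borel_measurable_integrable by blast
        moreover have "(\<lambda>x. (if x \<in> \<Omega> then ?d x else 0) \<bullet> b) = (\<lambda>x. indicator \<Omega> x *\<^sub>R (?d x \<bullet> b))" by (intro ext) auto
        ultimately have "integrable lebesgue (\<lambda>x. indicator \<Omega> x *\<^sub>R (?d x \<bullet> b))" by (rule back_subst)
        then show ?thesis using S by (simp add: integrable_restrict_space)
      qed
      have "(LINT x|?M. u x * pderiv_dir \<phi> b x) = - (LINT x|?M. (g x \<bullet> b) * \<phi> x)"
        using w t b S unfolding weak_grad_def by (simp add: LINT_lebesgue_on)
      moreover have "(LINT x|?M. u x * pderiv_dir \<phi> b x) = (LINT x|?M. ?d x \<bullet> b - (grad u x \<bullet> b) * \<phi> x)"
        by (intro Bochner_Integration.integral_cong) (auto simp: inner_add_left gb)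
      moreover have "(LINT x|?M. ?d x \<bullet> b - (grad u x \<bullet> b) * \<phi> x) = - (LINT x|?M. (grad u x \<bullet> b) * \<phi> x)"
        using 0 i1 i3 by simp
      ultimately have "(LINT x|?M. (g x \<bullet> b) * \<phi> x) - (LINT x|?M. (grad u x \<bullet> b) * \<phi> x) = 0" by simp
      then have "(LINT x|?M. (g x \<bullet> b) * \<phi> x - (grad u x \<bullet> b) * \<phi> x) = 0"
        using Bochner_Integration.integral_diff[OF i2 i1] by simp
      then show ?thesis by (simp add: left_diff_distrib)
    qed
  qed
  have "AE x in ?M. \<forall>b\<in>Basis. g x \<bullet> b - grad u x \<bullet> b = 0"
    using comp by (intro AE_finite_allI) auto
  then show ?thesis by eventually_elim (auto intro: euclidean_eqI)
qed

section \<open>The vector field of the \<open>p\<close>-Laplacian\<close>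

text \<open>The field A of the overview. Its value at the origin is 0 for every \<open>p\<close>,
  also where \<open>p - 2\<close> is negative, so the singular and the degenerate range are treated
  alike.\<close>

definition pfield :: "real \<Rightarrow> 'a::euclidean_space \<Rightarrow> 'a" where
  "pfield p \<xi> = norm \<xi> powr (p - 2) *\<^sub>R \<xi>"

lemma powr_minus_one_mult: "0 \<le> (a::real) \<Longrightarrow> a powr (p - 1) * a = a powr p"
  by (cases "a = 0") (auto simp: powr_diff)

lemma norm_pfield: "norm (pfield p \<xi>) = norm \<xi> powr (p - 1)"
  unfolding pfield_def using powr_minus_one_mult[of "norm \<xi>" "p - 1"] by simp

lemma pfield_inner_self: "pfield p \<xi> \<bullet> \<xi> = norm \<xi> powr p"
proof (cases "\<xi> = 0")
  case False
  then have "norm \<xi> powr (p - 2) * (norm \<xi>)\<^sup>2 = norm \<xi> powr p"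
    by (simp add: powr_diff powr_numeral)
  then show ?thesis by (simp add: pfield_def power2_norm_eq_inner)
qed (simp add: pfield_def)

lemma pfield_scaleR:
  assumes "0 < c"
  shows "pfield p (c *\<^sub>R \<xi>) = c powr (p - 1) *\<^sub>R pfield p \<xi>"
  using assms powr_minus_one_mult[of c "p - 1"] unfolding pfield_def
  by (simp add: powr_mult mult_ac)

lemma borel_measurable_pfield [measurable]: "pfield p \<in> borel_measurable borel"
  unfolding pfield_def by measurable

text \<open>Cauchy-Schwarz in the two mixed products leaves an expression in the norms alone, which
  factorises. This reduction to scalars is uniform in \<open>p\<close>, without a case split at
  2.\<close>

lemma pfield_monotone_norms:
  "(norm \<xi> powr (p - 1) - norm \<eta> powr (p - 1)) * (norm \<xi> - norm \<eta>)
     \<le> (pfield p \<xi> - pfield p \<eta>) \<bullet> (\<xi> - \<eta>)"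
proof -
  have 1: "pfield p \<xi> \<bullet> \<eta> \<le> norm \<xi> powr (p - 1) * norm \<eta>"
    using norm_cauchy_schwarz[of "pfield p \<xi>" \<eta>] by (simp add: norm_pfield)
  have 2: "pfield p \<eta> \<bullet> \<xi> \<le> norm \<eta> powr (p - 1) * norm \<xi>"
    using norm_cauchy_schwarz[of "pfield p \<eta>" \<xi>] by (simp add: norm_pfield)
  have "(pfield p \<xi> - pfield p \<eta>) \<bullet> (\<xi> - \<eta>) = norm \<xi> powr p + norm \<eta> powr p - pfield p \<xi> \<bullet> \<eta> - pfield p \<eta> \<bullet> \<xi>"
    by (simp add: inner_diff_left inner_diff_right pfield_inner_self)
  moreover have "(norm \<xi> powr (p - 1) - norm \<eta> powr (p - 1)) * (norm \<xi> - norm \<eta>)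
    = norm \<xi> powr p + norm \<eta> powr p - norm \<xi> powr (p - 1) * norm \<eta> - norm \<eta> powr (p - 1) * norm \<xi>"
    by (simp add: left_diff_distrib right_diff_distrib powr_minus_one_mult)
  ultimately show ?thesis using 1 2 by linarith
qed

lemma powr_diff_mult_nonneg:
  fixes a b :: real
  assumes "0 \<le> a" "0 \<le> b" "0 < q"
  shows "0 \<le> (a powr q - b powr q) * (a - b)"
  using assms powr_mono2[of q a b] powr_mono2[of q b a]
  by (cases "a \<le> b") (auto intro: mult_nonneg_nonneg mult_nonpos_nonpos)

lemma pfield_monotone:
  assumes "1 < p"
  shows "0 \<le> (pfield p \<xi> - pfield p \<eta>) \<bullet> (\<xi> - \<eta>)"
  using pfield_monotone_norms[of \<xi> p \<eta>] powr_diff_mult_nonneg[of "norm \<xi>" "norm \<eta>" "p - 1"] assms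
  by simp

text \<open>A vanishing pairing forces equal norms, since t^(p-1) is strictly increasing in t. With
  equal norms both values of the field carry the same scalar factor, and the pairing is that factor
  times \<open>(norm (\<xi> - \<eta>))\<^sup>2\<close>; if the common norm is 0, both vectors are
  0.\<close>

lemma pfield_strictly_monotone:
  assumes p: "1 < p" and 0: "(pfield p \<xi> - pfield p \<eta>) \<bullet> (\<xi> - \<eta>) = 0"
  shows "\<xi> = \<eta>"
proof -
  have "(norm \<xi> powr (p - 1) - norm \<eta> powr (p - 1)) * (norm \<xi> - norm \<eta>) = 0"
    using 0 pfield_monotone_norms[of \<xi> p \<eta>] powr_diff_mult_nonneg[of "norm \<xi>" "norm \<eta>" "p - 1"] p
    by simp
  then have eq: "norm \<xi> = norm \<eta>"
    using p powr_less_mono2[of "p - 1" "norm \<xi>" "norm \<eta>"] powr_less_mono2[of "p - 1" "norm \<eta>" "norm \<xi>"]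
    by (cases "norm \<xi>" "norm \<eta>" rule: linorder_cases) auto
  have "(pfield p \<xi> - pfield p \<eta>) \<bullet> (\<xi> - \<eta>) = norm \<xi> powr (p - 2) * (norm (\<xi> - \<eta>))\<^sup>2"
    unfolding pfield_def eq by (simp add: scaleR_diff_right[symmetric] power2_norm_eq_inner)
  then show ?thesis using 0 eq by auto
qed

text \<open>If \<open>norm \<eta>\<close> is at most twice \<open>norm \<xi>\<close>, the term
  \<open>norm \<xi> powr p\<close> alone suffices, with factor \<open>2 powr p\<close>. Otherwise
  the norms are far enough apart for scalar monotonicity to recover a fixed fraction of
  \<open>norm \<eta> powr p\<close>.\<close>

lemma pfield_coercive:
  assumes p: "1 < p"
  obtains C where "0 < C"
    "\<And>\<xi> \<eta> :: 'a::euclidean_space. norm \<eta> powr p \<le> C * ((pfield p \<xi> - pfield p \<eta>) \<bullet> (\<xi> - \<eta>) + norm \<xi> powr p)"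
proof -
  \<comment> \<open>The fraction kept when \<open>a \<le> b / 2\<close>: the difference of the
    powers retains \<open>1 - (1/2) powr (p - 1)\<close> of \<open>b powr (p - 1)\<close>, and
    \<open>b - a\<close> retains half of \<open>b\<close>.\<close>
  define \<kappa> where "\<kappa> = (1 - (1/2) powr (p - 1)) / 2"
  have \<kappa>: "\<kappa> > 0" unfolding \<kappa>_def using p powr_less_mono2[of "p - 1" "1/2" "1::real"] by simp
  define C where "C = 2 powr p + 1 / \<kappa>"
  have C: "C > 0" "2 powr p \<le> C" "1 / \<kappa> \<le> C" unfolding C_def using \<kappa> by (auto simp: add_pos_pos)
  have "norm \<eta> powr p \<le> C * ((pfield p \<xi> - pfield p \<eta>) \<bullet> (\<xi> - \<eta>) + norm \<xi> powr p)" for \<xi> \<eta> :: 'a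
  proof -
    define a b m where "a = norm \<xi>" and "b = norm \<eta>" and "m = (pfield p \<xi> - pfield p \<eta>) \<bullet> (\<xi> - \<eta>)"
    have ab: "0 \<le> a" "0 \<le> b" unfolding a_def b_def by auto
    have m: "0 \<le> m" "(a powr (p - 1) - b powr (p - 1)) * (a - b) \<le> m"
      unfolding m_def a_def b_def using pfield_monotone[OF p] pfield_monotone_norms by auto
    have "b powr p \<le> C * (m + a powr p)"
    proof (cases "b \<le> 2 * a")
      case True
      have "b powr p \<le> (2 * a) powr p" using True ab p by (intro powr_mono2) auto
      also have "\<dots> = 2 powr p * a powr p" using ab by (simp add: powr_mult)
      also have "\<dots> \<le> C * a powr p" using C by (intro mult_right_mono) auto
      also have "\<dots> \<le> C * (m + a powr p)" using C m by (intro mult_left_mono) auto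
      finally show ?thesis .
    next
      case False
      then have a2: "a \<le> b / 2" by simp
      have "a powr (p - 1) \<le> (b / 2) powr (p - 1)" using a2 ab p by (intro powr_mono2) auto
      also have "\<dots> = (1/2) powr (p - 1) * b powr (p - 1)" using ab powr_mult[of "1/2" b "p - 1"] by simp
      finally have "(1 - (1/2) powr (p - 1)) * b powr (p - 1) \<le> b powr (p - 1) - a powr (p - 1)"
        by (simp add: algebra_simps)
      moreover have "b / 2 \<le> b - a" using a2 by simp
      ultimately have "((1 - (1/2) powr (p - 1)) * b powr (p - 1)) * (b / 2) \<le> (b powr (p - 1) - a powr (p - 1)) * (b - a)"
        using ab p a2 powr_mono2[of "p - 1" a b] by (intro mult_mono) auto
      also have "\<dots> \<le> m" using m(2) by (simp add: algebra_simps)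
      finally have "\<kappa> * (b powr (p - 1) * b) \<le> m" unfolding \<kappa>_def by (simp add: algebra_simps)
      then have "\<kappa> * b powr p \<le> m" using ab by (simp add: powr_minus_one_mult)
      then have "b powr p \<le> (1 / \<kappa>) * m" using \<kappa> by (simp add: field_simps)
      also have "\<dots> \<le> C * (m + a powr p)" using C m \<kappa> by (intro mult_mono) auto
      finally show ?thesis .
    qed
    then show ?thesis unfolding a_def b_def m_def .
  qed
  with C(1) show ?thesis by (rule that)
qed

text \<open>A weighted Young inequality with unsharp constants, obtained without conjugate
  exponents: compare \<open>t\<close> with \<open>\<delta> * s\<close> and keep the term that
  dominates.\<close>

lemma powr_Young:
  fixes s t \<delta> p :: real
  assumes "0 \<le> s" "0 \<le> t" "0 < \<delta>" "1 < p"
  shows "s powr (p - 1) * t \<le> \<delta> * s powr p + \<delta> powr (1 - p) * t powr p"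
proof (cases "t \<le> \<delta> * s")
  case True
  have "s powr (p - 1) * t \<le> s powr (p - 1) * (\<delta> * s)" using True by (intro mult_left_mono) auto
  also have "\<dots> = \<delta> * s powr p" using powr_minus_one_mult[OF assms(1), of p] by (simp add: mult_ac)
  also have "\<dots> \<le> \<delta> * s powr p + \<delta> powr (1 - p) * t powr p" by simp
  finally show ?thesis .
next
  case False
  then have "s \<le> t / \<delta>" using assms by (simp add: field_simps)
  then have "s powr (p - 1) \<le> (t / \<delta>) powr (p - 1)" using assms by (intro powr_mono2) auto
  also have "\<dots> = \<delta> powr (1 - p) * t powr (p - 1)"
    using assms by (simp add: powr_divide powr_diff powr_minus_divide field_simps)
  finally have "s powr (p - 1) * t \<le> \<delta> powr (1 - p) * t powr (p - 1) * t"
    using assms by (intro mult_right_mono) auto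
  also have "\<dots> = \<delta> powr (1 - p) * t powr p"
    using powr_minus_one_mult[OF assms(2), of p] by (simp add: mult_ac)
  also have "\<dots> \<le> \<delta> * s powr p + \<delta> powr (1 - p) * t powr p" using assms by simp
  finally show ?thesis .
qed

section \<open>Integrability over compact parts of the domain\<close>

lemma integrable_bounded_support:
  fixes h :: "'a::euclidean_space \<Rightarrow> 'b::euclidean_space"
  assumes m: "h \<in> borel_measurable (lebesgue_on \<Omega>)" and K: "compact K"
    and B: "\<And>x. x \<in> K \<Longrightarrow> x \<in> \<Omega> \<Longrightarrow> norm (h x) \<le> B" and z: "\<And>x. x \<in> \<Omega> - K \<Longrightarrow> h x = 0" and \<Omega>: "\<Omega> \<in> sets lebesgue"
  shows "integrable (lebesgue_on \<Omega>) h"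
proof (rule Bochner_Integration.integrable_bound[OF _ m])
  have "integrable lborel (indicator K :: 'a \<Rightarrow> real)"
    using K emeasure_bounded_finite[OF compact_imp_bounded[OF K]]
    by (intro integrable_real_indicator) (auto simp: compact_imp_closed borel_closed)
  then have i: "integrable lebesgue (indicator K :: 'a \<Rightarrow> real)"
    using K by (subst integrable_completion) (auto simp: compact_imp_closed borel_closed)
  have "integrable (lebesgue_on \<Omega>) (indicator K :: 'a \<Rightarrow> real)"
    using integrable_mult_indicator[OF \<Omega> i] \<Omega> by (simp add: integrable_restrict_space)
  then show "integrable (lebesgue_on \<Omega>) (\<lambda>x. \<bar>B\<bar> * indicator K x)" by simp
  show "AE x in lebesgue_on \<Omega>. norm (h x) \<le> norm (\<bar>B\<bar> * indicat_real K x)"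
  proof (rule AE_I2)
    fix x assume "x \<in> space (lebesgue_on \<Omega>)"
    then show "norm (h x) \<le> norm (\<bar>B\<bar> * indicat_real K x)"
      using B[of x] z[of x] by (cases "x \<in> K") auto
  qed
qed

lemma pfield_continuous_bounded_on_compact:
  assumes "compact K" "continuous_on K d" "1 < p"
  obtains B where "\<And>x. x \<in> K \<Longrightarrow> norm (d x) \<le> B" "\<And>x. x \<in> K \<Longrightarrow> norm (pfield p (d x)) \<le> B"
proof -
  have "bounded (d ` K)" using assms compact_continuous_image compact_imp_bounded by blast
  then obtain B where B: "B > 0" "\<And>x. x \<in> K \<Longrightarrow> norm (d x) \<le> B" unfolding bounded_pos by auto
  have "norm (pfield p (d x)) \<le> B powr (p - 1)" if "x \<in> K" for x
    unfolding norm_pfield using B(2)[OF that] assms(3) by (intro powr_mono2) auto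
  then show ?thesis using that[of "max B (B powr (p - 1))"] B(2) by (meson max.coboundedI1 max.coboundedI2)
qed

section \<open>The transformation \<open>F(u)\<close>\<close>

text \<open>The values of \<open>u\<close> lie strictly between 0 and \<open>af\<close>. There the
  derivatives within the interval become two-sided, monotonicity becomes a sign of
  \<open>f'\<close>, and \<open>f\<close> is positive; the endpoint 0, where \<open>f\<close> may
  vanish, is left out.\<close>

lemma condC_derivative:
  assumes "condC f af"
  obtains f' where "open {t. 0 < t \<and> ereal t < af}"
    "\<forall>t. 0 < t \<and> ereal t < af \<longrightarrow> 0 < f t"
    "\<forall>t. 0 < t \<and> ereal t < af \<longrightarrow> (f has_real_derivative f' t) (at t)"
    "\<forall>t. 0 < t \<and> ereal t < af \<longrightarrow> 0 \<le> f' t"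
    "continuous_on {t. 0 < t \<and> ereal t < af} f'"
proof -
  let ?S = "{t. 0 \<le> t \<and> ereal t < af}" and ?T = "{t. 0 < t \<and> ereal t < af}"
  obtain f' where m: "mono_on ?S f" and d: "\<forall>t\<in>?S. (f has_real_derivative f' t) (at t within ?S)"
    and c: "continuous_on ?S f'" and pos: "\<forall>t\<in>?S. 0 < t \<longrightarrow> 0 < f t"
    using assms unfolding condC_def Let_def by blast
  have "{t. ereal t < af} = ereal -` {..<af}" by auto
  then have "open {t. ereal t < af}" by (simp add: open_ereal_vimage)
  then have o: "open ?T" using open_Int[of "{0<..}" "{t. ereal t < af}"] by (simp add: Int_def)
  have sub: "?T \<subseteq> interior ?S" using o by (intro interior_maximal) auto
  have d': "(f has_real_derivative f' t) (at t)" if "t \<in> ?T" for t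
  proof -
    have "t \<in> ?S" using that by auto
    moreover have "at t within ?S = at t" using that sub at_within_interior by blast
    ultimately show ?thesis using d by metis
  qed
  moreover have "0 \<le> f' t" if "t \<in> ?T" for t
    using mono_on_imp_deriv_nonneg[OF m d'[OF that]] that sub by blast
  moreover have "continuous_on ?T f'" using c by (rule continuous_on_subset) auto
  ultimately show ?thesis using that[of f'] o pos by simp
qed

text \<open>The integrand may blow up at 0. Integrability on an interval reaching beyond
  \<open>t\<close>, together with continuity at the single point \<open>t\<close>, is enough for the
  fundamental theorem of calculus.\<close>

lemma Fint_derivative:
  assumes o: "open {t. 0 < t \<and> ereal t < af}"
    and c: "continuous_on {t. 0 < t \<and> ereal t < af} (\<lambda>s. f s powr (- 1 / (p - 1)))"
    and i: "\<forall>a. 0 < a \<and> ereal a < af \<longrightarrow> set_integrable lborel {0<..<a} (\<lambda>s. f s powr (- 1 / (p - 1)))"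
    and t: "0 < t" "ereal t < af"
  shows "(Fint p f has_real_derivative f t powr (- 1 / (p - 1))) (at t)"
proof -
  let ?k = "\<lambda>s. f s powr (- 1 / (p - 1))"
  obtain e where e: "e > 0" "ball t e \<subseteq> {t. 0 < t \<and> ereal t < af}"
    using o t open_contains_ball by (metis (mono_tags, lifting) mem_Collect_eq)
  define a where "a = t + e / 2"
  have a: "t < a" "ereal a < af" "0 < a"
    using e subsetD[OF e(2), of a] t unfolding a_def by (auto simp: dist_real_def)
  have si: "set_integrable lborel {0..y} ?k" if "0 \<le> y" "y < a" for y
  proof -
    have "set_integrable lborel {0<..<a} ?k" using i a by blast
    then have "set_integrable lborel {0<..y} ?k"
      by (rule set_integrable_subset) (use that in auto)
    \<comment> \<open>\<open>Fint\<close> integrates over a closed interval and the hypothesis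
      speaks of an open one; the endpoint 0 is added as a compact singleton.\<close>
    moreover have "set_integrable lborel {0} ?k"
      unfolding set_integrable_def by (intro borel_integrable_compact) auto
    ultimately have "set_integrable lborel ({0} \<union> {0<..y}) ?k" by (intro set_integrable_Un) auto
    moreover have "{0} \<union> {0<..y} = {0..y}" using that by auto
    ultimately show ?thesis by simp
  qed
  have F: "Fint p f y = integral {0..y} ?k" if "0 \<le> y" "y < a" for y
    unfolding Fint_def by (rule set_borel_integral_eq_integral(2)[OF si[OF that]])
  define b where "b = (t + a) / 2"
  have b: "t < b" "b < a" unfolding b_def using a by auto
  have "?k integrable_on {0..b}"
    using set_borel_integral_eq_integral(1)[OF si[of b]] b t by simp
  moreover have "isCont ?k t" using c o t continuous_on_eq_continuous_at[of "{t. 0 < t \<and> ereal t < af}" ?k] by auto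
  then have "continuous (at t within {0..b}) ?k" by (rule continuous_at_imp_continuous_at_within)
  ultimately have "((\<lambda>y. integral {0..y} ?k) has_vector_derivative ?k t) (at t within {0..b})"
    using integral_has_vector_derivative_continuous_at[of ?k 0 b t "{}"] t b by simp
  moreover have "at t within {0..b} = at t" using t b by (intro at_within_interior) auto
  ultimately have "((\<lambda>y. integral {0..y} ?k) has_real_derivative ?k t) (at t)"
    by (simp add: has_real_derivative_iff_has_vector_derivative)
  then show ?thesis
    by (rule has_field_derivative_transform_within_open[of _ _ _ "{0<..<b}"]) (use t b F in auto)
qed

lemma Fint_nonneg: "0 \<le> Fint p f t"
  unfolding Fint_def set_lebesgue_integral_def by (intro integral_nonneg_AE) auto

text \<open>What the comparison arguments use of F(u): a classical gradient inside
  \<open>\<Omega>\<close>, C^1 tests with compact support, and \<open>0 \<le> w x\<close> in the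
  role of the boundary condition. Everything is local because
  \<open>f (u x) powr (- 1 / (p - 1))\<close> may be unbounded near the boundary.\<close>

definition plap_supersolution ::
  "real \<Rightarrow> 'a::euclidean_space set \<Rightarrow> ('a \<Rightarrow> real) \<Rightarrow> ('a \<Rightarrow> real) \<Rightarrow> ('a \<Rightarrow> 'a) \<Rightarrow> bool" where
  "plap_supersolution p \<Omega> \<rho> w dw \<longleftrightarrow>
     (\<forall>x\<in>\<Omega>. (w has_derivative (\<lambda>h. dw x \<bullet> h)) (at x)) \<and> continuous_on \<Omega> dw \<and> (\<forall>x\<in>\<Omega>. 0 \<le> w x) \<and>
     (\<forall>\<theta> d\<theta>. C1c \<Omega> \<theta> d\<theta> \<and> (\<forall>x. 0 \<le> \<theta> x) \<longrightarrow>
       (LINT x|lebesgue_on \<Omega>. \<rho> x * \<theta> x) \<le> (LINT x|lebesgue_on \<Omega>. pfield p (dw x) \<bullet> d\<theta> x))"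

lemma integrable_pfield_Lp:
  fixes g :: "'a::euclidean_space \<Rightarrow> 'a"
  assumes "open \<Omega>" "bounded \<Omega>" "Lp_on p \<Omega> g" "1 < p"
  shows "integrable (lebesgue_on \<Omega>) (\<lambda>x. pfield p (g x))"
proof -
  have m: "g \<in> borel_measurable (lebesgue_on \<Omega>)" using assms unfolding Lp_on_def by simp
  have "integrable (lebesgue_on \<Omega>) (\<lambda>x. norm (pfield p (g x)))"
    unfolding norm_pfield using integrable_norm_Lp[OF assms(1-3), of "p - 1"] assms(4) by simp
  moreover have "(\<lambda>x. pfield p (g x)) \<in> borel_measurable (lebesgue_on \<Omega>)" using m by measurable
  ultimately show ?thesis by (simp add: integrable_norm_iff)
qed

lemma integrable_pfield_inner_C1c:
  assumes \<Omega>: "open \<Omega>" and d: "continuous_on \<Omega> d" and p: "1 < p" and C: "C1c \<Omega> \<theta> d\<theta>"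
  shows "integrable (lebesgue_on \<Omega>) (\<lambda>x. pfield p (d x) \<bullet> d\<theta> x)"
proof -
  have S: "\<Omega> \<in> sets lebesgue" using \<Omega> by auto
  obtain K where K: "compact K" "K \<subseteq> \<Omega>" "\<And>x. x \<notin> K \<Longrightarrow> d\<theta> x = 0" using C unfolding C1c_def by metis
  obtain B where B: "\<And>x. x \<in> K \<Longrightarrow> norm (d x) \<le> B" "\<And>x. x \<in> K \<Longrightarrow> norm (pfield p (d x)) \<le> B"
    using pfield_continuous_bounded_on_compact[OF K(1) continuous_on_subset[OF d K(2)] p] by metis
  obtain B' where B': "0 < B'" "\<And>x. \<bar>\<theta> x\<bar> \<le> B'" "\<And>x. norm (d\<theta> x) \<le> B'" using C1c_bounded[OF C] by metis
  show ?thesis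
  proof (rule integrable_bounded_support[OF _ K(1) _ _ S])
    have "d \<in> borel_measurable (lebesgue_on \<Omega>)" using continuous_imp_measurable_on_sets_lebesgue[OF d S] .
    then show "(\<lambda>x. pfield p (d x) \<bullet> d\<theta> x) \<in> borel_measurable (lebesgue_on \<Omega>)"
      using C1c_measurable(2)[OF C, of \<Omega>] by measurable
    show "norm (pfield p (d x) \<bullet> d\<theta> x) \<le> B * B'" if "x \<in> K" for x
    proof -
      have "norm (pfield p (d x) \<bullet> d\<theta> x) \<le> norm (pfield p (d x)) * norm (d\<theta> x)"
        using Cauchy_Schwarz_ineq2[of "pfield p (d x)" "d\<theta> x"] by simp
      also have "\<dots> \<le> B * B'" using B(2)[OF that] B'(3)[of x] norm_ge_zero[of "pfield p (d x)"] norm_ge_zero[of "d\<theta> x"]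
        by (intro mult_mono) linarith+
      finally show ?thesis .
    qed
  qed (use K(3) in auto)
qed

text \<open>Measurability of \<open>\<rho>\<close> is recovered by division:
  \<open>\<rho> x * k x\<close> is measurable, and \<open>k\<close>, later \<open>f (u x)\<close>,
  is continuous and positive. Boundedness on a set of finite measure does the rest.\<close>

lemma supersolution_density_integrable:
  fixes \<Omega> :: "'a::euclidean_space set" and \<rho> k :: "'a \<Rightarrow> real"
  assumes \<Omega>: "open \<Omega>" "bounded \<Omega>" and b: "bounded (\<rho> ` \<Omega>)"
    and c: "continuous_on \<Omega> k" "\<forall>x\<in>\<Omega>. 0 < k x" and i: "integrable (lebesgue_on \<Omega>) (\<lambda>x. \<rho> x * k x)"
  shows "integrable (lebesgue_on \<Omega>) \<rho>"
proof -
  have S: "\<Omega> \<in> sets lebesgue" using \<Omega> by auto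
  have "k \<in> borel_measurable (lebesgue_on \<Omega>)" using continuous_imp_measurable_on_sets_lebesgue[OF c(1) S] .
  then have "(\<lambda>x. (\<rho> x * k x) / k x) \<in> borel_measurable (lebesgue_on \<Omega>)" using i by measurable
  moreover have "(\<rho> x * k x) / k x = \<rho> x" if "x \<in> space (lebesgue_on \<Omega>)" for x using c(2) that by force
  ultimately have m: "\<rho> \<in> borel_measurable (lebesgue_on \<Omega>)" by (rule measurable_cong[THEN iffD1, rotated])
  obtain B where "\<And>x. x \<in> \<Omega> \<Longrightarrow> norm (\<rho> x) \<le> B" using b unfolding bounded_iff by auto
  then have "AE x in lebesgue_on \<Omega>. norm (\<rho> x) \<le> B" by (intro AE_I2) simp
  moreover have "finite_measure (lebesgue_on \<Omega>)"
    using \<Omega> by (intro finite_measure_lebesgue_on lmeasurable_open)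
  ultimately show ?thesis using m finite_measure.integrable_const_bound by blast
qed

text \<open>Testing the inequality for \<open>u\<close> with \<open>\<theta> / f(u)\<close>: the term that comes from differentiating
  \<open>1 / f(u)\<close> has the good sign because \<open>f\<close> is nondecreasing, and the remaining term is the flux
  of \<open>F(u)\<close> paired with the gradient of \<open>\<theta>\<close>.\<close>

lemma supersolution_transform:
  fixes \<Omega> :: "'a::euclidean_space set"
  assumes \<Omega>: "open \<Omega>" "bounded \<Omega>" and p: "p > 1" and b: "bounded (\<rho> ` \<Omega>)"
    and fC: "condC f af"
    and fint: "\<forall>a. 0 < a \<and> ereal a < af \<longrightarrow>
                 set_integrable lborel {0<..<a} (\<lambda>s. f s powr (- 1 / (p - 1)))"
    and u: "C1_on \<Omega> u" and sup: "supersolution p \<Omega> \<rho> f u"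
    and pos: "\<forall>x\<in>\<Omega>. 0 < u x \<and> ereal (u x) < af"
  shows "integrable (lebesgue_on \<Omega>) \<rho>"
    and "plap_supersolution p \<Omega> \<rho> (\<lambda>x. Fint p f (u x)) (\<lambda>x. f (u x) powr (- 1 / (p - 1)) *\<^sub>R grad u x)"
proof -
  let ?M = "lebesgue_on \<Omega>" and ?T = "{t. 0 < t \<and> ereal t < af}"
  have S: "\<Omega> \<in> sets lebesgue" using \<Omega> by auto
  obtain f' where oT: "open ?T" and fpos: "\<forall>t. 0 < t \<and> ereal t < af \<longrightarrow> 0 < f t"
    and f': "\<forall>t. 0 < t \<and> ereal t < af \<longrightarrow> (f has_real_derivative f' t) (at t)"
    and f'nn: "\<forall>t. 0 < t \<and> ereal t < af \<longrightarrow> 0 \<le> f' t" and cf': "continuous_on ?T f'"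
    using condC_derivative[OF fC] .
  have cf: "continuous_on ?T f"
    using f' by (intro continuous_at_imp_continuous_on) (auto intro: DERIV_isCont)
  have du: "\<And>x. x \<in> \<Omega> \<Longrightarrow> (u has_derivative (\<lambda>h. grad u x \<bullet> h)) (at x)" and cgu: "continuous_on \<Omega> (grad u)"
    using u has_derivative_grad unfolding C1_on_def by blast+
  have cu: "continuous_on \<Omega> u"
    using du has_derivative_continuous by (intro continuous_at_imp_continuous_on) blast
  have uT: "u ` \<Omega> \<subseteq> ?T" using pos by auto
  have cfu: "continuous_on \<Omega> (\<lambda>x. f (u x))" and cf'u: "continuous_on \<Omega> (\<lambda>x. f' (u x))"
    by (rule continuous_on_compose2[OF cf cu uT], rule continuous_on_compose2[OF cf' cu uT])
  have fup: "0 < f (u x)" if "x \<in> \<Omega>" for x using fpos pos that by blast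
  have dfu: "((\<lambda>x. f (u x)) has_derivative (\<lambda>h. f' (u x) * (grad u x \<bullet> h))) (at x)" if "x \<in> \<Omega>" for x
    using has_derivative_compose[OF du[OF that], of f "\<lambda>t. f' (u x) * t"] f' pos that
    by (simp add: has_field_derivative_def)
  obtain g where sob: "sobolev0 p \<Omega> u g" and irf: "set_integrable lebesgue \<Omega> (\<lambda>x. \<rho> x * f (u x))"
    and test: "\<forall>\<phi>. test_fun \<Omega> \<phi> \<and> (\<forall>x. 0 \<le> \<phi> x) \<longrightarrow>
        (LINT x:\<Omega>|lebesgue. (norm (g x) powr (p - 2) *\<^sub>R g x) \<bullet> grad \<phi> x)
          \<ge> (LINT x:\<Omega>|lebesgue. \<rho> x * f (u x) * \<phi> x)"
    using sup unfolding supersolution_def by blast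
  have Lp: "Lp_on p \<Omega> g" and wg: "weak_grad \<Omega> u g" using sob unfolding sobolev0_def by auto
  \<comment> \<open>The supersolution comes with an abstract weak gradient \<open>g\<close>; almost
    everywhere it is now interchangeable with the classical one.\<close>
  have geq: "AE x in ?M. g x = grad u x" using weak_grad_C1_eq_grad[OF \<Omega> u wg Lp] p by simp
  have irf': "integrable ?M (\<lambda>x. \<rho> x * f (u x))" using irf S set_integrable_lebesgue_on by blast
  show "integrable ?M \<rho>"
    using fup by (intro supersolution_density_integrable[OF \<Omega> b cfu _ irf']) auto
  let ?V = "\<lambda>x. pfield p (g x)"
  have iV: "integrable ?M ?V" using integrable_pfield_Lp[OF \<Omega> Lp p] .
  have test': "(LINT x|?M. \<rho> x * f (u x) * \<phi> x) \<le> (LINT x|?M. ?V x \<bullet> grad \<phi> x)"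
    if "test_fun \<Omega> \<phi>" "\<And>x. 0 \<le> \<phi> x" for \<phi>
    using test that S unfolding pfield_def by (simp add: LINT_lebesgue_on)
  let ?w = "\<lambda>x. Fint p f (u x)" and ?dw = "\<lambda>x. f (u x) powr (- 1 / (p - 1)) *\<^sub>R grad u x"
  have cdw: "continuous_on \<Omega> ?dw"
    using cfu cgu fup by (intro continuous_intros) force+
  have dw: "(?w has_derivative (\<lambda>h. ?dw x \<bullet> h)) (at x)" if x: "x \<in> \<Omega>" for x
  proof -
    have "continuous_on ?T (\<lambda>s. f s powr (- 1 / (p - 1)))"
      using cf fpos by (intro continuous_intros) force+
    then have "(Fint p f has_real_derivative f (u x) powr (- 1 / (p - 1))) (at (u x))"
      using pos x by (intro Fint_derivative[OF oT _ fint]) auto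
    then show ?thesis
      using has_derivative_compose[OF du[OF x], of "Fint p f" "\<lambda>t. f (u x) powr (- 1 / (p - 1)) * t"]
      by (simp add: has_field_derivative_def)
  qed
  \<comment> \<open>This explains the exponent in \<open>Fint\<close>: \<open>pfield p\<close> is
    homogeneous of degree \<open>p - 1\<close>, so the factor
    \<open>f (u x) powr (- 1 / (p - 1))\<close> leaves it as exactly
    \<open>1 / f (u x)\<close>.\<close>
  have flux: "pfield p (?dw x) = (1 / f (u x)) *\<^sub>R pfield p (grad u x)" if "x \<in> \<Omega>" for x
  proof -
    have "(f (u x) powr (- 1 / (p - 1))) powr (p - 1) = 1 / f (u x)"
    proof -
      have "- 1 / (p - 1) * (p - 1) = - 1" using p by simp
      then show ?thesis
        using fup[OF that] unfolding powr_powr by (simp add: powr_minus_divide)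
    qed
    then show ?thesis using pfield_scaleR[of "f (u x) powr (- 1 / (p - 1))" p "grad u x"] fup[OF that] by simp
  qed
  have main: "(LINT x|?M. \<rho> x * \<theta> x) \<le> (LINT x|?M. pfield p (?dw x) \<bullet> d\<theta> x)"
    if C: "C1c \<Omega> \<theta> d\<theta>" and nn: "\<forall>x. 0 \<le> \<theta> x" for \<theta> d\<theta>
  proof -
    obtain K where K: "compact K" "K \<subseteq> \<Omega>" "\<And>x. x \<notin> K \<Longrightarrow> \<theta> x = 0 \<and> d\<theta> x = 0"
      using C unfolding C1c_def by metis
    have d\<theta>: "(\<theta> has_derivative (\<lambda>h. d\<theta> x \<bullet> h)) (at x)" for x using C unfolding C1c_def by blast
    have c\<theta>: "continuous_on UNIV \<theta>" "continuous_on UNIV d\<theta>"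
      using C C1c_continuous unfolding C1c_def by blast+
    \<comment> \<open>The quotient rule for \<open>\<theta> x / f (u x)\<close>; paired with the
      flux of \<open>u\<close>, the second summand is the one whose sign follows from
      \<open>0 \<le> f' (u x)\<close>.\<close>
    let ?e = "\<lambda>x. (1 / f (u x)) *\<^sub>R d\<theta> x - (\<theta> x * f' (u x) / (f (u x))\<^sup>2) *\<^sub>R grad u x"
    let ?\<theta>' = "\<lambda>x. if x \<in> \<Omega> then \<theta> x / f (u x) else 0" and ?d' = "\<lambda>x. if x \<in> \<Omega> then ?e x else 0"
    have C': "C1c \<Omega> ?\<theta>' ?d'"
    proof (rule C1c_extend[OF \<Omega>(1) K(1,2)])
      show "((\<lambda>x. \<theta> x / f (u x)) has_derivative (\<lambda>h. ?e x \<bullet> h)) (at x)" if "x \<in> \<Omega>" for x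
        by (rule has_derivative_eq_rhs[OF has_derivative_divide[OF d\<theta> dfu[OF that]]])
           (use fup[OF that] in \<open>auto simp: inner_diff_left field_simps power2_eq_square\<close>)
      show "continuous_on \<Omega> ?e"
        using fup by (intro continuous_intros cfu cf'u cgu continuous_on_subset[OF c\<theta>(1)] continuous_on_subset[OF c\<theta>(2)]) force+
    qed (use K in auto)
    have nn': "0 \<le> ?\<theta>' x" for x using nn fup by (simp add: less_imp_le)
    have "(LINT x|?M. \<rho> x * \<theta> x) = (LINT x|?M. \<rho> x * f (u x) * ?\<theta>' x)"
      using fup by (intro Bochner_Integration.integral_cong) (force simp: field_simps)+
    also have "\<dots> \<le> (LINT x|?M. ?V x \<bullet> ?d' x)"
      by (rule test_inequality_C1c[OF \<Omega>(1) iV irf' test' C' nn'])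
    also have "\<dots> \<le> (LINT x|?M. pfield p (?dw x) \<bullet> d\<theta> x)"
    proof (rule integral_mono_AE)
      obtain B where B: "0 < B" "\<And>x. \<bar>?\<theta>' x\<bar> \<le> B" "\<And>x. norm (?d' x) \<le> B"
        using C1c_bounded[OF C'] by metis
      show "integrable ?M (\<lambda>x. ?V x \<bullet> ?d' x)"
        by (rule integrable_inner_bounded[OF iV C1c_measurable(2)[OF C'] B(3)])
      show "integrable ?M (\<lambda>x. pfield p (?dw x) \<bullet> d\<theta> x)"
        by (rule integrable_pfield_inner_C1c[OF \<Omega>(1) cdw p C])
      show "AE x in ?M. ?V x \<bullet> ?d' x \<le> pfield p (?dw x) \<bullet> d\<theta> x"
        using geq AE_space
      proof eventually_elim
        fix x assume gx: "g x = grad u x" and "x \<in> space ?M"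
        then have x: "x \<in> \<Omega>" by simp
        have "pfield p (grad u x) \<bullet> ?e x = pfield p (?dw x) \<bullet> d\<theta> x
          - (\<theta> x * f' (u x) / (f (u x))\<^sup>2) * norm (grad u x) powr p"
          unfolding flux[OF x] by (simp add: inner_diff_right pfield_inner_self)
        moreover have "0 \<le> (\<theta> x * f' (u x) / (f (u x))\<^sup>2) * norm (grad u x) powr p"
          using nn f'nn pos x by auto
        ultimately show "?V x \<bullet> ?d' x \<le> pfield p (?dw x) \<bullet> d\<theta> x" using gx x by simp
      qed
    qed
    finally show ?thesis .
  qed
  show "plap_supersolution p \<Omega> \<rho> ?w ?dw"
    unfolding plap_supersolution_def using dw cdw main Fint_nonneg by blast
qed

text \<open>A \<open>C\<^sup>1\<close> substitute for the positive part with bounded derivative; it makes Sobolev chain rules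
  unnecessary.\<close>

definition smooth_pos :: "real \<Rightarrow> real" where
  "smooth_pos t = sqrt (1 + (max 0 t)\<^sup>2) - 1"

definition smooth_pos' :: "real \<Rightarrow> real" where
  "smooth_pos' t = max 0 t / sqrt (1 + (max 0 t)\<^sup>2)"

lemma DERIV_max_0_power2: "((\<lambda>t. (max 0 t)\<^sup>2) has_real_derivative 2 * max 0 t) (at t)"
proof (cases t "0::real" rule: linorder_cases)
  case less
  have "((\<lambda>x. 0) has_real_derivative 0) (at t)" by simp
  then have "((\<lambda>t. (max 0 t)\<^sup>2) has_real_derivative 0) (at t)"
    by (rule has_field_derivative_transform_within_open[of _ _ _ "{..<0}"]) (use less in auto)
  then show ?thesis using less by simp
next
  case equal
  have "((\<lambda>h::real. max 0 h) \<longlongrightarrow> max 0 0) (at 0)" by (intro tendsto_intros)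
  moreover have "(\<lambda>h. ((max 0 (0 + h))\<^sup>2 - (max 0 (0::real))\<^sup>2) / h) = (\<lambda>h::real. max 0 h)"
    by (intro ext) (simp add: max_def power2_eq_square)
  ultimately have "((\<lambda>t. (max 0 t)\<^sup>2) has_real_derivative 0) (at 0)"
    unfolding DERIV_def by (simp only: max.idem)
  then show ?thesis using equal by simp
next
  case greater
  have "((\<lambda>x. x\<^sup>2) has_real_derivative 2 * t) (at t)" by (auto intro!: derivative_eq_intros)
  then have "((\<lambda>t. (max 0 t)\<^sup>2) has_real_derivative 2 * t) (at t)"
    by (rule has_field_derivative_transform_within_open[of _ _ _ "{0<..}"]) (use greater in auto)
  then show ?thesis using greater by simp
qed

lemma DERIV_smooth_pos: "(smooth_pos has_real_derivative smooth_pos' t) (at t)"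
proof -
  have p: "1 + (max 0 t)\<^sup>2 > 0" by (simp add: add_pos_nonneg)
  have "((\<lambda>t. sqrt (1 + (max 0 t)\<^sup>2) - 1) has_real_derivative smooth_pos' t) (at t)"
  proof -
    have "((\<lambda>t. 1 + (max 0 t)\<^sup>2) has_real_derivative 2 * max 0 t) (at t)"
      using DERIV_add[OF DERIV_const[of 1] DERIV_max_0_power2] by simp
    from DERIV_diff[OF DERIV_chain2[OF DERIV_real_sqrt[OF p] this] DERIV_const[of 1]]
    show ?thesis unfolding smooth_pos'_def by (rule DERIV_cong) (simp add: field_simps)
  qed
  then show ?thesis unfolding smooth_pos_def .
qed

lemma smooth_pos_nonneg: "0 \<le> smooth_pos t" unfolding smooth_pos_def by simp

lemma smooth_pos_eq_0_iff: "smooth_pos t = 0 \<longleftrightarrow> t \<le> 0"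
proof -
  have "smooth_pos t = 0 \<longleftrightarrow> sqrt (1 + (max 0 t)\<^sup>2) = 1" unfolding smooth_pos_def by linarith
  also have "\<dots> \<longleftrightarrow> max 0 t = 0" by (simp only: real_sqrt_eq_1_iff add_cancel_left_right zero_eq_power2)
  also have "\<dots> \<longleftrightarrow> t \<le> 0" by linarith
  finally show ?thesis .
qed

lemma smooth_pos'_bounds: "0 \<le> smooth_pos' t" "smooth_pos' t \<le> 1"
proof -
  have "max 0 t = sqrt ((max 0 t)\<^sup>2)" by simp
  also have "\<dots> \<le> sqrt (1 + (max 0 t)\<^sup>2)" by (intro real_sqrt_le_mono) simp
  finally show "smooth_pos' t \<le> 1" unfolding smooth_pos'_def by (simp add: divide_le_eq_1 add_pos_nonneg)
  show "0 \<le> smooth_pos' t" unfolding smooth_pos'_def by simp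
qed

lemma smooth_pos'_eq_0_iff: "smooth_pos' t = 0 \<longleftrightarrow> t \<le> 0"
proof -
  have "1 + (max 0 t)\<^sup>2 > 0" by (simp add: add_pos_nonneg)
  then show ?thesis unfolding smooth_pos'_def by (auto simp: max_def)
qed

lemma continuous_smooth_pos': "continuous_on UNIV smooth_pos'"
proof -
  have "1 + (max 0 t)\<^sup>2 > 0" for t :: real by (simp add: add_pos_nonneg)
  then show ?thesis unfolding smooth_pos'_def by (intro continuous_intros) (metis less_irrefl real_sqrt_eq_zero_cancel_iff)
qed

text \<open>Pairing this gradient with a difference of fluxes gives \<open>smooth_pos'\<close> times
  a monotone pairing, hence something nonnegative. Both \<open>smooth_pos\<close> and
  \<open>smooth_pos'\<close> vanish where \<open>v x \<le> w x\<close>, which confines the support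
  to \<open>K\<close>.\<close>

lemma C1c_smooth_pos_diff:
  assumes \<Omega>: "open \<Omega>" and K: "compact K" "K \<subseteq> \<Omega>"
    and v: "\<And>x. x \<in> \<Omega> \<Longrightarrow> (v has_derivative (\<lambda>h. dv x \<bullet> h)) (at x)" "continuous_on \<Omega> dv"
    and w: "\<And>x. x \<in> \<Omega> \<Longrightarrow> (w has_derivative (\<lambda>h. dw x \<bullet> h)) (at x)" "continuous_on \<Omega> dw"
    and z: "\<And>x. x \<in> \<Omega> - K \<Longrightarrow> v x \<le> w x"
  shows "C1c \<Omega> (\<lambda>x. if x \<in> \<Omega> then smooth_pos (v x - w x) else 0)
    (\<lambda>x. if x \<in> \<Omega> then smooth_pos' (v x - w x) *\<^sub>R (dv x - dw x) else 0)"
proof (rule C1c_extend[OF \<Omega> K])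
  show "((\<lambda>x. smooth_pos (v x - w x)) has_derivative (\<lambda>h. (smooth_pos' (v x - w x) *\<^sub>R (dv x - dw x)) \<bullet> h)) (at x)"
    if "x \<in> \<Omega>" for x
    using has_derivative_compose[OF has_derivative_diff[OF v(1)[OF that] w(1)[OF that]]
        DERIV_smooth_pos[unfolded has_field_derivative_def]]
    by (simp add: inner_diff_left)
  have cv: "continuous_on \<Omega> v" "continuous_on \<Omega> w"
    by (intro continuous_at_imp_continuous_on ballI, rule has_derivative_continuous, erule v(1) w(1))+
  show "continuous_on \<Omega> (\<lambda>x. smooth_pos' (v x - w x) *\<^sub>R (dv x - dw x))"
    by (rule continuous_on_scaleR[OF continuous_on_compose2[OF continuous_smooth_pos'
          continuous_on_diff[OF cv]] continuous_on_diff[OF v(2) w(2)]]) auto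
  show "smooth_pos (v x - w x) = 0 \<and> smooth_pos' (v x - w x) *\<^sub>R (dv x - dw x) = 0" if "x \<in> \<Omega> - K" for x
    using z[OF that] smooth_pos_eq_0_iff smooth_pos'_eq_0_iff by simp
qed

section \<open>Comparison\<close>

lemma continuous_pfield:
  assumes "1 < q"
  shows "continuous_on UNIV (pfield q)"
proof (intro continuous_at_imp_continuous_on ballI)
  fix x :: 'a
  show "isCont (pfield q) x"
  proof (cases "x = 0")
    case True
    have "((\<lambda>h::'a. norm h powr (q - 1)) \<longlongrightarrow> 0) (at 0)"
      using assms by (intro tendsto_zero_powrI[OF _ tendsto_const] tendsto_norm_zero tendsto_ident_at) auto
    then have "((\<lambda>h::'a. norm (pfield q h)) \<longlongrightarrow> 0) (at 0)" by (simp add: norm_pfield)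
    then have "(pfield q \<longlongrightarrow> (0::'a)) (at 0)" by (rule tendsto_norm_zero_cancel)
    then show ?thesis using True by (simp add: isCont_def pfield_def)
  next
    case False
    then show ?thesis unfolding pfield_def by (intro continuous_intros) auto
  qed
qed

text \<open>Away from the origin this is the chain rule; at the origin the quotient is
  \<open>norm h powr (q - 1)\<close>, which tends to 0 because \<open>q\<close> exceeds 1.\<close>

lemma has_derivative_norm_powr:
  fixes x :: "'a::euclidean_space"
  assumes q: "1 < q"
  shows "((\<lambda>x. norm x powr q) has_derivative (\<lambda>h. (q *\<^sub>R pfield q x) \<bullet> h)) (at x)"
proof (cases "x = 0")
  case True
  have "((\<lambda>h::'a. norm h powr (q - 1)) \<longlongrightarrow> 0) (at 0)"
    using q by (intro tendsto_zero_powrI[OF _ tendsto_const] tendsto_norm_zero tendsto_ident_at) auto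
  moreover have "norm (norm h powr q) / norm h = norm h powr (q - 1)" for h :: 'a
    using powr_minus_one_mult[of "norm h" q] by (cases "h = 0") (auto simp: field_simps)
  ultimately have "((\<lambda>x::'a. norm x powr q) has_derivative (\<lambda>h. 0)) (at 0)"
    by (simp add: has_derivative_at)
  then show ?thesis using True by (simp add: pfield_def)
next
  case False
  have n: "(norm has_derivative (\<lambda>h. (x \<bullet> h) / norm x)) (at x)"
    using has_derivative_norm[OF False] by (rule has_derivative_eq_rhs) (auto simp: sgn_div_norm inner_commute divide_inverse mult.commute)
  have "((\<lambda>t. t powr q) has_real_derivative q * norm x powr (q - 1)) (at (norm x))"
    using False by (auto intro!: derivative_eq_intros)
  from has_derivative_compose[OF n this[unfolded has_field_derivative_def]]
  show ?thesis
  proof (rule has_derivative_eq_rhs)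
    have e: "norm x powr (q - 1) / norm x = norm x powr (q - 2)" using False by (simp add: powr_diff powr_numeral power2_eq_square)
    show "(\<lambda>h. q * norm x powr (q - 1) * ((x \<bullet> h) / norm x)) = (\<lambda>h. (q *\<^sub>R pfield q x) \<bullet> h)"
      by (intro ext) (simp add: pfield_def e[symmetric])
  qed
qed

text \<open>Conjugacy means \<open>(q - 1) * (p - 1) = 1\<close>, which cancels all powers of the
  norm. It fixes the exponent of the barrier: the gradient of \<open>norm x powr q\<close> is a
  multiple of \<open>pfield q x\<close>, so its image under \<open>pfield p\<close> is
  linear.\<close>

lemma pfield_conjugate:
  assumes "1 < p" "q = p / (p - 1)"
  shows "pfield p (pfield q z) = z"
proof (cases "z = 0")
  case False
  have "(q - 1) * (p - 2) + (q - 2) = 0" using assms by (simp add: field_simps)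
  then have "(norm z powr (q - 1)) powr (p - 2) * norm z powr (q - 2) = 1"
    using False by (simp add: powr_powr powr_add[symmetric])
  then show ?thesis
    unfolding pfield_def[of p] norm_pfield by (simp add: pfield_def)
qed (simp add: pfield_def)

lemma pfield_uminus: "pfield p (- \<xi>) = - pfield p \<xi>"
  unfolding pfield_def by simp

text \<open>The set where \<open>h\<close> is positive is open, and an open null set is
  empty.\<close>

lemma continuous_AE_nonpos_imp_nonpos:
  fixes h :: "'a::euclidean_space \<Rightarrow> real"
  assumes \<Omega>: "open \<Omega>" and c: "continuous_on \<Omega> h" and ae: "AE x in lebesgue_on \<Omega>. h x \<le> 0" and x: "x \<in> \<Omega>"
  shows "h x \<le> 0"
proof -
  let ?A = "\<Omega> \<inter> h -` {0<..}"
  have o: "open ?A" using continuous_open_preimage[OF c \<Omega>] by simp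
  have "AE x in lebesgue. x \<in> \<Omega> \<longrightarrow> h x \<le> 0" using ae \<Omega> by (subst (asm) AE_restrict_space_iff) auto
  then have "AE x in lebesgue. x \<notin> ?A" by eventually_elim auto
  then have "emeasure lebesgue ?A = 0" using o by (subst (asm) AE_iff_measurable[of ?A]) auto
  then have "negligible ?A" using o by (simp add: negligible_iff_null_sets null_sets_def)
  then have "?A = {}" using open_not_negligible[OF o] by blast
  then show ?thesis using x by force
qed

text \<open>The Poincare inequality makes the integral of the nonnegative \<open>\<theta>\<close>
  zero; continuity then turns almost everywhere into everywhere.\<close>

lemma C1c_AE_zero_gradient_imp_zero:
  assumes C: "C1c \<Omega> \<theta> d\<theta>" and \<Omega>: "open \<Omega>" "bounded \<Omega>" and nn: "\<And>x. 0 \<le> \<theta> x"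
    and ae: "AE x in lebesgue_on \<Omega>. d\<theta> x = 0"
  shows "\<theta> x = 0"
proof (cases "x \<in> \<Omega>")
  case False
  then show ?thesis using C unfolding C1c_def by blast
next
  case True
  have S: "\<Omega> \<in> sets lebesgue" using \<Omega> by auto
  obtain R where R: "\<And>x. x \<in> \<Omega> \<Longrightarrow> norm x \<le> R" using \<Omega>(2) unfolding bounded_iff by blast
  have c: "continuous_on UNIV \<theta>" "continuous_on UNIV d\<theta>"
    using C C1c_continuous unfolding C1c_def by blast+
  have z: "d\<theta> y = 0" "\<theta> y = 0" if "y \<notin> \<Omega>" for y using C that unfolding C1c_def by blast+
  have e: "(LINT x|lborel. norm (d\<theta> x)) = (LINT x|lebesgue_on \<Omega>. norm (d\<theta> x))"
    using z by (intro integral_lebesgue_on_eq_lborel[symmetric] S continuous_on_norm c) auto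
  have "(LINT x|lebesgue_on \<Omega>. norm (d\<theta> x)) = (LINT x|lebesgue_on \<Omega>. 0)"
  proof (rule integral_cong_AE)
    show "AE x in lebesgue_on \<Omega>. norm (d\<theta> x) = 0" using ae by eventually_elim simp
  qed (use C1c_measurable[OF C] in \<open>auto intro: borel_measurable_norm\<close>)
  then have "(LINT x|lborel. norm (d\<theta> x)) = 0" using e by simp
  moreover have "(LINT x|lborel. \<theta> x) \<le> R * (LINT x|lborel. norm (d\<theta> x))"
    by (rule Poincare_C1c[OF C R])
  moreover have "(LINT x|lborel. \<theta> x) \<ge> 0" using nn by simp
  ultimately have "(LINT x|lborel. \<theta> x) = 0" by simp
  then have "AE x in lborel. \<theta> x = 0"
    using integral_nonneg_eq_0_iff_AE[OF C1c_integrable(1)[OF C]] nn by simp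
  then have "AE x in lebesgue. \<theta> x = 0" by (rule AE_completion)
  then have "AE x in lebesgue. x \<in> \<Omega> \<longrightarrow> \<theta> x \<le> 0" by eventually_elim simp
  then have "AE x in lebesgue_on \<Omega>. \<theta> x \<le> 0" using S by (subst AE_restrict_space_iff) auto
  from continuous_AE_nonpos_imp_nonpos[OF \<Omega>(1) continuous_on_subset[OF c(1) subset_UNIV] this True]
  show ?thesis using nn[of x] by simp
qed

text \<open>The barrier solves \<open>-\<Delta>\<^sub>p v = c\<close> in the ball: its flux is the linear field
  \<open>-(c/N)(y - a)\<close>.\<close>

lemma plap_supersolution_ball_barrier:
  fixes \<Omega> :: "'a::euclidean_space set"
  assumes \<Omega>: "open \<Omega>" "bounded \<Omega>" and p: "1 < p" and sup: "plap_supersolution p \<Omega> \<rho> w dw"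
    and i\<rho>: "integrable (lebesgue_on \<Omega>) \<rho>"
    and d: "0 < d" "ball a d \<subseteq> \<Omega>" and c: "0 \<le> c" "\<And>y. y \<in> ball a d \<Longrightarrow> c \<le> \<rho> y"
    and y: "y \<in> ball a d" and q: "q = p / (p - 1)"
  shows "(c / DIM('a)) powr (1 / (p - 1)) / q * (d powr q - norm (y - a) powr q) \<le> w y"
proof (cases "c = 0")
  \<comment> \<open>A power of 0 is 0 under \<open>powr\<close>, so the claim reduces to
    \<open>0 \<le> w y\<close>.\<close>
  case True
  then show ?thesis using sup y d unfolding plap_supersolution_def by auto
next
  case False
  let ?M = "lebesgue_on \<Omega>" and ?B = "ball a d"
  have S: "\<Omega> \<in> sets lebesgue" using \<Omega> by auto
  have q1: "1 < q" using p unfolding q by (simp add: less_divide_eq)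
  \<comment> \<open>\<open>pfield p\<close> raises this factor to the power \<open>p - 1\<close>,
    which gives \<open>c / DIM('a)\<close>; the linear flux then has divergence
    \<open>- c\<close>.\<close>
  define \<kappa> where "\<kappa> = (c / DIM('a)) powr (1 / (p - 1))"
  have \<kappa>: "\<kappa> > 0" "\<kappa> powr (p - 1) = c / DIM('a)"
    using False c(1) p unfolding \<kappa>_def by (auto simp: powr_powr)
  define v where "v y = \<kappa> / q * (d powr q - norm (y - a) powr q)" for y
  define dv where "dv y = - (\<kappa> *\<^sub>R pfield q (y - a))" for y
  have dv: "(v has_derivative (\<lambda>h. dv y \<bullet> h)) (at y)" for y
  proof -
    have "((\<lambda>y. y - a) has_derivative (\<lambda>h. h)) (at y)" by (auto intro!: derivative_eq_intros)
    from has_derivative_compose[OF this has_derivative_norm_powr[OF q1]]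
    have "((\<lambda>y. norm (y - a) powr q) has_derivative (\<lambda>h. (q *\<^sub>R pfield q (y - a)) \<bullet> h)) (at y)" .
    from has_derivative_mult_right[OF has_derivative_diff[OF has_derivative_const this], of "\<kappa> / q" "d powr q"]
    show ?thesis unfolding v_def[abs_def] dv_def using q1 by (elim has_derivative_eq_rhs) auto
  qed
  have cdv: "continuous_on UNIV dv"
    unfolding dv_def
    by (intro continuous_on_minus continuous_on_scaleR continuous_on_const
        continuous_on_compose2[OF continuous_pfield[OF q1]] continuous_on_diff continuous_on_id) auto
  have cv: "continuous_on UNIV v"
    by (intro continuous_at_imp_continuous_on ballI) (rule has_derivative_continuous[OF dv])
  have flux: "pfield p (dv y) = - ((c / DIM('a)) *\<^sub>R (y - a))" for y
    unfolding dv_def pfield_uminus pfield_scaleR[OF \<kappa>(1)] pfield_conjugate[OF p q] \<kappa>(2) ..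
  have w: "\<And>x. x \<in> \<Omega> \<Longrightarrow> (w has_derivative (\<lambda>h. dw x \<bullet> h)) (at x)" "continuous_on \<Omega> dw"
    "\<And>x. x \<in> \<Omega> \<Longrightarrow> 0 \<le> w x"
    and wsup: "\<And>\<theta> d\<theta>. C1c \<Omega> \<theta> d\<theta> \<Longrightarrow> (\<And>x. 0 \<le> \<theta> x) \<Longrightarrow>
       (LINT x|?M. \<rho> x * \<theta> x) \<le> (LINT x|?M. pfield p (dw x) \<bullet> d\<theta> x)"
    using sup unfolding plap_supersolution_def by blast+
  have "v y - w y \<le> e" if e: "0 < e" for e
  proof -
    \<comment> \<open>\<open>v\<close> vanishes on the sphere, so its superlevel set at a positive
      \<open>e\<close> stays off it; since \<open>w\<close> is nonnegative, the positive part of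
      \<open>v - e - w\<close> has compact support in the ball. The level \<open>e\<close> is sent
      to 0 at the end.\<close>
    define K where "K = cball a d \<inter> v -` {e..}"
    have "closed (v -` {e..})"
      using cv by (intro closed_vimage closed_atLeast)
    then have K: "compact K" unfolding K_def by (intro compact_Int_closed compact_cball)
    have KB: "K \<subseteq> ?B"
    proof
      fix z assume z: "z \<in> K"
      have "norm (z - a) \<noteq> d"
      proof
        assume "norm (z - a) = d"
        then have "v z = 0" unfolding v_def by simp
        then show False using z e unfolding K_def by simp
      qed
      then show "z \<in> ?B" using z unfolding K_def by (simp add: dist_norm norm_minus_commute)
    qed
    define \<theta> where "\<theta> x = (if x \<in> ?B then smooth_pos (v x - e - w x) else 0)" for x
    define d\<theta> where "d\<theta> x = (if x \<in> ?B then smooth_pos' (v x - e - w x) *\<^sub>R (dv x - dw x) else 0)" for x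
    have CB: "C1c ?B \<theta> d\<theta>"
      unfolding \<theta>_def[abs_def] d\<theta>_def[abs_def]
    proof (rule C1c_smooth_pos_diff[OF open_ball K KB])
      show "((\<lambda>x. v x - e) has_derivative (\<lambda>h. dv x \<bullet> h)) (at x)" for x
        using has_derivative_diff[OF dv has_derivative_const] by simp
      show "continuous_on ?B dv" using cdv continuous_on_subset by blast
      show "(w has_derivative (\<lambda>h. dw x \<bullet> h)) (at x)" if "x \<in> ?B" for x using w(1) that d(2) by blast
      show "continuous_on ?B dw" using w(2) continuous_on_subset d(2) by blast
      show "v x - e \<le> w x" if "x \<in> ?B - K" for x
      proof -
        have "v x < e" using that unfolding K_def by auto
        moreover have "0 \<le> w x" using w(3) that d(2) by blast
        ultimately show ?thesis by simp
      qed
    qed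
    have C: "C1c \<Omega> \<theta> d\<theta>" using C1c_mono[OF CB d(2)] .
    have nn: "0 \<le> \<theta> x" for x unfolding \<theta>_def using smooth_pos_nonneg by simp
    have c\<theta>: "continuous_on UNIV \<theta>" "continuous_on UNIV d\<theta>"
      using C C1c_continuous unfolding C1c_def by blast+
    have z: "\<theta> x = 0" "d\<theta> x = 0" if "x \<notin> \<Omega>" for x using that d(2) unfolding \<theta>_def d\<theta>_def by auto
    \<comment> \<open>The barrier's equation is tested by direct computation: every coordinate of
      the linear flux contributes the same integral of \<open>\<theta>\<close>, and the
      \<open>DIM('a)\<close> equal terms cancel the denominator.\<close>
    have "(LINT x|?M. pfield p (dv x) \<bullet> d\<theta> x) = (LINT x|lborel. pfield p (dv x) \<bullet> d\<theta> x)"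
      unfolding flux using z c\<theta>
      by (intro integral_lebesgue_on_eq_lborel S continuous_on_inner continuous_on_minus continuous_on_scaleR
          continuous_on_const continuous_on_diff continuous_on_id) auto
    also have "\<dots> = (LINT x|lborel. - (c / DIM('a)) * (\<Sum>b\<in>Basis. ((x - a) \<bullet> b) * (d\<theta> x \<bullet> b)))"
    proof (intro Bochner_Integration.integral_cong refl)
      fix x
      have "pfield p (dv x) \<bullet> d\<theta> x = - (c / DIM('a)) * ((x - a) \<bullet> d\<theta> x)"
        unfolding flux inner_minus_left inner_scaleR_left by simp
      then show "pfield p (dv x) \<bullet> d\<theta> x = - (c / DIM('a)) * (\<Sum>b\<in>Basis. ((x - a) \<bullet> b) * (d\<theta> x \<bullet> b))"
        unfolding euclidean_inner[of "x - a" "d\<theta> x"] .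
    qed
    also have "\<dots> = - (c / DIM('a)) * (LINT x|lborel. (\<Sum>b\<in>Basis. ((x - a) \<bullet> b) * (d\<theta> x \<bullet> b)))"
      by (rule integral_mult_right_zero)
    also have "(LINT x|lborel. (\<Sum>b\<in>Basis. ((x - a) \<bullet> b) * (d\<theta> x \<bullet> b)))
      = (\<Sum>b\<in>Basis. (LINT x|lborel. ((x - a) \<bullet> b) * (d\<theta> x \<bullet> b)))"
      by (rule Bochner_Integration.integral_sum) (rule integral_C1c_by_parts(2)[OF C])
    also have "\<dots> = (\<Sum>b\<in>(Basis::'a set). - (LINT x|lborel. \<theta> x))"
      by (rule sum.cong[OF refl]) (rule integral_C1c_by_parts(1)[OF C])
    also have "- (c / DIM('a)) * \<dots> = c * (LINT x|lborel. \<theta> x)" by simp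
    also have "(LINT x|lborel. \<theta> x) = (LINT x|?M. \<theta> x)"
      using z by (intro integral_lebesgue_on_eq_lborel[symmetric] S c\<theta>) auto
    also have "c * (LINT x|?M. \<theta> x) = (LINT x|?M. c * \<theta> x)" by simp
    also have "\<dots> \<le> (LINT x|?M. \<rho> x * \<theta> x)"
    proof (rule integral_mono)
      obtain B where B: "0 < B" "\<And>x. \<bar>\<theta> x\<bar> \<le> B" "\<And>x. norm (d\<theta> x) \<le> B" using C1c_bounded[OF C] by metis
      show "integrable ?M (\<lambda>x. \<rho> x * \<theta> x)" by (rule integrable_mult_bounded[OF i\<rho> C1c_measurable(1)[OF C] B(2)])
      obtain L where L: "compact L" "L \<subseteq> \<Omega>" "\<And>x. x \<notin> L \<Longrightarrow> \<theta> x = 0" using C unfolding C1c_def by metis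
      have "integrable ?M \<theta>"
        by (rule integrable_bounded_support[OF C1c_measurable(1)[OF C] L(1) _ _ S, of B]) (use B L(3) in auto)
      then show "integrable ?M (\<lambda>x. c * \<theta> x)" by simp
      show "c * \<theta> x \<le> \<rho> x * \<theta> x" for x
      proof (cases "x \<in> ?B")
        case True
        then show ?thesis using c(2) nn by (intro mult_right_mono) auto
      qed (simp add: \<theta>_def)
    qed
    also have "\<dots> \<le> (LINT x|?M. pfield p (dw x) \<bullet> d\<theta> x)" by (rule wsup[OF C nn])
    finally have le: "(LINT x|?M. pfield p (dv x) \<bullet> d\<theta> x) \<le> (LINT x|?M. pfield p (dw x) \<bullet> d\<theta> x)" .
    have i1: "integrable ?M (\<lambda>x. pfield p (dv x) \<bullet> d\<theta> x)"
      by (rule integrable_pfield_inner_C1c[OF \<Omega>(1) continuous_on_subset[OF cdv subset_UNIV] p C])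
    have i2: "integrable ?M (\<lambda>x. pfield p (dw x) \<bullet> d\<theta> x)"
      by (rule integrable_pfield_inner_C1c[OF \<Omega>(1) w(2) p C])
    let ?D = "\<lambda>x. pfield p (dv x) \<bullet> d\<theta> x - pfield p (dw x) \<bullet> d\<theta> x"
    \<comment> \<open>The integrand is a nonnegative weight times the monotone pairing, while its
      integral is at most 0. So almost everywhere the weight or the pairing vanishes, and either one
      makes \<open>d\<theta>\<close> vanish.\<close>
    have De: "?D x = smooth_pos' (v x - e - w x) * ((pfield p (dv x) - pfield p (dw x)) \<bullet> (dv x - dw x))"
      if "x \<in> ?B" for x using that unfolding d\<theta>_def by (simp add: inner_diff_left inner_diff_right algebra_simps)
    have Dnn: "0 \<le> ?D x" for x
    proof (cases "x \<in> ?B")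
      case True
      show ?thesis unfolding De[OF True] by (rule mult_nonneg_nonneg[OF smooth_pos'_bounds(1) pfield_monotone[OF p]])
    qed (simp add: d\<theta>_def)
    have "(LINT x|?M. ?D x) \<le> 0" using le Bochner_Integration.integral_diff[OF i1 i2] by simp
    moreover have "(LINT x|?M. ?D x) \<ge> 0" using Dnn by (intro integral_nonneg_AE) auto
    ultimately have "(LINT x|?M. ?D x) = 0" by simp
    then have "AE x in ?M. ?D x = 0"
      using integral_nonneg_eq_0_iff_AE[OF Bochner_Integration.integrable_diff[OF i1 i2]] Dnn by simp
    then have "AE x in ?M. d\<theta> x = 0"
    proof eventually_elim
      fix x assume D: "?D x = 0"
      show "d\<theta> x = 0"
      proof (cases "x \<in> ?B")
        case True
        then have "smooth_pos' (v x - e - w x) = 0 \<or> (pfield p (dv x) - pfield p (dw x)) \<bullet> (dv x - dw x) = 0"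
          using D De[OF True] by simp
        then show ?thesis unfolding d\<theta>_def using pfield_strictly_monotone[OF p, of "dv x" "dw x"] by auto
      qed (simp add: d\<theta>_def)
    qed
    then have "\<theta> y = 0" by (rule C1c_AE_zero_gradient_imp_zero[OF C \<Omega> nn])
    then show ?thesis using y smooth_pos_eq_0_iff unfolding \<theta>_def by simp
  qed
  then have "v y - w y \<le> 0 + e" if "0 < e" for e using that by simp
  then have "v y - w y \<le> 0" by (rule field_le_epsilon)
  then show ?thesis unfolding v_def \<kappa>_def by simp
qed

section \<open>Comparison with a weak solution on the whole domain\<close>

lemma powr_add_le:
  fixes s t p :: real
  assumes "0 \<le> s" "0 \<le> t" "0 < p"
  shows "(s + t) powr p \<le> 2 powr p * (s powr p + t powr p)"
proof -
  have "(s + t) powr p \<le> (2 * max s t) powr p" using assms by (intro powr_mono2) auto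
  also have "\<dots> = 2 powr p * (max s t) powr p" using assms by (simp add: powr_mult)
  also have "\<dots> \<le> 2 powr p * (s powr p + t powr p)"
    by (intro mult_left_mono) (auto simp: max_def)
  finally show ?thesis .
qed

lemma integrable_powr_diff:
  fixes f g :: "'a \<Rightarrow> 'b::euclidean_space"
  assumes M: "finite_measure M" and f: "f \<in> borel_measurable M" "\<And>x. norm (f x) \<le> B"
    and g: "g \<in> borel_measurable M" "integrable M (\<lambda>x. norm (g x) powr p)" and p: "0 < p"
  shows "integrable M (\<lambda>x. norm (f x - g x) powr p)"
proof (rule Bochner_Integration.integrable_bound)
  show "integrable M (\<lambda>x. 2 powr p * (B powr p + norm (g x) powr p))"
    using g M finite_measure.integrable_const
    by (intro integrable_mult_right Bochner_Integration.integrable_add) auto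
  show "(\<lambda>x. norm (f x - g x) powr p) \<in> borel_measurable M" using f(1) g(1) by measurable
  show "AE x in M. norm (norm (f x - g x) powr p) \<le> norm (2 powr p * (B powr p + norm (g x) powr p))"
  proof (rule AE_I2)
    fix x
    have B: "0 \<le> B" using f(2)[of x] norm_ge_zero order.trans by blast
    have "norm (f x - g x) powr p \<le> (B + norm (g x)) powr p"
      using norm_triangle_ineq4[of "f x" "g x"] f(2)[of x] p by (intro powr_mono2) auto
    also have "\<dots> \<le> 2 powr p * (B powr p + norm (g x) powr p)" using B p by (intro powr_add_le) auto
    finally show "norm (norm (f x - g x) powr p) \<le> norm (2 powr p * (B powr p + norm (g x) powr p))"
      by simp
  qed
qed

lemma LIMSEQ_powr_zero_cancel:
  fixes s :: "nat \<Rightarrow> real"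
  assumes "(\<lambda>k. s k powr p) \<longlonglongrightarrow> 0" "\<And>k. 0 \<le> s k" "0 < p"
  shows "s \<longlonglongrightarrow> 0"
proof -
  have "(\<lambda>k. (s k powr p) powr (1 / p)) \<longlonglongrightarrow> 0"
    using assms by (intro tendsto_zero_powrI[OF assms(1) tendsto_const]) auto
  moreover have "(s k powr p) powr (1 / p) = s k" for k using assms(2)[of k] assms(3) by (simp add: powr_powr)
  ultimately show ?thesis by simp
qed

text \<open>The function \<open>w\<close> need not be in a global Sobolev space, so the test functions are positive parts of \<open>\<phi>\<^sub>k - w\<close> with
  \<open>\<phi>\<^sub>k\<close> test functions converging to \<open>\<psi>\<close>; they have compact support because \<open>w \<ge> 0\<close>.
  The monotonicity defect \<open>Md k\<close> tends to 0 in mean, which controls \<open>\<nabla>w\<close> in \<open>L\<^sup>p\<close>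
  on the sets \<open>{\<phi>\<^sub>k > w}\<close> by coercivity, and strict monotonicity then forces the gradients of the test
  functions to 0 in mean.\<close>

lemma plap_supersolution_ge_weak_solution:
  fixes \<Omega> :: "'a::euclidean_space set"
  assumes \<Omega>: "open \<Omega>" "bounded \<Omega>" and p: "1 < p" and sup: "plap_supersolution p \<Omega> \<rho> w dw"
    and i\<rho>: "integrable (lebesgue_on \<Omega>) \<rho>"
    and c\<psi>: "continuous_on \<Omega> \<psi>" and sol: "weak_solution_rhs p \<Omega> \<rho> \<psi>" and x0: "x0 \<in> \<Omega>"
  shows "\<psi> x0 \<le> w x0"
proof -
  let ?M = "lebesgue_on \<Omega>"
  have S: "\<Omega> \<in> sets lebesgue" using \<Omega> by auto
  have fin: "finite_measure ?M" using \<Omega> by (intro finite_measure_lebesgue_on lmeasurable_open)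
  obtain R where R: "\<And>x. x \<in> \<Omega> \<Longrightarrow> norm x \<le> R" using \<Omega>(2) unfolding bounded_iff by blast
  have w: "\<And>x. x \<in> \<Omega> \<Longrightarrow> (w has_derivative (\<lambda>h. dw x \<bullet> h)) (at x)" "continuous_on \<Omega> dw"
    "\<And>x. x \<in> \<Omega> \<Longrightarrow> 0 \<le> w x"
    and wsup: "\<And>\<theta> d\<theta>. C1c \<Omega> \<theta> d\<theta> \<Longrightarrow> (\<And>x. 0 \<le> \<theta> x) \<Longrightarrow>
       (LINT x|?M. \<rho> x * \<theta> x) \<le> (LINT x|?M. pfield p (dw x) \<bullet> d\<theta> x)"
    using sup unfolding plap_supersolution_def by blast+
  have cw: "continuous_on \<Omega> w"
    by (intro continuous_at_imp_continuous_on ballI, rule has_derivative_continuous, erule w(1))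
  have mw: "w \<in> borel_measurable ?M" "dw \<in> borel_measurable ?M"
    using continuous_imp_measurable_on_sets_lebesgue S cw w(2) by blast+
  obtain \<xi> where sob: "sobolev0 p \<Omega> \<psi> \<xi>" and weak: "\<forall>\<phi>. test_fun \<Omega> \<phi> \<longrightarrow>
        (LINT x:\<Omega>|lebesgue. (norm (\<xi> x) powr (p - 2) *\<^sub>R \<xi> x) \<bullet> grad \<phi> x)
          = (LINT x:\<Omega>|lebesgue. \<rho> x * \<phi> x)"
    using sol unfolding weak_solution_rhs_def by blast
  obtain \<phi> where t: "\<And>k. test_fun \<Omega> (\<phi> k)"
    and lim1: "(\<lambda>k. LINT x:\<Omega>|lebesgue. \<bar>\<phi> k x - \<psi> x\<bar> powr p) \<longlonglongrightarrow> 0"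
    and lim2: "(\<lambda>k. LINT x:\<Omega>|lebesgue. norm (grad (\<phi> k) x - \<xi> x) powr p) \<longlonglongrightarrow> 0"
    using sob unfolding sobolev0_def by blast
  have Lp: "Lp_on p \<Omega> \<psi>" "Lp_on p \<Omega> \<xi>" using sob unfolding sobolev0_def by auto
  have m\<psi>: "\<psi> \<in> borel_measurable ?M" and m\<xi>: "\<xi> \<in> borel_measurable ?M"
    and i\<psi>: "integrable ?M (\<lambda>x. norm (\<psi> x) powr p)" and i\<xi>: "integrable ?M (\<lambda>x. norm (\<xi> x) powr p)"
    using Lp S unfolding Lp_on_def by (auto simp: set_integrable_lebesgue_on)
  note C\<phi> = test_fun_C1c[OF t]
  note m\<phi> = C1c_measurable[OF C\<phi>, of _ \<Omega>]
  have d\<phi>: "(\<phi> k has_derivative (\<lambda>h. grad (\<phi> k) x \<bullet> h)) (at x)" and cg\<phi>: "continuous_on UNIV (grad (\<phi> k))" for k x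
    using C\<phi>[of k] unfolding C1c_def by blast+
  define a0 where "a0 k x = norm (\<phi> k x - \<psi> x) powr p" for k x
  define a where "a k x = norm (grad (\<phi> k) x - \<xi> x) powr p" for k x
  have ia0: "integrable ?M (a0 k)" and ia: "integrable ?M (a k)" for k
  proof -
    obtain B where B: "0 < B" "\<And>x. \<bar>\<phi> k x\<bar> \<le> B" "\<And>x. norm (grad (\<phi> k) x) \<le> B" using C1c_bounded[OF C\<phi>] by metis
    show "integrable ?M (a0 k)" unfolding a0_def[abs_def]
      by (rule integrable_powr_diff[OF fin m\<phi>(1) _ m\<psi> i\<psi>, of _ B]) (use B p in auto)
    show "integrable ?M (a k)" unfolding a_def[abs_def]
      by (rule integrable_powr_diff[OF fin m\<phi>(2) _ m\<xi> i\<xi>, of _ B]) (use B p in auto)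
  qed
  have a_nn: "0 \<le> a0 k x" "0 \<le> a k x" for k x unfolding a0_def a_def by auto
  have la0: "(\<lambda>k. LINT x|?M. a0 k x) \<longlonglongrightarrow> 0" and la: "(\<lambda>k. LINT x|?M. a k x) \<longlonglongrightarrow> 0"
    using lim1 lim2 S by (simp_all add: LINT_lebesgue_on a0_def a_def)
  \<comment> \<open>The weight that the estimates carry. It lies between 0 and 1 and vanishes where
    \<open>\<phi> k x \<le> w x\<close>, so within \<open>\<Omega>\<close> it lives on the support
    of \<open>\<phi> k\<close>.\<close>
  define \<gamma> where "\<gamma> k x = smooth_pos' (\<phi> k x - w x)" for k x
  have \<gamma>: "0 \<le> \<gamma> k x" "\<gamma> k x \<le> 1" for k x unfolding \<gamma>_def using smooth_pos'_bounds by auto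
  have m\<gamma>: "\<gamma> k \<in> borel_measurable ?M" for k
  proof -
    have "(\<lambda>x. \<phi> k x - w x) \<in> borel_measurable ?M" using m\<phi>(1) mw(1) by (rule borel_measurable_diff)
    from measurable_compose[OF this borel_measurable_continuous_onI[OF continuous_smooth_pos']]
    show ?thesis unfolding \<gamma>_def[abs_def] .
  qed
  define \<theta> where "\<theta> k x = (if x \<in> \<Omega> then smooth_pos (\<phi> k x - w x) else 0)" for k x
  define d\<theta> where "d\<theta> k x = (if x \<in> \<Omega> then \<gamma> k x *\<^sub>R (grad (\<phi> k) x - dw x) else 0)" for k x
  have ex: "\<exists>K. compact K \<and> K \<subseteq> \<Omega> \<and> (\<forall>x. x \<in> \<Omega> - K \<longrightarrow> \<phi> k x \<le> w x)" for k
  proof -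
    obtain K where "compact K" "K \<subseteq> \<Omega>" "\<And>x. x \<notin> K \<Longrightarrow> \<phi> k x = 0" using C\<phi>[of k] unfolding C1c_def by metis
    then show ?thesis using w(3) by (intro exI[of _ K]) auto
  qed
  have C: "C1c \<Omega> (\<theta> k) (d\<theta> k)" for k
  proof -
    obtain K where K: "compact K" "K \<subseteq> \<Omega>" "\<And>x. x \<in> \<Omega> - K \<Longrightarrow> \<phi> k x \<le> w x" using ex by blast
    show ?thesis unfolding \<theta>_def[abs_def] d\<theta>_def[abs_def] \<gamma>_def
      by (rule C1c_smooth_pos_diff[OF \<Omega>(1) K(1,2) d\<phi> continuous_on_subset[OF cg\<phi> subset_UNIV] w(1,2) K(3)])
  qed
  have \<theta>nn: "0 \<le> \<theta> k x" for k x unfolding \<theta>_def using smooth_pos_nonneg by simp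
  \<comment> \<open>The weight vanishes off a compact part of \<open>\<Omega>\<close>, so quantities
    built from \<open>dw\<close> need only be locally bounded.\<close>
  have ibs: "integrable ?M (\<lambda>x. \<gamma> k x * h x)"
    if mh: "h \<in> borel_measurable ?M" and bh: "\<And>K. compact K \<Longrightarrow> K \<subseteq> \<Omega> \<Longrightarrow> \<exists>B. \<forall>x\<in>K. \<bar>h x\<bar> \<le> B"
    for h :: "'a \<Rightarrow> real" and k
  proof -
    obtain K where K: "compact K" "K \<subseteq> \<Omega>" "\<And>x. x \<in> \<Omega> - K \<Longrightarrow> \<phi> k x \<le> w x" using ex by blast
    obtain B where B: "\<And>x. x \<in> K \<Longrightarrow> \<bar>h x\<bar> \<le> B" using bh[OF K(1,2)] by blast
    show ?thesis
    proof (rule integrable_bounded_support[OF _ K(1) _ _ S])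
      show "(\<lambda>x. \<gamma> k x * h x) \<in> borel_measurable ?M" using m\<gamma> mh by (rule borel_measurable_times)
      show "norm (\<gamma> k x * h x) \<le> B" if "x \<in> K" for x
        using mult_mono[OF \<gamma>(2)[of k x] B[OF that]] \<gamma>[of k x] by (simp add: abs_mult)
      show "\<gamma> k x * h x = 0" if "x \<in> \<Omega> - K" for x
        using K(3)[OF that] smooth_pos'_eq_0_iff unfolding \<gamma>_def by simp
    qed
  qed
  define X where "X = (LINT x|?M. norm (\<xi> x) powr p)"
  have X: "0 \<le> X" unfolding X_def by simp
  define b where "b k x = \<gamma> k x * norm (dw x) powr p" for k x
  have ib: "integrable ?M (b k)" for k
    unfolding b_def[abs_def]
  proof (rule ibs)
    show "(\<lambda>x. norm (dw x) powr p) \<in> borel_measurable ?M" using mw(2) by measurable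
    fix K assume K: "compact K" "K \<subseteq> \<Omega>"
    obtain B where B: "\<And>x. x \<in> K \<Longrightarrow> norm (dw x) \<le> B" "\<And>x. x \<in> K \<Longrightarrow> norm (pfield p (dw x)) \<le> B"
      using pfield_continuous_bounded_on_compact[OF K(1) continuous_on_subset[OF w(2) K(2)] p] by metis
    have "\<bar>norm (dw x) powr p\<bar> \<le> B powr p" if "x \<in> K" for x
      using B(1)[OF that] p by (auto intro: powr_mono2)
    then show "\<exists>B. \<forall>x\<in>K. \<bar>norm (dw x) powr p\<bar> \<le> B" by blast
  qed
  obtain c where c: "0 < c" and coer: "\<And>\<xi> \<eta> :: 'a.
      norm \<eta> powr p \<le> c * ((pfield p \<xi> - pfield p \<eta>) \<bullet> (\<xi> - \<eta>) + norm \<xi> powr p)"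
    using pfield_coercive[OF p] by metis
  define m where "m x = (pfield p (\<xi> x) - pfield p (dw x)) \<bullet> (\<xi> x - dw x)" for x
  have m: "0 \<le> m x" for x unfolding m_def by (rule pfield_monotone[OF p])
  define Md where "Md k x = \<gamma> k x * m x" for k x
  have Md: "0 \<le> Md k x" for k x unfolding Md_def using \<gamma> m by simp
  have b_le: "b k x \<le> c * (Md k x + norm (\<xi> x) powr p)" for k x
  proof -
    have "b k x \<le> \<gamma> k x * (c * (m x + norm (\<xi> x) powr p))"
      unfolding b_def m_def by (intro mult_left_mono coer \<gamma>)
    also have "\<dots> = c * (Md k x + \<gamma> k x * norm (\<xi> x) powr p)" unfolding Md_def by (simp add: algebra_simps)
    also have "\<dots> \<le> c * (Md k x + norm (\<xi> x) powr p)"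
      using c \<gamma>[of k x] by (intro mult_left_mono add_left_mono) (auto simp: mult_left_le_one_le)
    finally show ?thesis .
  qed
  \<comment> \<open>The error of testing with the gradient of \<open>\<phi> k\<close> in place of
    \<open>\<xi>\<close>, the weak gradient of \<open>\<psi>\<close>: the tested difference of
    fluxes \<open>N k\<close> splits into the defect \<open>Md k\<close> and this term.\<close>
  define E where "E k x = \<gamma> k x * ((pfield p (\<xi> x) - pfield p (dw x)) \<bullet> (grad (\<phi> k) x - \<xi> x))" for k x
  define N where "N k x = pfield p (\<xi> x) \<bullet> d\<theta> k x - pfield p (dw x) \<bullet> d\<theta> k x" for k x
  have NME: "N k x = Md k x + E k x" if "x \<in> \<Omega>" for k x
    using that unfolding N_def Md_def E_def m_def d\<theta>_def
    by (simp add: inner_diff_left inner_diff_right algebra_simps)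
  have iV: "integrable ?M (\<lambda>x. pfield p (\<xi> x))" by (rule integrable_pfield_Lp[OF \<Omega> Lp(2) p])
  have iN1: "integrable ?M (\<lambda>x. pfield p (\<xi> x) \<bullet> d\<theta> k x)" for k
  proof -
    obtain B where B: "0 < B" "\<And>x. \<bar>\<theta> k x\<bar> \<le> B" "\<And>x. norm (d\<theta> k x) \<le> B" using C1c_bounded[OF C] by metis
    show ?thesis by (rule integrable_inner_bounded[OF iV C1c_measurable(2)[OF C] B(3)])
  qed
  have iN2: "integrable ?M (\<lambda>x. pfield p (dw x) \<bullet> d\<theta> k x)" for k
    by (rule integrable_pfield_inner_C1c[OF \<Omega>(1) w(2) p C])
  have iN: "integrable ?M (N k)" for k
    unfolding N_def[abs_def] by (rule Bochner_Integration.integrable_diff[OF iN1 iN2])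
  \<comment> \<open>\<open>test_inequality_C1c\<close> applied to the negated flux and density turns
    the equation for \<open>\<psi>\<close> into an upper bound; the inequality for \<open>w\<close>
    gives the matching lower bound.\<close>
  have N0: "(LINT x|?M. N k x) \<le> 0" for k
  proof -
    have "(LINT x|?M. - \<rho> x * \<theta> k x) \<le> (LINT x|?M. (- pfield p (\<xi> x)) \<bullet> d\<theta> k x)"
    proof (rule test_inequality_C1c[OF \<Omega>(1) _ _ _ C \<theta>nn])
      show "integrable ?M (\<lambda>x. - pfield p (\<xi> x))" "integrable ?M (\<lambda>x. - \<rho> x)" using iV i\<rho> by auto
      fix f assume "test_fun \<Omega> f"
      then have "(LINT x|?M. pfield p (\<xi> x) \<bullet> grad f x) = (LINT x|?M. \<rho> x * f x)"
        using weak S unfolding pfield_def by (simp add: LINT_lebesgue_on)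
      then show "(LINT x|?M. - \<rho> x * f x) \<le> (LINT x|?M. (- pfield p (\<xi> x)) \<bullet> grad f x)"
        by simp
    qed
    then have "(LINT x|?M. pfield p (\<xi> x) \<bullet> d\<theta> k x) \<le> (LINT x|?M. \<rho> x * \<theta> k x)" by simp
    also have "\<dots> \<le> (LINT x|?M. pfield p (dw x) \<bullet> d\<theta> k x)" by (rule wsup[OF C \<theta>nn])
    finally show ?thesis
      unfolding N_def using Bochner_Integration.integral_diff[OF iN1 iN2, of k k] by simp
  qed
  \<comment> \<open>The small factor falls on the terms that need not tend to 0, and the large
    factor \<open>\<delta> powr (1 - p)\<close> on \<open>a k\<close>, whose integral does.\<close>
  have Ebound: "\<bar>E k x\<bar> \<le> \<delta> * norm (\<xi> x) powr p + \<delta> * b k x + 2 * \<delta> powr (1 - p) * a k x" if \<delta>: "0 < \<delta>" for \<delta> k x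
  proof -
    let ?t = "norm (grad (\<phi> k) x - \<xi> x)"
    have "\<bar>(pfield p (\<xi> x) - pfield p (dw x)) \<bullet> (grad (\<phi> k) x - \<xi> x)\<bar>
      \<le> norm (pfield p (\<xi> x) - pfield p (dw x)) * ?t" by (rule Cauchy_Schwarz_ineq2)
    also have "\<dots> \<le> (norm (\<xi> x) powr (p - 1) + norm (dw x) powr (p - 1)) * ?t"
      using norm_triangle_ineq4[of "pfield p (\<xi> x)" "pfield p (dw x)"] unfolding norm_pfield
      by (intro mult_right_mono) auto
    also have "\<dots> = norm (\<xi> x) powr (p - 1) * ?t + norm (dw x) powr (p - 1) * ?t" by (simp add: algebra_simps)
    also have "\<dots> \<le> (\<delta> * norm (\<xi> x) powr p + \<delta> powr (1 - p) * a k x) + (\<delta> * norm (dw x) powr p + \<delta> powr (1 - p) * a k x)"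
      unfolding a_def by (intro add_mono powr_Young) (use \<delta> p in auto)
    finally have 1: "\<bar>(pfield p (\<xi> x) - pfield p (dw x)) \<bullet> (grad (\<phi> k) x - \<xi> x)\<bar>
      \<le> \<delta> * norm (\<xi> x) powr p + 2 * \<delta> powr (1 - p) * a k x + \<delta> * norm (dw x) powr p" by (simp add: algebra_simps)
    have "\<bar>E k x\<bar> \<le> \<gamma> k x * (\<delta> * norm (\<xi> x) powr p + 2 * \<delta> powr (1 - p) * a k x + \<delta> * norm (dw x) powr p)"
      unfolding E_def abs_mult using \<gamma>(1)[of k x] mult_left_mono[OF 1 \<gamma>(1)[of k x]] by simp
    also have "\<dots> = \<gamma> k x * (\<delta> * norm (\<xi> x) powr p + 2 * \<delta> powr (1 - p) * a k x) + \<delta> * b k x"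
      unfolding b_def by (simp add: algebra_simps)
    also have "\<dots> \<le> (\<delta> * norm (\<xi> x) powr p + 2 * \<delta> powr (1 - p) * a k x) + \<delta> * b k x"
      using \<gamma>[of k x] a_nn(2)[of k x] \<delta> by (intro add_right_mono mult_left_le_one_le) auto
    finally show ?thesis by simp
  qed
  have mE: "E k \<in> borel_measurable ?M" for k
  proof -
    have "(\<lambda>x. pfield p (\<xi> x) - pfield p (dw x)) \<in> borel_measurable ?M"
      using measurable_compose[OF m\<xi> borel_measurable_pfield] measurable_compose[OF mw(2) borel_measurable_pfield]
      by (rule borel_measurable_diff)
    moreover have "(\<lambda>x. grad (\<phi> k) x - \<xi> x) \<in> borel_measurable ?M" using m\<phi>(2) m\<xi> by (rule borel_measurable_diff)
    ultimately show ?thesis unfolding E_def[abs_def] using m\<gamma>[of k] by measurable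
  qed
  have iE: "integrable ?M (E k)" for k
  proof (rule Bochner_Integration.integrable_bound[OF _ mE])
    show "integrable ?M (\<lambda>x. 1 * norm (\<xi> x) powr p + 1 * b k x + 2 * 1 powr (1 - p) * a k x)"
      using i\<xi> ib ia by (intro Bochner_Integration.integrable_add integrable_mult_right) auto
    show "AE x in ?M. norm (E k x) \<le> norm (1 * norm (\<xi> x) powr p + 1 * b k x + 2 * 1 powr (1 - p) * a k x)"
      using order.trans[OF Ebound[OF zero_less_one] abs_ge_self] by (intro AE_I2) (simp only: real_norm_def)
  qed
  \<comment> \<open>Finiteness of this integral is what later allows \<open>I k\<close> to be
    absorbed into the left side.\<close>
  have iMd: "integrable ?M (Md k)" for k
  proof -
    have "integrable ?M (\<lambda>x. N k x - E k x)" by (rule Bochner_Integration.integrable_diff[OF iN iE])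
    moreover have "integrable ?M (\<lambda>x. N k x - E k x) \<longleftrightarrow> integrable ?M (Md k)"
      by (rule Bochner_Integration.integrable_cong) (auto simp: NME)
    ultimately show ?thesis by simp
  qed
  define I where "I k = (LINT x|?M. Md k x)" for k
  have I: "0 \<le> I k" for k unfolding I_def using Md by (intro integral_nonneg_AE) auto
  \<comment> \<open>Coercivity bounds \<open>b k\<close> by the defect itself, so \<open>I k\<close>
    recurs on the right, but with the factor \<open>\<delta> * c\<close>.\<close>
  have Ib: "I k \<le> \<delta> * (1 + c) * X + \<delta> * c * I k + 2 * \<delta> powr (1 - p) * (LINT x|?M. a k x)" if \<delta>: "0 < \<delta>" for \<delta> k
  proof -
    have "I k = (LINT x|?M. N k x - E k x)"
      unfolding I_def by (intro Bochner_Integration.integral_cong) (auto simp: NME)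
    also have "\<dots> = (LINT x|?M. N k x) - (LINT x|?M. E k x)" by (rule Bochner_Integration.integral_diff[OF iN iE])
    also have "\<dots> \<le> - (LINT x|?M. E k x)" using N0[of k] by simp
    also have "\<dots> = (LINT x|?M. - E k x)" by simp
    also have "\<dots> \<le> (LINT x|?M. \<delta> * (1 + c) * norm (\<xi> x) powr p + \<delta> * c * Md k x + 2 * \<delta> powr (1 - p) * a k x)"
    proof (rule integral_mono)
      show "integrable ?M (\<lambda>x. - E k x)" using iE by simp
      show "integrable ?M (\<lambda>x. \<delta> * (1 + c) * norm (\<xi> x) powr p + \<delta> * c * Md k x + 2 * \<delta> powr (1 - p) * a k x)"
        using i\<xi> iMd ia by (intro Bochner_Integration.integrable_add integrable_mult_right) auto
      fix x
      have "\<delta> * b k x \<le> \<delta> * (c * (Md k x + norm (\<xi> x) powr p))" using b_le \<delta> by (intro mult_left_mono) auto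
      then show "- E k x \<le> \<delta> * (1 + c) * norm (\<xi> x) powr p + \<delta> * c * Md k x + 2 * \<delta> powr (1 - p) * a k x"
        using Ebound[OF \<delta>, of k x] by (simp add: algebra_simps)
    qed
    also have "\<dots> = \<delta> * (1 + c) * X + \<delta> * c * I k + 2 * \<delta> powr (1 - p) * (LINT x|?M. a k x)"
      unfolding X_def I_def using i\<xi> iMd ia by simp
    finally show ?thesis .
  qed
  have lI: "I \<longlonglongrightarrow> 0"
  proof (rule LIMSEQ_I)
    fix e :: real assume e: "0 < e"
    \<comment> \<open>The first entry lets half of \<open>I k\<close> absorb the recurring term; the
      second makes the fixed term at most \<open>e / 4\<close>, with \<open>X + 1\<close> guarding
      against \<open>X = 0\<close>. Absorption doubles what remains, hence \<open>e / 4\<close> here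
      and the factor 4 in \<open>D\<close>.\<close>
    define \<delta> where "\<delta> = min (1 / (2 * c)) (e / (4 * (1 + c) * (X + 1)))"
    have \<delta>: "0 < \<delta>" unfolding \<delta>_def using c e X by auto
    have \<delta>1: "\<delta> * c \<le> 1 / 2"
    proof -
      have "\<delta> * c \<le> 1 / (2 * c) * c" unfolding \<delta>_def using c by (intro mult_right_mono) auto
      then show ?thesis using c by simp
    qed
    have \<delta>2: "\<delta> * (1 + c) * X \<le> e / 4"
    proof -
      have "\<delta> * ((1 + c) * X) \<le> e / (4 * (1 + c) * (X + 1)) * ((1 + c) * X)"
        unfolding \<delta>_def using c X by (intro mult_right_mono) auto
      also have "\<dots> = e / 4 * (X / (X + 1))"
      proof -
        have "e / (4 * k * y) * (k * X) = e / 4 * (X / y)" if "k \<noteq> 0" for k y using that by simp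
        moreover have "1 + c \<noteq> 0" using c by simp
        ultimately show ?thesis by blast
      qed
      also have "\<dots> \<le> e / 4" using e X by (intro mult_left_le) auto
      finally show ?thesis by (simp add: mult.assoc)
    qed
    define D where "D = 4 * \<delta> powr (1 - p)"
    have D: "0 < D" unfolding D_def using \<delta> by simp
    have "eventually (\<lambda>k. (LINT x|?M. a k x) < e / (2 * D)) sequentially"
      using order_tendstoD(2)[OF la, of "e / (2 * D)"] e D by simp
    then obtain K where K: "\<And>k. k \<ge> K \<Longrightarrow> (LINT x|?M. a k x) < e / (2 * D)"
      unfolding eventually_sequentially by blast
    have "norm (I k - 0) < e" if "k \<ge> K" for k
    proof -
      have "\<delta> * c * I k \<le> 1 / 2 * I k" using \<delta>1 I by (intro mult_right_mono) auto
      then have "I k \<le> 2 * (\<delta> * (1 + c) * X) + D * (LINT x|?M. a k x)"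
        using Ib[OF \<delta>, of k] unfolding D_def by linarith
      also have "\<dots> < 2 * (e / 4) + D * (e / (2 * D))"
        using \<delta>2 mult_strict_left_mono[OF K[OF that] D] by linarith
      also have "\<dots> = e" using D by simp
      finally show ?thesis using I[of k] by simp
    qed
    then show "\<exists>K. \<forall>k\<ge>K. norm (I k - 0) < e" by blast
  qed
  \<comment> \<open>Adding up the three null sequences lets one subsequence serve for the almost
    everywhere convergence of all of them.\<close>
  define s where "s k x = a0 k x + a k x + Md k x" for k x
  have i_s: "integrable ?M (s k)" for k
    unfolding s_def[abs_def] using ia0 ia iMd by (intro Bochner_Integration.integrable_add)
  have s_nn: "0 \<le> s k x" for k x unfolding s_def using a_nn Md by (simp add: add_nonneg_nonneg)
  have "(\<lambda>k. (LINT x|?M. a0 k x) + (LINT x|?M. a k x) + I k) \<longlonglongrightarrow> 0 + 0 + 0"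
    by (intro tendsto_add la0 la lI)
  moreover have "(LINT x|?M. norm (s k x)) = (LINT x|?M. a0 k x) + (LINT x|?M. a k x) + I k" for k
  proof -
    have "(LINT x|?M. norm (s k x)) = (LINT x|?M. s k x)" using s_nn by simp
    also have "\<dots> = (LINT x|?M. a0 k x) + (LINT x|?M. a k x) + I k"
      unfolding s_def I_def using ia0 ia iMd by simp
    finally show ?thesis .
  qed
  ultimately have "(\<lambda>k. LINT x|?M. norm (s k x)) \<longlonglongrightarrow> 0" by simp
  then obtain r where r: "strict_mono r" and AEs: "AE x in ?M. (\<lambda>k. s (r k) x) \<longlonglongrightarrow> 0"
    using tendsto_L1_AE_subseq[where u = s, OF i_s] by metis
  have conv: "(\<lambda>k. \<phi> (r k) x) \<longlonglongrightarrow> \<psi> x" "(\<lambda>k. norm (grad (\<phi> (r k)) x - \<xi> x)) \<longlonglongrightarrow> 0"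
    "(\<lambda>k. Md (r k) x) \<longlonglongrightarrow> 0" "(\<lambda>k. a (r k) x) \<longlonglongrightarrow> 0"
    if s0: "(\<lambda>k. s (r k) x) \<longlonglongrightarrow> 0" for x
  proof -
    have sq: "h \<longlonglongrightarrow> 0" if "\<And>k. 0 \<le> h k" "\<And>k. h k \<le> s (r k) x" for h :: "nat \<Rightarrow> real"
      by (rule tendsto_sandwich[OF _ _ tendsto_const s0]) (use that in auto)
    have "(\<lambda>k. norm (\<phi> (r k) x - \<psi> x) powr p) \<longlonglongrightarrow> 0"
      using sq[of "\<lambda>k. a0 (r k) x"] a_nn Md unfolding s_def a0_def by (simp add: add_nonneg_nonneg)
    then have "(\<lambda>k. norm (\<phi> (r k) x - \<psi> x)) \<longlonglongrightarrow> 0" by (rule LIMSEQ_powr_zero_cancel) (use p in auto)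
    then show "(\<lambda>k. \<phi> (r k) x) \<longlonglongrightarrow> \<psi> x" by (rule LIM_zero_cancel[OF tendsto_norm_zero_cancel])
    show aa: "(\<lambda>k. a (r k) x) \<longlonglongrightarrow> 0"
      using sq[of "\<lambda>k. a (r k) x"] a_nn Md unfolding s_def by (simp add: add_nonneg_nonneg)
    then show "(\<lambda>k. norm (grad (\<phi> (r k)) x - \<xi> x)) \<longlonglongrightarrow> 0"
      unfolding a_def by (rule LIMSEQ_powr_zero_cancel) (use p in auto)
    show "(\<lambda>k. Md (r k) x) \<longlonglongrightarrow> 0"
      using sq[of "\<lambda>k. Md (r k) x"] a_nn Md unfolding s_def by (simp add: add_nonneg_nonneg)
  qed
  \<comment> \<open>No fixed integrable majorant is at hand for \<open>d\<theta> k\<close> itself.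
    The terms subtracted have integrals tending to 0, and the positive part of the remainder is
    dominated by a fixed integrable function of \<open>\<xi>\<close>.\<close>
  define h where "h k x = max 0 (norm (d\<theta> k x) - c * Md k x - a k x)" for k x
  have d\<theta>_le: "norm (d\<theta> k x) \<le> norm (grad (\<phi> k) x - \<xi> x) + \<gamma> k x * norm (\<xi> x - dw x)" if "x \<in> \<Omega>" for k x
  proof -
    have "norm (d\<theta> k x) = \<gamma> k x * norm ((grad (\<phi> k) x - \<xi> x) + (\<xi> x - dw x))"
      using that \<gamma> unfolding d\<theta>_def by simp
    also have "\<dots> \<le> \<gamma> k x * (norm (grad (\<phi> k) x - \<xi> x) + norm (\<xi> x - dw x))"
      using \<gamma> by (intro mult_left_mono norm_triangle_ineq) auto
    also have "\<dots> = \<gamma> k x * norm (grad (\<phi> k) x - \<xi> x) + \<gamma> k x * norm (\<xi> x - dw x)" by (simp add: algebra_simps)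
    also have "\<dots> \<le> norm (grad (\<phi> k) x - \<xi> x) + \<gamma> k x * norm (\<xi> x - dw x)"
      using \<gamma>[of k x] by (intro add_right_mono mult_left_le_one_le) auto
    finally show ?thesis .
  qed
  have le1: "t \<le> 1 + t powr p" if "0 \<le> t" for t :: real
    using powr_Young[of 1 t 1 p] that p by simp
  have h_le: "h k x \<le> 3 + (1 + c) * norm (\<xi> x) powr p" if x: "x \<in> \<Omega>" for k x
  proof -
    have "\<gamma> k x * norm (\<xi> x - dw x) \<le> \<gamma> k x * (norm (\<xi> x) + norm (dw x))"
      using \<gamma> by (intro mult_left_mono norm_triangle_ineq4) auto
    also have "\<dots> \<le> \<gamma> k x * ((1 + norm (\<xi> x) powr p) + (1 + norm (dw x) powr p))"
      using \<gamma> le1 by (intro mult_left_mono add_mono) auto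
    also have "\<dots> = \<gamma> k x * (2 + norm (\<xi> x) powr p) + b k x" unfolding b_def by (simp add: algebra_simps)
    also have "\<dots> \<le> (2 + norm (\<xi> x) powr p) + c * (Md k x + norm (\<xi> x) powr p)"
      using \<gamma>[of k x] b_le by (intro add_mono mult_left_le_one_le) auto
    finally have "\<gamma> k x * norm (\<xi> x - dw x) \<le> 2 + (1 + c) * norm (\<xi> x) powr p + c * Md k x" by (simp add: algebra_simps)
    moreover have "norm (grad (\<phi> k) x - \<xi> x) \<le> 1 + a k x" unfolding a_def by (rule le1) simp
    ultimately have "norm (d\<theta> k x) - c * Md k x - a k x \<le> 3 + (1 + c) * norm (\<xi> x) powr p"
      using d\<theta>_le[OF x, of k] by linarith
    moreover have "0 \<le> 3 + (1 + c) * norm (\<xi> x) powr p" using c by (intro add_nonneg_nonneg mult_nonneg_nonneg) auto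
    ultimately show ?thesis unfolding h_def by simp
  qed
  have mh: "h k \<in> borel_measurable ?M" for k
  proof -
    have "d\<theta> k \<in> borel_measurable ?M" "Md k \<in> borel_measurable ?M" "a k \<in> borel_measurable ?M"
      using C1c_measurable(2)[OF C] iMd ia by auto
    then show ?thesis unfolding h_def[abs_def] by measurable
  qed
  have iD: "integrable ?M (\<lambda>x. 3 + (1 + c) * norm (\<xi> x) powr p)"
    using i\<xi> finite_measure.integrable_const[OF fin] by (intro Bochner_Integration.integrable_add) auto
  have h0: "(\<lambda>k. h (r k) x) \<longlonglongrightarrow> 0" if s0: "(\<lambda>k. s (r k) x) \<longlonglongrightarrow> 0" and x: "x \<in> \<Omega>" for x
  proof -
    have "isCont smooth_pos' (\<psi> x - w x)"
      using continuous_smooth_pos' by (simp add: continuous_on_eq_continuous_at)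
    then have g: "(\<lambda>k. \<gamma> (r k) x) \<longlonglongrightarrow> smooth_pos' (\<psi> x - w x)"
      unfolding \<gamma>_def by (rule isCont_tendsto_compose) (intro tendsto_diff conv(1)[OF s0] tendsto_const)
    have "(\<lambda>k. \<gamma> (r k) x * norm (\<xi> x - dw x)) \<longlonglongrightarrow> 0"
    \<comment> \<open>If the limit weight is 0, so is the limit of the product. Otherwise
      \<open>Md\<close> tending to 0 forces \<open>m x = 0\<close>, and strict monotonicity gives
      \<open>\<xi> x = dw x\<close>.\<close>
    proof (cases "smooth_pos' (\<psi> x - w x) = 0")
      case True
      then show ?thesis using tendsto_mult[OF g tendsto_const, of "norm (\<xi> x - dw x)"] by simp
    next
      case False
      have "(\<lambda>k. Md (r k) x) \<longlonglongrightarrow> smooth_pos' (\<psi> x - w x) * m x"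
        unfolding Md_def by (intro tendsto_mult g tendsto_const)
      then have "smooth_pos' (\<psi> x - w x) * m x = 0" using conv(3)[OF s0] LIMSEQ_unique by blast
      then have "m x = 0" using False by simp
      then have "\<xi> x = dw x" unfolding m_def by (rule pfield_strictly_monotone[OF p])
      then show ?thesis by simp
    qed
    from tendsto_add[OF conv(2)[OF s0] this]
    have lim: "(\<lambda>k. norm (grad (\<phi> (r k)) x - \<xi> x) + \<gamma> (r k) x * norm (\<xi> x - dw x)) \<longlonglongrightarrow> 0" by simp
    have ub: "h (r k) x \<le> norm (grad (\<phi> (r k)) x - \<xi> x) + \<gamma> (r k) x * norm (\<xi> x - dw x)" for k
    proof -
      have "0 \<le> c * Md (r k) x" using c Md by simp
      then have "norm (d\<theta> (r k) x) - c * Md (r k) x - a (r k) x \<le> norm (grad (\<phi> (r k)) x - \<xi> x) + \<gamma> (r k) x * norm (\<xi> x - dw x)"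
        using d\<theta>_le[OF x, of "r k"] a_nn(2)[of "r k" x] by linarith
      moreover have "0 \<le> norm (grad (\<phi> (r k)) x - \<xi> x) + \<gamma> (r k) x * norm (\<xi> x - dw x)"
        using \<gamma> by (intro add_nonneg_nonneg mult_nonneg_nonneg) auto
      ultimately show ?thesis unfolding h_def by simp
    qed
    show ?thesis
      by (rule tendsto_sandwich[OF _ _ tendsto_const lim]) (use ub in \<open>auto simp: h_def\<close>)
  qed
  have lh: "(\<lambda>k. LINT x|?M. h (r k) x) \<longlonglongrightarrow> (LINT x|?M. 0)"
  proof (rule integral_dominated_convergence[OF _ mh iD])
    show "AE x in ?M. (\<lambda>k. h (r k) x) \<longlonglongrightarrow> 0"
      using AEs AE_space by eventually_elim (auto intro: h0)
    show "AE x in ?M. norm (h (r k) x) \<le> 3 + (1 + c) * norm (\<xi> x) powr p" for k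
      using AE_space by eventually_elim (use h_le in \<open>auto simp: h_def\<close>)
  qed simp
  have ih: "integrable ?M (h k)" for k
  proof (rule Bochner_Integration.integrable_bound[OF iD mh])
    show "AE x in ?M. norm (h k x) \<le> norm (3 + (1 + c) * norm (\<xi> x) powr p)"
      using AE_space by eventually_elim (use h_le in \<open>force simp: h_def\<close>)
  qed
  have \<theta>int: "(LINT x|?M. norm (\<theta> k x)) \<le> \<bar>R\<bar> * ((LINT x|?M. h k x) + c * I k + (LINT x|?M. a k x))" for k
  proof -
    have c\<theta>: "continuous_on UNIV (\<theta> k)" "continuous_on UNIV (d\<theta> k)"
      using C C1c_continuous unfolding C1c_def by blast+
    have z: "\<theta> k x = 0" "d\<theta> k x = 0" if "x \<notin> \<Omega>" for x using that unfolding \<theta>_def d\<theta>_def by auto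
    have "(LINT x|?M. norm (\<theta> k x)) = (LINT x|?M. \<theta> k x)" using \<theta>nn by simp
    also have "\<dots> = (LINT x|lborel. \<theta> k x)" using z by (intro integral_lebesgue_on_eq_lborel S c\<theta>) auto
    also have "\<dots> \<le> \<bar>R\<bar> * (LINT x|lborel. norm (d\<theta> k x))"
      by (rule Poincare_C1c[OF C]) (use R in force)
    also have "(LINT x|lborel. norm (d\<theta> k x)) = (LINT x|?M. norm (d\<theta> k x))"
      using z by (intro integral_lebesgue_on_eq_lborel[symmetric] S continuous_on_norm c\<theta>) auto
    also have "(LINT x|?M. norm (d\<theta> k x)) \<le> (LINT x|?M. h k x + c * Md k x + a k x)"
    proof (rule integral_mono)
      obtain B where B: "0 < B" "\<And>x. \<bar>\<theta> k x\<bar> \<le> B" "\<And>x. norm (d\<theta> k x) \<le> B" using C1c_bounded[OF C] by metis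
      show "integrable ?M (\<lambda>x. norm (d\<theta> k x))"
        by (rule finite_measure.integrable_const_bound[OF fin, of _ B])
           (use B(3) C1c_measurable(2)[OF C] in \<open>auto intro: borel_measurable_norm\<close>)
      show "integrable ?M (\<lambda>x. h k x + c * Md k x + a k x)"
        using ih iMd ia by (intro Bochner_Integration.integrable_add integrable_mult_right) auto
      show "norm (d\<theta> k x) \<le> h k x + c * Md k x + a k x" for x unfolding h_def by simp
    qed
    also have "\<dots> = (LINT x|?M. h k x) + c * I k + (LINT x|?M. a k x)"
      unfolding I_def using ih iMd ia by simp
    finally show ?thesis by (simp add: mult_left_mono)
  qed
  have "(\<lambda>k. \<bar>R\<bar> * ((LINT x|?M. h (r k) x) + c * I (r k) + (LINT x|?M. a (r k) x))) \<longlonglongrightarrow> \<bar>R\<bar> * ((LINT x|?M. 0) + c * 0 + 0)"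
    using LIMSEQ_subseq_LIMSEQ[OF lI r] LIMSEQ_subseq_LIMSEQ[OF la r]
    by (intro tendsto_mult tendsto_add tendsto_const lh) (simp_all add: o_def)
  then have L: "(\<lambda>k. \<bar>R\<bar> * ((LINT x|?M. h (r k) x) + c * I (r k) + (LINT x|?M. a (r k) x))) \<longlonglongrightarrow> 0" by simp
  have l\<theta>: "(\<lambda>k. LINT x|?M. norm (\<theta> (r k) x)) \<longlonglongrightarrow> 0"
    by (rule tendsto_sandwich[OF _ _ tendsto_const L]) (use \<theta>int in \<open>auto intro!: always_eventually\<close>)
  have i\<theta>: "integrable ?M (\<theta> k)" for k
  proof -
    obtain B where B: "0 < B" "\<And>x. \<bar>\<theta> k x\<bar> \<le> B" "\<And>x. norm (d\<theta> k x) \<le> B" using C1c_bounded[OF C] by metis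
    show ?thesis
      by (rule finite_measure.integrable_const_bound[OF fin, of _ B]) (use B(2) C1c_measurable(1)[OF C] in auto)
  qed
  \<comment> \<open>A further subsequence makes the test functions converge to 0 pointwise, whereas
    by convergence of the approximants their limit is
    \<open>smooth_pos (\<psi> x - w x)\<close>.\<close>
  obtain r' where r': "strict_mono r'" and AE\<theta>: "AE x in ?M. (\<lambda>k. \<theta> (r (r' k)) x) \<longlonglongrightarrow> 0"
    using tendsto_L1_AE_subseq[where u = "\<lambda>k. \<theta> (r k)", OF i\<theta> l\<theta>] by metis
  have "AE x in ?M. \<psi> x - w x \<le> 0"
    using AE\<theta> AEs AE_space
  proof eventually_elim
    fix x assume \<theta>0: "(\<lambda>k. \<theta> (r (r' k)) x) \<longlonglongrightarrow> 0" and s0: "(\<lambda>k. s (r k) x) \<longlonglongrightarrow> 0" and "x \<in> space ?M"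
    then have x: "x \<in> \<Omega>" by simp
    have "isCont smooth_pos (\<psi> x - w x)" by (rule DERIV_isCont[OF DERIV_smooth_pos])
    moreover have "(\<lambda>k. \<phi> (r (r' k)) x - w x) \<longlonglongrightarrow> \<psi> x - w x"
      using LIMSEQ_subseq_LIMSEQ[OF conv(1)[OF s0] r'] by (intro tendsto_diff tendsto_const) (simp add: o_def)
    ultimately have "(\<lambda>k. smooth_pos (\<phi> (r (r' k)) x - w x)) \<longlonglongrightarrow> smooth_pos (\<psi> x - w x)"
      by (rule isCont_tendsto_compose)
    then have "(\<lambda>k. \<theta> (r (r' k)) x) \<longlonglongrightarrow> smooth_pos (\<psi> x - w x)" using x by (simp add: \<theta>_def)
    then have "smooth_pos (\<psi> x - w x) = 0" using \<theta>0 LIMSEQ_unique by blast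
    then show "\<psi> x - w x \<le> 0" by (simp add: smooth_pos_eq_0_iff)
  qed
  from continuous_AE_nonpos_imp_nonpos[OF \<Omega>(1) continuous_on_diff[OF c\<psi> cw] this x0]
  show ?thesis by simp
qed

text \<open>A ball is connected, so one centred in \<open>\<Omega>\<close> that leaves
  \<open>\<Omega>\<close> meets the frontier at a distance below its radius. Boundedness makes the
  frontier nonempty, which matters because \<open>infdist\<close> to the empty set is 0.\<close>

lemma dOmega_pos_ball_subset:
  assumes \<Omega>: "open \<Omega>" "bounded \<Omega>" and x: "x \<in> \<Omega>"
  shows "0 < dOmega \<Omega> x" "ball x (dOmega \<Omega> x) \<subseteq> \<Omega>"
proof -
  have "\<Omega> \<noteq> UNIV" using \<Omega>(2) not_bounded_UNIV by auto
  then have ne: "frontier \<Omega> \<noteq> {}" using x frontier_eq_empty by blast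
  have "x \<notin> frontier \<Omega>" using \<Omega>(1) x by (simp add: frontier_def interior_open)
  then show "0 < dOmega \<Omega> x"
    unfolding dOmega_def using infdist_pos_not_in_closed[OF frontier_closed ne] by blast
  then have xb: "x \<in> ball x (dOmega \<Omega> x)" by simp
  show "ball x (dOmega \<Omega> x) \<subseteq> \<Omega>"
  proof (rule ccontr)
    assume "\<not> ball x (dOmega \<Omega> x) \<subseteq> \<Omega>"
    then obtain z where z: "z \<in> ball x (dOmega \<Omega> x)" "z \<in> frontier \<Omega>"
      using connected_Int_frontier[OF connected_ball, of x "dOmega \<Omega> x" \<Omega>] xb x by blast
    then show False using infdist_le[OF z(2), of x] unfolding dOmega_def by simp
  qed
qed

theorem theorem2p2:
  fixes \<Omega> :: "'a::euclidean_space set" and p :: real and \<rho> :: "'a \<Rightarrow> real"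
    and f :: "real \<Rightarrow> real" and af :: ereal and u :: "'a \<Rightarrow> real"
  assumes dom: "smooth_bounded_domain \<Omega>"
    and p: "p > 1"
    and rho_bdd: "bounded (\<rho> ` \<Omega>)"
    and rho_nonneg: "\<forall>x\<in>\<Omega>. 0 \<le> \<rho> x"
    and rho_nz: "\<exists>x\<in>\<Omega>. \<rho> x \<noteq> 0"
    and fC: "condC f af"
    and fint: "\<forall>a. 0 < a \<and> ereal a < af \<longrightarrow>
                 set_integrable lborel {0<..<a} (\<lambda>s. f s powr (- 1 / (p - 1)))"
    and uC1: "C1_on \<Omega> u"
    and usup: "supersolution p \<Omega> \<rho> f u"
    and upos: "\<forall>x\<in>\<Omega>. 0 < u x \<and> ereal (u x) < af"
  shows
    "(\<forall>\<psi>. continuous_on \<Omega> \<psi> \<and> weak_solution_rhs p \<Omega> \<rho> \<psi> \<longrightarrow>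
          (\<forall>x\<in>\<Omega>. Fint p f (u x) \<ge> \<psi> x))
     \<and> (\<forall>x\<in>\<Omega>. \<forall>y. dist y x < dOmega \<Omega> x \<longrightarrow>
          Fint p f (u y) \<ge> (p - 1) / p * rho_inf \<rho> x (dOmega \<Omega> x) powr (1 / (p - 1))
             * (dOmega \<Omega> x powr (p / (p - 1)) - dist x y powr (p / (p - 1)))
             / real DIM('a) powr (1 / (p - 1)))
     \<and> (\<forall>x\<in>\<Omega>. Fint p f (u x) \<ge>
          (p - 1) / p * (rho_inf \<rho> x (dOmega \<Omega> x) * dOmega \<Omega> x powr p / real DIM('a)) powr (1 / (p - 1)))"
proof -
  have \<Omega>: "open \<Omega>" "connected \<Omega>" "\<Omega> \<noteq> {}" "bounded \<Omega>"
    using dom unfolding smooth_bounded_domain_def by auto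
  let ?w = "\<lambda>x. Fint p f (u x)" and ?dw = "\<lambda>x. f (u x) powr (- 1 / (p - 1)) *\<^sub>R grad u x"
  note tr = supersolution_transform[OF \<Omega>(1,4) p rho_bdd fC fint uC1 usup upos]
  \<comment> \<open>The factor \<open>(p - 1) / p\<close> of the statement is \<open>1 / q\<close>;
    it compensates the \<open>q\<close> that differentiating the power in the barrier
    produces.\<close>
  define q where "q = p / (p - 1)"
  have i: "\<psi> x \<le> Fint p f (u x)" if "continuous_on \<Omega> \<psi>" "weak_solution_rhs p \<Omega> \<rho> \<psi>" "x \<in> \<Omega>" for \<psi> x
    by (rule plap_supersolution_ge_weak_solution[OF \<Omega>(1,4) p tr(2,1) that])
  have ball: "0 < dOmega \<Omega> x" "ball x (dOmega \<Omega> x) \<subseteq> \<Omega>" if "x \<in> \<Omega>" for x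
    using dOmega_pos_ball_subset[OF \<Omega>(1,4) that] by auto
  have \<rho>: "0 \<le> rho_inf \<rho> x (dOmega \<Omega> x)" "\<And>y. y \<in> ball x (dOmega \<Omega> x) \<Longrightarrow> rho_inf \<rho> x (dOmega \<Omega> x) \<le> \<rho> y"
    if "x \<in> \<Omega>" for x
  proof -
    have nn: "0 \<le> \<rho> y" if "y \<in> ball x (dOmega \<Omega> x)" for y using rho_nonneg ball(2)[OF \<open>x \<in> \<Omega>\<close>] that by blast
    show "0 \<le> rho_inf \<rho> x (dOmega \<Omega> x)"
      unfolding rho_inf_def using ball(1)[OF that] nn by (intro cINF_greatest) auto
    show "rho_inf \<rho> x (dOmega \<Omega> x) \<le> \<rho> y" if "y \<in> ball x (dOmega \<Omega> x)" for y
      unfolding rho_inf_def using nn that by (intro cINF_lower bdd_belowI2[of _ 0]) auto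
  qed
  have ii: "Fint p f (u y) \<ge> (p - 1) / p * rho_inf \<rho> x (dOmega \<Omega> x) powr (1 / (p - 1))
             * (dOmega \<Omega> x powr (p / (p - 1)) - dist x y powr (p / (p - 1)))
             / real DIM('a) powr (1 / (p - 1))" if x: "x \<in> \<Omega>" and y: "dist y x < dOmega \<Omega> x" for x y
  proof -
    have "(rho_inf \<rho> x (dOmega \<Omega> x) / DIM('a)) powr (1 / (p - 1)) / q * (dOmega \<Omega> x powr q - norm (y - x) powr q) \<le> ?w y"
      by (rule plap_supersolution_ball_barrier[OF \<Omega>(1,4) p tr(2,1) ball[OF x] \<rho>[OF x] _ q_def])
         (use y in \<open>auto simp: dist_commute\<close>)
    moreover have "norm (y - x) = dist x y" by (simp add: dist_norm norm_minus_commute)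
    moreover have "(rho_inf \<rho> x (dOmega \<Omega> x) / DIM('a)) powr (1 / (p - 1))
      = rho_inf \<rho> x (dOmega \<Omega> x) powr (1 / (p - 1)) / real DIM('a) powr (1 / (p - 1))"
      by (rule powr_divide)
    ultimately show ?thesis unfolding q_def by (simp add: mult_ac)
  qed
  have iii: "Fint p f (u x) \<ge>
      (p - 1) / p * (rho_inf \<rho> x (dOmega \<Omega> x) * dOmega \<Omega> x powr p / real DIM('a)) powr (1 / (p - 1))"
    if x: "x \<in> \<Omega>" for x
  proof -
    \<comment> \<open>The bound at the centre is the case \<open>y = x\<close> of \<open>ii\<close>,
      where the subtracted power is 0; here the exponent \<open>1 / (p - 1)\<close> is distributed
      over the product to match.\<close>
    have "(rho_inf \<rho> x (dOmega \<Omega> x) * dOmega \<Omega> x powr p / real DIM('a)) powr (1 / (p - 1))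
      = rho_inf \<rho> x (dOmega \<Omega> x) powr (1 / (p - 1)) * dOmega \<Omega> x powr (p / (p - 1)) / real DIM('a) powr (1 / (p - 1))"
      using \<rho>(1)[OF x] ball(1)[OF x] by (simp add: powr_divide powr_mult powr_powr)
    then show ?thesis using ii[OF x, of x] ball(1)[OF x] by simp
  qed
  show ?thesis using i ii iii by blast
qed

end
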